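(* Let $0<\alpha\le1/2$, $a_0=\Gamma(1-\alpha)$, and $$Q_3=\frac{\Gamma(1-\alpha)^2\,\Gamma(1-3\alpha/2)}{\Gamma(1-\alpha/2)},\qquad r_\alpha=\Bigl(\frac{Q_3}{a_0^3}-1\Bigr)^{1/3}.$$ Let $P$ be the orthogonal projection onto the constant function $\mathbf1$ in $L^2(\nu)$, let $C=(I-P)S_\alpha(I-P)$ on $\mathbf1^\perp$, and $b=(I-P)S_\alpha\mathbf1$. Then $$\|C\|\le a_0r_\alpha,\qquad 0<r_\alpha\le r_*:=\Bigl(\frac{\Gamma(1/4)}{\sqrt\pi\,\Gamma(3/4)}-1\Bigr)^{1/3}<1.$$ Put $\mu_j=\langle b,C^jb\rangle\ge0$ for $j\ge0$. The leading eigenvalue $\lambda$ of $S_\alpha$ is the unique real solution greater than $a_0$ of $$\lambda=a_0+\sum_{j=0}^\infty\frac{\mu_j}{\lambda^{j+1}}.$$ If $\lambda_N>a_0$ solves the equation truncated after $j=N$, i.e. $\lambda_N=a_0+\sum_{j=0}^N\mu_j\lambda_N^{-j-1}$, then $\lambda_N\uparrow\lambda$ as $N\to\infty$ and $$0\le\frac{\lambda-\lambda_N}{a_0}\le\frac{r_*^{N+4}}{3(1-r_* )}.$$ In particular, the same geometric rate holds for all $0<\alpha\le1/2$, so the convergence rate does not deteriorate at $\alpha=1/2$.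
   Context: Let $\nu(du)=e^{-u}\,du$ on $[0,\infty)$, a probability measure. For $0<\alpha<1$, $S_\alpha$ is the positive compact self-adjoint operator on $L^2(\nu)$ given by $(S_\alpha h)(u)=\int_0^\infty|u-v|^{-\alpha}h(v)e^{-v}\,dv$. $\langle\cdot,\cdot\rangle$ is the inner product of $L^2(\nu)$ and $\|C\|$ is the operator norm. *)

theory Defs
  imports "HOL-Analysis.Analysis"
begin

section \<open>The measure\<close>

text \<open>The measure \<open>e\<^sup>-\<^sup>u du\<close> on \<open>[0, \<infinity>)\<close>, realised on the Borel sets of the real line; the negative
  half-line is a null set.\<close>

definition nu :: "real measure" where
  "nu = density lborel (\<lambda>u. ennreal (exp (- u)) * indicator {0..} u)"

lemma sets_nu [measurable_cong, simp]: "sets nu = sets borel"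
  by (simp add: nu_def)

lemma space_nu [simp]: "space nu = UNIV"
  by (simp add: nu_def)

lemma prob_nu: "emeasure nu UNIV = 1"
proof -
  have "(\<integral>\<^sup>+u. ennreal (exp (- u)) * indicator {0..} u \<partial>lborel) = ennreal 1"
    using has_integral_exp_minus_to_infinity[of 1 0]
    by (intro nn_integral_has_integral_lebesgue') auto
  then show ?thesis
    by (simp add: nu_def emeasure_density)
qed

interpretation nu: finite_measure nu
  by standard (simp add: prob_nu)


section \<open>The real Hilbert space of square integrable functions\<close>

definition sq_integrable :: "(real \<Rightarrow> real) \<Rightarrow> bool" where
  "sq_integrable f \<longleftrightarrow> f \<in> borel_measurable nu \<and> integrable nu (\<lambda>u. (f u)\<^sup>2)"

lemma sq_integrable_measurable: "sq_integrable f \<Longrightarrow> f \<in> borel_measurable borel"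
  by (simp add: sq_integrable_def cong: measurable_cong_sets)

lemma sq_integrable_mult:
  assumes "sq_integrable f" "sq_integrable g"
  shows "integrable nu (\<lambda>u. f u * g u)"
proof (rule Bochner_Integration.integrable_bound)
  show "integrable nu (\<lambda>u. (f u)\<^sup>2 + (g u)\<^sup>2)"
    using assms by (auto simp: sq_integrable_def)
  show "(\<lambda>u. f u * g u) \<in> borel_measurable nu"
    using assms by (auto simp: sq_integrable_def)
  have "\<bar>x * y\<bar> \<le> x\<^sup>2 + y\<^sup>2" for x y :: real
  proof -
    have "0 \<le> (\<bar>x\<bar> - \<bar>y\<bar>)\<^sup>2" by simp
    then have "2 * (\<bar>x\<bar> * \<bar>y\<bar>) \<le> x\<^sup>2 + y\<^sup>2" by (simp add: power2_diff)
    moreover have "0 \<le> \<bar>x\<bar> * \<bar>y\<bar>" by simp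
    ultimately have "\<bar>x\<bar> * \<bar>y\<bar> \<le> x\<^sup>2 + y\<^sup>2" by linarith
    then show ?thesis by (simp add: abs_mult)
  qed
  then show "AE u in nu. norm (f u * g u) \<le> norm ((f u)\<^sup>2 + (g u)\<^sup>2)"
    by auto
qed

lemma sq_integrable_add:
  assumes "sq_integrable f" "sq_integrable g"
  shows "sq_integrable (\<lambda>u. f u + g u)"
  unfolding sq_integrable_def
proof
  show "(\<lambda>u. f u + g u) \<in> borel_measurable nu"
    using assms by (auto simp: sq_integrable_def)
  have "integrable nu (\<lambda>u. (f u)\<^sup>2 + (g u)\<^sup>2 + 2 * (f u * g u))"
    using assms sq_integrable_mult[OF assms] by (auto simp: sq_integrable_def)
  then show "integrable nu (\<lambda>u. (f u + g u)\<^sup>2)"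
    by (simp add: power2_sum mult.assoc)
qed

lemma sq_integrable_scale:
  "sq_integrable f \<Longrightarrow> sq_integrable (\<lambda>u. c * f u)"
  by (auto simp: sq_integrable_def power_mult_distrib)

lemma sq_integrable_const: "sq_integrable (\<lambda>_. c)"
  by (simp add: sq_integrable_def)

quotient_type L2nu = "real \<Rightarrow> real" /
  partial: "\<lambda>f g. sq_integrable f \<and> sq_integrable g \<and> (AE u in nu. f u = g u)"
proof (rule part_equivpI)
  show "\<exists>f. sq_integrable f \<and> sq_integrable f \<and> (AE u in nu. f u = f u)"
    using sq_integrable_const by auto
  show "symp (\<lambda>f g. sq_integrable f \<and> sq_integrable g \<and> (AE u in nu. f u = g u))"
    by (rule sympI) (auto elim: AE_mp)
  show "transp (\<lambda>f g. sq_integrable f \<and> sq_integrable g \<and> (AE u in nu. f u = g u))"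
  proof (rule transpI)
    fix f g h
    assume *: "sq_integrable f \<and> sq_integrable g \<and> (AE u in nu. f u = g u)"
      "sq_integrable g \<and> sq_integrable h \<and> (AE u in nu. g u = h u)"
    then have "AE u in nu. f u = g u" "AE u in nu. g u = h u" by auto
    then have "AE u in nu. f u = h u" by eventually_elim simp
    with * show "sq_integrable f \<and> sq_integrable h \<and> (AE u in nu. f u = h u)" by simp
  qed
qed

instantiation L2nu :: real_inner
begin

lift_definition zero_L2nu :: L2nu is "\<lambda>_. 0"
  by (simp add: sq_integrable_const)

lift_definition plus_L2nu :: "L2nu \<Rightarrow> L2nu \<Rightarrow> L2nu" is "\<lambda>f g u. f u + g u"
  by (auto intro: sq_integrable_add)

lift_definition scaleR_L2nu :: "real \<Rightarrow> L2nu \<Rightarrow> L2nu" is "\<lambda>c f u. c * f u"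
  by (auto intro: sq_integrable_scale)

lift_definition inner_L2nu :: "L2nu \<Rightarrow> L2nu \<Rightarrow> real" is "\<lambda>f g. \<integral>u. f u * g u \<partial>nu"
proof -
  fix f f' g g' :: "real \<Rightarrow> real"
  assume *: "sq_integrable f \<and> sq_integrable f' \<and> (AE u in nu. f u = f' u)"
    "sq_integrable g \<and> sq_integrable g' \<and> (AE u in nu. g u = g' u)"
  then have "AE u in nu. f u = f' u" "AE u in nu. g u = g' u" by auto
  then have "AE u in nu. f u * g u = f' u * g' u" by eventually_elim simp
  with * show "(\<integral>u. f u * g u \<partial>nu) = (\<integral>u. f' u * g' u \<partial>nu)"
    by (intro integral_cong_AE) (auto simp: sq_integrable_def)
qed

definition uminus_L2nu :: "L2nu \<Rightarrow> L2nu" where "uminus_L2nu f = (-1) *\<^sub>R f"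
definition minus_L2nu :: "L2nu \<Rightarrow> L2nu \<Rightarrow> L2nu" where "minus_L2nu f g = f + (- g)"
definition norm_L2nu :: "L2nu \<Rightarrow> real" where "norm_L2nu f = sqrt (inner f f)"
definition sgn_L2nu :: "L2nu \<Rightarrow> L2nu" where "sgn_L2nu f = inverse (norm f) *\<^sub>R f"
definition dist_L2nu :: "L2nu \<Rightarrow> L2nu \<Rightarrow> real" where "dist_L2nu f g = norm (f - g)"
definition uniformity_L2nu :: "(L2nu \<times> L2nu) filter" where
  "uniformity_L2nu = (INF e\<in>{0<..}. principal {(f, g). dist f g < e})"
definition open_L2nu :: "L2nu set \<Rightarrow> bool" where
  "open_L2nu U \<longleftrightarrow> (\<forall>f\<in>U. \<forall>\<^sub>F (f', g) in uniformity. f' = f \<longrightarrow> g \<in> U)"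

instance
proof
  fix f g h :: L2nu and a b :: real
  show "f + g + h = f + (g + h)"
    by transfer (auto intro!: sq_integrable_add simp: add.assoc)
  show "f + g = g + f"
    by transfer (auto intro!: sq_integrable_add simp: add.commute)
  show "0 + f = f"
    by transfer auto
  show "- f + f = 0"
    unfolding uminus_L2nu_def
    by transfer (auto intro!: sq_integrable_add sq_integrable_scale[of _ "-1", simplified] simp: sq_integrable_const)
  show "f - g = f + (- g)"
    by (rule minus_L2nu_def)
  show "a *\<^sub>R (f + g) = a *\<^sub>R f + a *\<^sub>R g"
    by transfer (auto intro!: sq_integrable_add sq_integrable_scale simp: algebra_simps)
  show "(a + b) *\<^sub>R f = a *\<^sub>R f + b *\<^sub>R f"
    by transfer (auto intro!: sq_integrable_add sq_integrable_scale simp: algebra_simps)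
  show "a *\<^sub>R b *\<^sub>R f = (a * b) *\<^sub>R f"
    by transfer (auto intro!: sq_integrable_scale simp: algebra_simps)
  show "1 *\<^sub>R f = f"
    by transfer auto
  show "sgn f = inverse (norm f) *\<^sub>R f"
    by (rule sgn_L2nu_def)
  show "dist f g = norm (f - g)"
    by (rule dist_L2nu_def)
  show "uniformity = (INF e\<in>{0<..}. principal {(f::L2nu, g). dist f g < e})"
    by (rule uniformity_L2nu_def)
  show "open U \<longleftrightarrow> (\<forall>f\<in>U. \<forall>\<^sub>F (f', g) in uniformity. f' = f \<longrightarrow> g \<in> U)" for U :: "L2nu set"
    by (rule open_L2nu_def)
  show "inner f g = inner g f"
    by transfer (simp add: mult.commute)
  show "inner (f + g) h = inner f h + inner g h"
  proof transfer
    fix f g h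
    assume "sq_integrable f \<and> sq_integrable f \<and> (AE u in nu. f u = f u)"
      "sq_integrable g \<and> sq_integrable g \<and> (AE u in nu. g u = g u)"
      "sq_integrable h \<and> sq_integrable h \<and> (AE u in nu. h u = h u)"
    then show "(\<integral>u. (f u + g u) * h u \<partial>nu) = (\<integral>u. f u * h u \<partial>nu) + (\<integral>u. g u * h u \<partial>nu)"
      by (simp add: distrib_right sq_integrable_mult)
  qed
  show "inner (a *\<^sub>R f) g = a * inner f g"
    by transfer (simp add: mult.assoc)
  show "0 \<le> inner f f"
    by transfer simp
  show "inner f f = 0 \<longleftrightarrow> f = 0"
  proof transfer
    fix f
    assume f: "sq_integrable f \<and> sq_integrable f \<and> (AE u in nu. f u = f u)"
    then have "(\<integral>u. f u * f u \<partial>nu) = 0 \<longleftrightarrow> (AE u in nu. f u * f u = 0)"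
      by (intro integral_nonneg_eq_0_iff_AE sq_integrable_mult) auto
    with f show "((\<integral>u. f u * f u \<partial>nu) = 0) \<longleftrightarrow>
        (sq_integrable f \<and> sq_integrable (\<lambda>_. 0) \<and> (AE u in nu. f u = 0))"
      by (simp add: sq_integrable_const)
  qed
  show "norm f = sqrt (inner f f)"
    by (rule norm_L2nu_def)
qed

end


section \<open>The integral operator\<close>

definition riesz_kernel :: "real \<Rightarrow> real \<Rightarrow> real \<Rightarrow> real" where
  "riesz_kernel \<alpha> u v = \<bar>u - v\<bar> powr (- \<alpha>)"

lemma riesz_kernel_measurable [measurable]:
  "case_prod (riesz_kernel \<alpha>) \<in> borel_measurable (borel \<Otimes>\<^sub>M borel)"
  unfolding riesz_kernel_def by measurable

lemma riesz_kernel_nonneg [simp]: "0 \<le> riesz_kernel \<alpha> u v"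
  by (simp add: riesz_kernel_def)

lemma riesz_kernel_commute: "riesz_kernel \<alpha> u v = riesz_kernel \<alpha> v u"
  by (simp add: riesz_kernel_def abs_minus_commute)

definition schur_const :: "real \<Rightarrow> real" where
  "schur_const \<alpha> = 2 / (1 - \<alpha>) + 1"

lemma nn_integral_riesz_kernel_le:
  assumes "0 < \<alpha>" "\<alpha> < 1"
  shows "(\<integral>\<^sup>+v. riesz_kernel \<alpha> u v \<partial>nu) \<le> ennreal (schur_const \<alpha>)"
proof -
  define k where "k w = ennreal (w powr (- \<alpha>)) * indicator {0..1} w" for w :: real
  have [measurable]: "k \<in> borel_measurable borel"
    unfolding k_def by measurable
  have kint: "(\<integral>\<^sup>+w. k w \<partial>lborel) = ennreal (1 / (1 - \<alpha>))"
    unfolding k_def using has_integral_powr_from_0[of "- \<alpha>" 1] assms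
    by (intro nn_integral_has_integral_lebesgue') (auto simp: add.commute)
  have k1: "(\<integral>\<^sup>+v. k (v - u) \<partial>lborel) = ennreal (1 / (1 - \<alpha>))"
    using nn_integral_real_affine[of k 1 "- u"] by (simp add: kint)
  have k2: "(\<integral>\<^sup>+v. k (u - v) \<partial>lborel) = ennreal (1 / (1 - \<alpha>))"
    using nn_integral_real_affine[of k "-1" u] by (simp add: kint)
  have "(\<integral>\<^sup>+v. riesz_kernel \<alpha> u v \<partial>nu)
      = (\<integral>\<^sup>+v. ennreal (exp (- v)) * indicator {0..} v * ennreal (riesz_kernel \<alpha> u v) \<partial>lborel)"
    unfolding nu_def by (subst nn_integral_density) (auto simp: riesz_kernel_def)
  also have "\<dots> \<le> (\<integral>\<^sup>+v. k (v - u) + k (u - v) + ennreal (exp (- v)) * indicator {0..} v \<partial>lborel)"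
  proof (rule nn_integral_mono)
    fix v :: real
    show "ennreal (exp (- v)) * indicator {0..} v * ennreal (riesz_kernel \<alpha> u v)
        \<le> k (v - u) + k (u - v) + ennreal (exp (- v)) * indicator {0..} v"
    proof (cases "v \<ge> 0")
      case False
      then show ?thesis by simp
    next
      case v: True
      show ?thesis
      proof (cases "\<bar>u - v\<bar> \<le> 1")
        case True
        have "ennreal (exp (- v)) * ennreal (riesz_kernel \<alpha> u v) \<le> 1 * ennreal (riesz_kernel \<alpha> u v)"
          using v by (intro mult_right_mono) (auto simp: ennreal_le_1)
        also have "\<dots> \<le> k (v - u) + k (u - v)"
        proof (cases "u \<le> v")
          case le: True
          with True have "k (v - u) = ennreal (riesz_kernel \<alpha> u v)"
            by (simp add: k_def riesz_kernel_def abs_minus_commute[of u v])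
          then show ?thesis by (simp add: add_increasing2)
        next
          case ge: False
          with True have "k (u - v) = ennreal (riesz_kernel \<alpha> u v)"
            by (simp add: k_def riesz_kernel_def)
          then show ?thesis by (simp add: add_increasing)
        qed
        finally show ?thesis using v by (simp add: add_increasing2)
      next
        case False
        then have "riesz_kernel \<alpha> u v \<le> 1"
          using assms powr_mono[of "- \<alpha>" 0 "\<bar>u - v\<bar>"]
          by (simp add: riesz_kernel_def split: if_splits)
        then have "ennreal (exp (- v)) * ennreal (riesz_kernel \<alpha> u v) \<le> ennreal (exp (- v)) * 1"
          by (intro mult_left_mono) (auto simp: ennreal_le_1)
        then show ?thesis using v by (simp add: add_increasing)
      qed
    qed
  qed
  also have "\<dots> = ennreal (1 / (1 - \<alpha>)) + ennreal (1 / (1 - \<alpha>)) + 1"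
    using prob_nu by (simp add: nn_integral_add k1 k2 nu_def emeasure_density)
  also have "\<dots> = ennreal (schur_const \<alpha>)"
    using assms by (simp add: schur_const_def flip: ennreal_plus ennreal_1)
  finally show ?thesis .
qed

lemma schur_bound:
  assumes \<alpha>: "0 < \<alpha>" "\<alpha> < 1" and h: "sq_integrable h"
  shows "(\<integral>\<^sup>+u. (\<integral>\<^sup>+v. ennreal \<bar>riesz_kernel \<alpha> u v * h v\<bar> \<partial>nu)\<^sup>2 \<partial>nu)
    \<le> ennreal ((schur_const \<alpha>)\<^sup>2 * (\<integral>u. (h u)\<^sup>2 \<partial>nu))"
proof -
  let ?M = "ennreal (schur_const \<alpha>)"
  have M0: "0 \<le> schur_const \<alpha>" using \<alpha> by (simp add: schur_const_def)
  have [measurable]: "h \<in> borel_measurable borel"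
    using h by (rule sq_integrable_measurable)
  have "(\<integral>\<^sup>+v. ennreal \<bar>riesz_kernel \<alpha> u v * h v\<bar> \<partial>nu)\<^sup>2
      \<le> ?M * (\<integral>\<^sup>+v. ennreal (riesz_kernel \<alpha> u v * (h v)\<^sup>2) \<partial>nu)" for u
  proof -
    have "ennreal \<bar>riesz_kernel \<alpha> u v * h v\<bar>
        = ennreal (sqrt (riesz_kernel \<alpha> u v)) * ennreal (sqrt (riesz_kernel \<alpha> u v) * \<bar>h v\<bar>)" for v
      by (subst ennreal_mult[symmetric]) (auto simp: abs_mult simp flip: mult.assoc)
    then have "(\<integral>\<^sup>+v. ennreal \<bar>riesz_kernel \<alpha> u v * h v\<bar> \<partial>nu)
        = (\<integral>\<^sup>+v. ennreal (sqrt (riesz_kernel \<alpha> u v)) * ennreal (sqrt (riesz_kernel \<alpha> u v) * \<bar>h v\<bar>) \<partial>nu)"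
      by simp
    also have "\<dots>\<^sup>2 \<le> (\<integral>\<^sup>+v. ennreal (sqrt (riesz_kernel \<alpha> u v)) ^ 2 \<partial>nu)
        * (\<integral>\<^sup>+v. ennreal (sqrt (riesz_kernel \<alpha> u v) * \<bar>h v\<bar>) ^ 2 \<partial>nu)"
      by (rule Cauchy_Schwarz_nn_integral) measurable
    also have "\<dots> = (\<integral>\<^sup>+v. riesz_kernel \<alpha> u v \<partial>nu) * (\<integral>\<^sup>+v. ennreal (riesz_kernel \<alpha> u v * (h v)\<^sup>2) \<partial>nu)"
      by (simp add: ennreal_power power_mult_distrib)
    also have "\<dots> \<le> ?M * (\<integral>\<^sup>+v. ennreal (riesz_kernel \<alpha> u v * (h v)\<^sup>2) \<partial>nu)"
      by (intro mult_right_mono nn_integral_riesz_kernel_le \<alpha>) simp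
    finally show ?thesis .
  qed
  then have "(\<integral>\<^sup>+u. (\<integral>\<^sup>+v. ennreal \<bar>riesz_kernel \<alpha> u v * h v\<bar> \<partial>nu)\<^sup>2 \<partial>nu)
      \<le> (\<integral>\<^sup>+u. ?M * (\<integral>\<^sup>+v. ennreal (riesz_kernel \<alpha> u v * (h v)\<^sup>2) \<partial>nu) \<partial>nu)"
    by (intro nn_integral_mono) auto
  also have "\<dots> = ?M * (\<integral>\<^sup>+u. (\<integral>\<^sup>+v. ennreal (riesz_kernel \<alpha> u v * (h v)\<^sup>2) \<partial>nu) \<partial>nu)"
    by (rule nn_integral_cmult) measurable
  also have "(\<integral>\<^sup>+u. (\<integral>\<^sup>+v. ennreal (riesz_kernel \<alpha> u v * (h v)\<^sup>2) \<partial>nu) \<partial>nu)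
      = (\<integral>\<^sup>+v. (\<integral>\<^sup>+u. ennreal (riesz_kernel \<alpha> u v * (h v)\<^sup>2) \<partial>nu) \<partial>nu)"
  proof -
    interpret pair_sigma_finite nu nu ..
    show ?thesis by (rule Fubini'[symmetric]) measurable
  qed
  also have "\<dots> = (\<integral>\<^sup>+v. ennreal ((h v)\<^sup>2) * (\<integral>\<^sup>+u. riesz_kernel \<alpha> v u \<partial>nu) \<partial>nu)"
    by (subst nn_integral_cmult[symmetric])
      (auto simp: mult.commute riesz_kernel_commute[of \<alpha> _ "_ :: real"] ennreal_mult' intro!: nn_integral_cong)
  also have "\<dots> \<le> (\<integral>\<^sup>+v. ennreal ((h v)\<^sup>2) * ?M \<partial>nu)"
    by (intro nn_integral_mono mult_left_mono nn_integral_riesz_kernel_le \<alpha>) simp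
  also have "\<dots> = (\<integral>\<^sup>+v. ennreal ((h v)\<^sup>2) \<partial>nu) * ?M"
    by (rule nn_integral_multc) measurable
  also have "(\<integral>\<^sup>+v. ennreal ((h v)\<^sup>2) \<partial>nu) = ennreal (\<integral>v. (h v)\<^sup>2 \<partial>nu)"
    using h by (intro nn_integral_eq_integral) (auto simp: sq_integrable_def)
  also have "?M * (ennreal (\<integral>v. (h v)\<^sup>2 \<partial>nu) * ?M) = ennreal ((schur_const \<alpha>)\<^sup>2 * (\<integral>u. (h u)\<^sup>2 \<partial>nu))"
    using M0 by (simp add: power2_eq_square mult_ac flip: ennreal_mult)
  finally show ?thesis by (simp add: mult_left_mono)
qed

lemma schur_bound_real:
  assumes \<alpha>: "0 < \<alpha>" "\<alpha> < 1" and h: "sq_integrable h"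
  defines "T \<equiv> \<lambda>u. \<integral>v. riesz_kernel \<alpha> u v * h v \<partial>nu"
  shows "AE u in nu. integrable nu (\<lambda>v. riesz_kernel \<alpha> u v * h v)"
    and "sq_integrable T"
    and "(\<integral>u. (T u)\<^sup>2 \<partial>nu) \<le> (schur_const \<alpha>)\<^sup>2 * (\<integral>u. (h u)\<^sup>2 \<partial>nu)"
proof -
  have [measurable]: "h \<in> borel_measurable borel"
    using h by (rule sq_integrable_measurable)
  define A where "A u = (\<integral>\<^sup>+v. ennreal \<bar>riesz_kernel \<alpha> u v * h v\<bar> \<partial>nu)" for u
  have [measurable]: "A \<in> borel_measurable nu"
    unfolding A_def by measurable
  have Tm [measurable]: "T \<in> borel_measurable nu"
    unfolding T_def by measurable
  have A: "(\<integral>\<^sup>+u. (A u)\<^sup>2 \<partial>nu) \<le> ennreal ((schur_const \<alpha>)\<^sup>2 * (\<integral>u. (h u)\<^sup>2 \<partial>nu))"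
    unfolding A_def by (rule schur_bound[OF \<alpha> h])
  then have "(\<integral>\<^sup>+u. (A u)\<^sup>2 \<partial>nu) \<noteq> \<infinity>"
    by (auto simp: top_unique)
  then have "AE u in nu. (A u)\<^sup>2 \<noteq> \<infinity>"
    by (intro nn_integral_PInf_AE) auto
  then show "AE u in nu. integrable nu (\<lambda>v. riesz_kernel \<alpha> u v * h v)"
  proof eventually_elim
    case (elim u)
    then have "A u < \<infinity>"
      by (cases "A u") (auto simp: power2_eq_square ennreal_mult_top)
    then show ?case
      by (intro integrableI_bounded) (auto simp: A_def)
  qed
  have "ennreal ((T u)\<^sup>2) \<le> (A u)\<^sup>2" for u
  proof -
    have "ennreal \<bar>T u\<bar> \<le> A u"
    proof (cases "integrable nu (\<lambda>v. riesz_kernel \<alpha> u v * h v)")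
      case True
      then show ?thesis
        using integral_norm_bound_ennreal[OF True] by (simp add: T_def A_def)
    next
      case False
      then show ?thesis by (simp add: T_def not_integrable_integral_eq)
    qed
    then have "ennreal \<bar>T u\<bar> ^ 2 \<le> (A u)\<^sup>2"
      by (intro power_mono) auto
    then show ?thesis by (simp add: ennreal_power)
  qed
  then have "(\<integral>\<^sup>+u. ennreal ((T u)\<^sup>2) \<partial>nu) \<le> (\<integral>\<^sup>+u. (A u)\<^sup>2 \<partial>nu)"
    by (intro nn_integral_mono) auto
  also note A
  finally have le: "(\<integral>\<^sup>+u. ennreal ((T u)\<^sup>2) \<partial>nu) \<le> ennreal ((schur_const \<alpha>)\<^sup>2 * (\<integral>u. (h u)\<^sup>2 \<partial>nu))" .
  then have int: "integrable nu (\<lambda>u. (T u)\<^sup>2)"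
    by (intro integrableI_bounded) (auto simp: less_top[symmetric] top_unique)
  then show "sq_integrable T"
    by (simp add: sq_integrable_def)
  have "ennreal (\<integral>u. (T u)\<^sup>2 \<partial>nu) = (\<integral>\<^sup>+u. ennreal ((T u)\<^sup>2) \<partial>nu)"
    using int by (intro nn_integral_eq_integral[symmetric]) auto
  moreover have "0 \<le> (schur_const \<alpha>)\<^sup>2 * (\<integral>u. (h u)\<^sup>2 \<partial>nu)"
    by simp
  ultimately show "(\<integral>u. (T u)\<^sup>2 \<partial>nu) \<le> (schur_const \<alpha>)\<^sup>2 * (\<integral>u. (h u)\<^sup>2 \<partial>nu)"
    using le by (metis ennreal_le_iff)
qed

text \<open>The defining integral converges for almost every \<open>u\<close>
  (\<open>schur_bound_real\<close>); outside \<open>0 < \<alpha> < 1\<close> the value is a dummy.\<close>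

lift_definition riesz_op_fun :: "real \<Rightarrow> L2nu \<Rightarrow> L2nu" is
  "\<lambda>\<alpha> h u. if 0 < \<alpha> \<and> \<alpha> < 1 then \<integral>v. \<bar>u - v\<bar> powr (- \<alpha>) * h v \<partial>nu else 0"
proof -
  fix \<alpha> :: real and h g
  assume *: "sq_integrable h \<and> sq_integrable g \<and> (AE u in nu. h u = g u)"
  show "sq_integrable (\<lambda>u. if 0 < \<alpha> \<and> \<alpha> < 1 then \<integral>v. \<bar>u - v\<bar> powr (- \<alpha>) * h v \<partial>nu else 0) \<and>
    sq_integrable (\<lambda>u. if 0 < \<alpha> \<and> \<alpha> < 1 then \<integral>v. \<bar>u - v\<bar> powr (- \<alpha>) * g v \<partial>nu else 0) \<and>
    (AE u in nu. (if 0 < \<alpha> \<and> \<alpha> < 1 then \<integral>v. \<bar>u - v\<bar> powr (- \<alpha>) * h v \<partial>nu else 0) =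
      (if 0 < \<alpha> \<and> \<alpha> < 1 then \<integral>v. \<bar>u - v\<bar> powr (- \<alpha>) * g v \<partial>nu else 0))"
  proof (cases "0 < \<alpha> \<and> \<alpha> < 1")
    case True
    have hm [measurable]: "h \<in> borel_measurable borel" "g \<in> borel_measurable borel"
      using * by (auto intro: sq_integrable_measurable)
    have "(\<integral>v. \<bar>u - v\<bar> powr (- \<alpha>) * h v \<partial>nu) = (\<integral>v. \<bar>u - v\<bar> powr (- \<alpha>) * g v \<partial>nu)" for u
    proof (rule integral_cong_AE)
      show "AE v in nu. \<bar>u - v\<bar> powr (- \<alpha>) * h v = \<bar>u - v\<bar> powr (- \<alpha>) * g v"
        using * by auto
    qed measurable
    then show ?thesis
      using True * schur_bound_real(2)[of \<alpha> h] schur_bound_real(2)[of \<alpha> g]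
      by (simp add: riesz_kernel_def)
  next
    case False
    then show ?thesis
      by (cases "0 < \<alpha>"; cases "\<alpha> < 1") (simp_all add: sq_integrable_const)
  qed
qed

lift_definition riesz_op :: "real \<Rightarrow> L2nu \<Rightarrow>\<^sub>L L2nu" is riesz_op_fun
proof -
  fix \<alpha> :: real
  show "bounded_linear (riesz_op_fun \<alpha>)"
  proof (rule bounded_linear_intro)
    fix f g :: L2nu
    show "riesz_op_fun \<alpha> (f + g) = riesz_op_fun \<alpha> f + riesz_op_fun \<alpha> g"
    proof (transfer fixing: \<alpha>)
      fix f g
      assume *: "sq_integrable f \<and> sq_integrable f \<and> (AE u in nu. f u = f u)"
        "sq_integrable g \<and> sq_integrable g \<and> (AE u in nu. g u = g u)"
      let ?T = "\<lambda>h u. if 0 < \<alpha> \<and> \<alpha> < 1 then \<integral>v. \<bar>u - v\<bar> powr (- \<alpha>) * h v \<partial>nu else 0"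
      have sq: "sq_integrable (?T h)" if "sq_integrable h" for h
        using that schur_bound_real(2)[of \<alpha> h]
        by (cases "0 < \<alpha>"; cases "\<alpha> < 1") (simp_all add: riesz_kernel_def sq_integrable_const)
      have "AE u in nu. ?T (\<lambda>u. f u + g u) u = ?T f u + ?T g u"
      proof (cases "0 < \<alpha> \<and> \<alpha> < 1")
        case True
        then have "AE u in nu. integrable nu (\<lambda>v. riesz_kernel \<alpha> u v * f v)"
          "AE u in nu. integrable nu (\<lambda>v. riesz_kernel \<alpha> u v * g v)"
          using * schur_bound_real(1) by auto
        then show ?thesis
          by eventually_elim (use True in \<open>simp add: distrib_left riesz_kernel_def\<close>)
      next
        case False
        then show ?thesis by (cases "0 < \<alpha>"; cases "\<alpha> < 1") simp_all
      qed
      then show "sq_integrable (?T (\<lambda>u. f u + g u)) \<and> sq_integrable (\<lambda>u. ?T f u + ?T g u) \<and>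
        (AE u in nu. ?T (\<lambda>u. f u + g u) u = ?T f u + ?T g u)"
        using * sq[OF sq_integrable_add[of f g]] sq_integrable_add[OF sq[of f] sq[of g]] by blast
    qed
  next
    fix c :: real and f :: L2nu
    show "riesz_op_fun \<alpha> (c *\<^sub>R f) = c *\<^sub>R riesz_op_fun \<alpha> f"
    proof (transfer fixing: \<alpha> c)
      fix f
      assume *: "sq_integrable f \<and> sq_integrable f \<and> (AE u in nu. f u = f u)"
      let ?T = "\<lambda>h u. if 0 < \<alpha> \<and> \<alpha> < 1 then \<integral>v. \<bar>u - v\<bar> powr (- \<alpha>) * h v \<partial>nu else 0"
      have sq: "sq_integrable (?T h)" if "sq_integrable h" for h
        using that schur_bound_real(2)[of \<alpha> h]
        by (cases "0 < \<alpha>"; cases "\<alpha> < 1") (simp_all add: riesz_kernel_def sq_integrable_const)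
      have "?T (\<lambda>u. c * f u) u = c * ?T f u" for u
        by (simp add: mult.left_commute[of _ c])
      then show "sq_integrable (?T (\<lambda>u. c * f u)) \<and> sq_integrable (\<lambda>u. c * ?T f u) \<and>
        (AE u in nu. ?T (\<lambda>u. c * f u) u = c * ?T f u)"
        using * sq[OF sq_integrable_scale[of f c]] sq_integrable_scale[OF sq[of f], of c] by simp
    qed
  next
    fix f :: L2nu
    have "inner (riesz_op_fun \<alpha> f) (riesz_op_fun \<alpha> f) \<le> (schur_const \<alpha>)\<^sup>2 * inner f f"
    proof (transfer fixing: \<alpha>)
      fix f
      assume *: "sq_integrable f \<and> sq_integrable f \<and> (AE u in nu. f u = f u)"
      let ?T = "\<lambda>h u. if 0 < \<alpha> \<and> \<alpha> < 1 then \<integral>v. \<bar>u - v\<bar> powr (- \<alpha>) * h v \<partial>nu else 0"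
      show "(\<integral>u. ?T f u * ?T f u \<partial>nu) \<le> (schur_const \<alpha>)\<^sup>2 * (\<integral>u. f u * f u \<partial>nu)"
        using * schur_bound_real(3)[of \<alpha> f]
        by (cases "0 < \<alpha>"; cases "\<alpha> < 1") (simp_all add: riesz_kernel_def power2_eq_square)
    qed
    then have "norm (riesz_op_fun \<alpha> f) \<le> sqrt ((schur_const \<alpha>)\<^sup>2 * inner f f)"
      unfolding norm_eq_sqrt_inner by (rule real_sqrt_le_mono)
    then show "norm (riesz_op_fun \<alpha> f) \<le> norm f * \<bar>schur_const \<alpha>\<bar>"
      by (simp add: norm_eq_sqrt_inner real_sqrt_mult mult.commute)
  qed
qed

lift_definition const_one :: L2nu is "\<lambda>_. 1"
  by (simp add: sq_integrable_const)

lemma inner_const_one: "inner const_one const_one = 1"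
  by transfer (use prob_nu in \<open>simp add: measure_def\<close>)


section \<open>Compression to the orthogonal complement of the constants\<close>

lift_definition proj_const :: "L2nu \<Rightarrow>\<^sub>L L2nu" is "\<lambda>f. inner f const_one *\<^sub>R const_one"
  by (intro bounded_linear_scaleR_const bounded_linear_inner_left)

text \<open>\<open>proj_const\<close> is the orthogonal projection onto the line of constants.\<close>

lemma proj_const_in_span: "blinfun_apply proj_const f \<in> span {const_one}"
  by (simp add: proj_const.rep_eq span_base span_scale)

lemma proj_const_orthogonal: "g \<in> span {const_one} \<Longrightarrow> inner (f - blinfun_apply proj_const f) g = 0"
  by (auto simp: proj_const.rep_eq span_singleton inner_diff_left inner_const_one)

definition C_op :: "real \<Rightarrow> L2nu \<Rightarrow>\<^sub>L L2nu" where
  "C_op \<alpha> = (id_blinfun - proj_const) o\<^sub>L riesz_op \<alpha> o\<^sub>L (id_blinfun - proj_const)"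

lemma C_op_const_one: "blinfun_apply (C_op \<alpha>) const_one = 0"
  by (simp add: C_op_def blinfun.diff_left proj_const.rep_eq inner_const_one)

text \<open>\<open>C_op \<alpha>\<close> acts on all of \<^typ>\<open>L2nu\<close> and vanishes on the constants, so its operator norm
  is that of its restriction to the orthogonal complement of the constants.\<close>

lemma norm_C_op_le_iff:
  "norm (C_op \<alpha>) \<le> c \<longleftrightarrow>
    0 \<le> c \<and> (\<forall>f. inner f const_one = 0 \<longrightarrow> norm (blinfun_apply (C_op \<alpha>) f) \<le> c * norm f)"
proof
  assume le: "norm (C_op \<alpha>) \<le> c"
  have "norm (blinfun_apply (C_op \<alpha>) f) \<le> c * norm f" for f
    using norm_blinfun[of "C_op \<alpha>" f] mult_right_mono[OF le, of "norm f"] by simp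
  moreover have "0 \<le> c"
    using norm_ge_zero le by (rule order_trans)
  ultimately show "0 \<le> c \<and> (\<forall>f. inner f const_one = 0 \<longrightarrow> norm (blinfun_apply (C_op \<alpha>) f) \<le> c * norm f)"
    by simp
next
  assume *: "0 \<le> c \<and> (\<forall>f. inner f const_one = 0 \<longrightarrow> norm (blinfun_apply (C_op \<alpha>) f) \<le> c * norm f)"
  show "norm (C_op \<alpha>) \<le> c"
  proof (rule norm_blinfun_bound)
    fix f
    define g where "g = f - inner f const_one *\<^sub>R const_one"
    have g: "inner g const_one = 0"
      by (simp add: g_def inner_diff_left inner_const_one)
    have f: "f = g + inner f const_one *\<^sub>R const_one"
      by (simp add: g_def)
    have "(norm f)\<^sup>2 = (norm g)\<^sup>2 + (inner f const_one)\<^sup>2"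
    proof -
      have "inner (g + c *\<^sub>R const_one) (g + c *\<^sub>R const_one) = inner g g + c\<^sup>2" for c
        by (simp add: inner_add_left inner_add_right g inner_commute[of const_one g] inner_const_one
            power2_eq_square)
      then show ?thesis
        unfolding power2_norm_eq_inner by (metis f)
    qed
    moreover have "0 \<le> (inner f const_one)\<^sup>2"
      by simp
    ultimately have "norm g \<le> norm f"
      by (intro power2_le_imp_le[OF _ norm_ge_zero]) linarith
    have "blinfun_apply (C_op \<alpha>) f = blinfun_apply (C_op \<alpha>) g"
      by (simp add: g_def blinfun.diff_right blinfun.scaleR_right C_op_const_one)
    also have "norm \<dots> \<le> c * norm g"
      using * g by simp
    also have "\<dots> \<le> c * norm f"
      using * \<open>norm g \<le> norm f\<close> by (simp add: mult_left_mono)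
    finally show "norm (blinfun_apply (C_op \<alpha>) f) \<le> c * norm f" .
  qed (use * in simp)
qed

definition b_vec :: "real \<Rightarrow> L2nu" where
  "b_vec \<alpha> = blinfun_apply (id_blinfun - proj_const) (blinfun_apply (riesz_op \<alpha>) const_one)"

definition moment :: "real \<Rightarrow> nat \<Rightarrow> real" where
  "moment \<alpha> j = inner (b_vec \<alpha>) ((blinfun_apply (C_op \<alpha>) ^^ j) (b_vec \<alpha>))"

definition eigenvalue :: "('a::real_normed_vector \<Rightarrow>\<^sub>L 'a) \<Rightarrow> real \<Rightarrow> bool" where
  "eigenvalue T \<kappa> \<longleftrightarrow> (\<exists>f. f \<noteq> 0 \<and> blinfun_apply T f = \<kappa> *\<^sub>R f)"

definition leading_eigenvalue :: "('a::real_normed_vector \<Rightarrow>\<^sub>L 'a) \<Rightarrow> real \<Rightarrow> bool" where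
  "leading_eigenvalue T l \<longleftrightarrow> eigenvalue T l \<and> (\<forall>\<kappa>. eigenvalue T \<kappa> \<longrightarrow> \<kappa> \<le> l)"


section \<open>Constants\<close>

definition a0 :: "real \<Rightarrow> real" where
  "a0 \<alpha> = Gamma (1 - \<alpha>)"

definition Q3 :: "real \<Rightarrow> real" where
  "Q3 \<alpha> = (Gamma (1 - \<alpha>))\<^sup>2 * Gamma (1 - 3 * \<alpha> / 2) / Gamma (1 - \<alpha> / 2)"

definition r_alpha :: "real \<Rightarrow> real" where
  "r_alpha \<alpha> = root 3 (Q3 \<alpha> / (a0 \<alpha>) ^ 3 - 1)"

definition r_star :: real where
  "r_star = root 3 (Gamma (1/4) / (sqrt pi * Gamma (3/4)) - 1)"

end

theory Submission
  imports Defs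
begin

text \<open>Split \<open>L\<^sup>2(\<nu>)\<close> into the constants and their orthogonal complement, so that \<open>S\<^sub>\<alpha>\<close> becomes a block
  operator with diagonal blocks \<open>a\<^sub>0\<close> and \<open>C\<close> and off-diagonal block \<open>b\<close>.  For a positive operator
  given by a \<open>2 \<times> 2\<close> matrix with rows \<open>(a\<^sub>0, \<beta>)\<close> and \<open>(\<beta>, c)\<close> the trace of the cube is
  \<open>a\<^sub>0\<^sup>3 + 3 a\<^sub>0 \<beta>\<^sup>2 + 3 \<beta>\<^sup>2 c + c\<^sup>3\<close>, and compression does not increase the trace of the cube.  Since
  the trace of \<open>S\<^sub>\<alpha>\<^sup>3\<close> is \<open>Q\<^sub>3 = a\<^sub>0\<^sup>3 (1 + r\<^sub>\<alpha>\<^sup>3)\<close>, compressing to \<open>span {1, f}\<close> with a unit vector \<open>f\<close>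
  orthogonal to \<open>1\<close> gives \<open>\<langle>f, C f\<rangle> \<le> a\<^sub>0 r\<^sub>\<alpha>\<close>, hence \<open>\<parallel>C\<parallel> \<le> a\<^sub>0 r\<^sub>\<alpha>\<close>; taking \<open>f = b / \<parallel>b\<parallel>\<close> gives
  \<open>3 \<parallel>b\<parallel>\<^sup>2 \<le> a\<^sub>0\<^sup>2 r\<^sub>\<alpha>\<^sup>3\<close>.  The factor \<open>1/3\<close> and the exponent \<open>N + 4\<close> in the error bound come from
  this second estimate.

  The trace inequality (\<open>trace_cube_ineq\<close>) comes from a factorisation of the operator.  The kernel
  is a superposition of products of indicator functions of intervals:
  \<open>\<bar>u - v\<bar>\<^sup>-\<^sup>\<alpha> = \<integral> \<phi>\<^sub>\<omega>(u) \<phi>\<^sub>\<omega>(v) d\<omega>\<close>, where \<open>\<omega> = (x, s)\<close> ranges over the intervals \<open>[x, x + s]\<close>.  So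
  \<open>\<langle>f, S f\<rangle> = \<integral> \<langle>\<phi>\<^sub>\<omega>, f\<rangle>\<^sup>2 d\<omega>\<close>, which shows positivity, and for orthonormal \<open>e\<^sub>1, e\<^sub>2\<close> Bessel's inequality
  yields \<open>\<Sum>\<^sub>i \<langle>S e\<^sub>i, S (S e\<^sub>i)\<rangle> = \<integral> \<Sum>\<^sub>i \<langle>S \<phi>\<^sub>\<omega>, e\<^sub>i\<rangle>\<^sup>2 d\<omega> \<le> \<integral> \<parallel>S \<phi>\<^sub>\<omega>\<parallel>\<^sup>2 d\<omega>\<close>.  By Tonelli the last integral is
  the triple integral of \<open>\<bar>u - v\<bar>\<^sup>-\<^sup>\<alpha> \<bar>u - w\<bar>\<^sup>-\<^sup>\<alpha> \<bar>v - w\<bar>\<^sup>-\<^sup>\<alpha>\<close> against \<open>\<nu>\<^sup>3\<close>, a Selberg integral whose value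
  is \<open>Q\<^sub>3\<close> (\<open>riesz_triple_integral\<close>).  The bounds \<open>0 < r\<^sub>\<alpha> \<le> r\<^sub>*\<close> hold because the logarithm of
  \<open>Q\<^sub>3 / a\<^sub>0\<^sup>3\<close> vanishes at \<open>0\<close> and increases, the digamma function being increasing, and \<open>r\<^sub>*\<close> is the value of \<open>r\<^sub>\<alpha>\<close> at
  \<open>\<alpha> = 1/2\<close>; \<open>r\<^sub>* < 1\<close> is an estimate of \<open>\<Gamma>(1/4)\<close>.

  For \<open>x > \<parallel>C\<parallel>\<close> the eigenvalue equation \<open>S f = x f\<close> can be solved for the component of \<open>f\<close>
  orthogonal to \<open>1\<close>, since \<open>x - C\<close> is invertible; what remains is the scalar equation
  \<open>x = a\<^sub>0 + \<langle>b, (x - C)\<^sup>-\<^sup>1 b\<rangle>\<close>, whose right-hand side is the series of moments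
  (\<open>eigenvalue_iff_secular\<close>).  As \<open>\<parallel>C\<parallel> < a\<^sub>0\<close>, all eigenvalues above \<open>a\<^sub>0\<close> are found this way.  The
  right-hand side decreases in \<open>x\<close>, and it exceeds \<open>a\<^sub>0\<close> at \<open>a\<^sub>0\<close> because \<open>b \<noteq> 0\<close>; so there is exactly
  one root, and it is the leading eigenvalue.  Truncating the series lowers the right-hand side by
  at most \<open>\<Sum>\<^bsub>j > N\<^esub> \<parallel>b\<parallel>\<^sup>2 (a\<^sub>0 r\<^sub>\<alpha>)\<^sup>j / a\<^sub>0\<^sup>j\<^sup>+\<^sup>1\<close>, and by monotonicity this also bounds the error of the
  root.\<close>

section \<open>Completeness of the Hilbert space\<close>

text \<open>The algebraic operations of \<^typ>\<open>L2nu\<close> agree with the pointwise ones on representatives only almost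
  everywhere, so the facts about representatives are stated through norms and integrals.\<close>

definition representative :: "L2nu \<Rightarrow> real \<Rightarrow> real" where "representative = rep_L2nu"

lemma sq_integrable_representative: "sq_integrable (representative f)"
  using Quotient_rep_reflp[OF Quotient_L2nu, of f] by (simp add: representative_def)

lemma abs_representative: "abs_L2nu (representative f) = f"
  using Quotient_abs_rep[OF Quotient_L2nu, of f] by (simp add: representative_def)

lemma norm_abs_diff:
  assumes f: "sq_integrable f" and g: "sq_integrable g"
  shows "(norm (abs_L2nu f - abs_L2nu g))\<^sup>2 = (\<integral>u. (f u - g u)\<^sup>2 \<partial>nu)"
proof -
  have sq: "sq_integrable (\<lambda>u. f u + (-1) * g u)"
    using f g by (intro sq_integrable_add sq_integrable_scale)
  have "abs_L2nu f - abs_L2nu g = abs_L2nu (\<lambda>u. f u + (-1) * g u)"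
  proof -
    have "(-1) *\<^sub>R abs_L2nu g = abs_L2nu (\<lambda>u. (-1) * g u)"
      by (rule scaleR_L2nu.abs_eq) (use g in simp)
    moreover have "abs_L2nu f + abs_L2nu (\<lambda>u. (-1) * g u) = abs_L2nu (\<lambda>u. f u + (-1) * g u)"
      by (rule plus_L2nu.abs_eq) (use f sq_integrable_scale[OF g, of "-1"] in simp_all)
    ultimately show ?thesis by (simp only: minus_L2nu_def uminus_L2nu_def)
  qed
  moreover have "(norm (abs_L2nu h))\<^sup>2 = (\<integral>u. h u * h u \<partial>nu)" if "sq_integrable h" for h
    using that by (simp add: power2_norm_eq_inner inner_L2nu.abs_eq)
  ultimately show ?thesis
    using sq by (simp add: power2_eq_square)
qed

lemma sq_integrable_diff: "sq_integrable f \<Longrightarrow> sq_integrable g \<Longrightarrow> sq_integrable (\<lambda>u. f u - g u)"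
  using sq_integrable_add[of f "\<lambda>u. (-1) * g u"] sq_integrable_scale[of g "-1"] by simp

lemma nn_integral_representative_diff:
  "(\<integral>\<^sup>+u. ennreal ((representative f u - representative g u)\<^sup>2) \<partial>nu) = ennreal ((norm (f - g))\<^sup>2)"
proof -
  have "(norm (f - g))\<^sup>2 = (\<integral>u. (representative f u - representative g u)\<^sup>2 \<partial>nu)"
    using norm_abs_diff[OF sq_integrable_representative sq_integrable_representative, of f g] by (simp add: abs_representative)
  then show ?thesis
    using sq_integrable_diff[OF sq_integrable_representative sq_integrable_representative, of f g]
    by (simp add: nn_integral_eq_integral sq_integrable_def)
qed

text \<open>The measure \<^const>\<open>nu\<close> has mass one, so the \<open>L\<^sup>1\<close> distance is at most the \<open>L\<^sup>2\<close> distance.\<close>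

lemma nn_integral_representative_diff_abs:
  "(\<integral>\<^sup>+u. ennreal \<bar>representative f u - representative g u\<bar> \<partial>nu) \<le> ennreal (norm (f - g))"
proof -
  have [measurable]: "representative f \<in> borel_measurable borel" for f
    using sq_integrable_representative by (rule sq_integrable_measurable)
  have "(\<integral>\<^sup>+u. ennreal \<bar>representative f u - representative g u\<bar> * 1 \<partial>nu)\<^sup>2 \<le> (\<integral>\<^sup>+u. (ennreal \<bar>representative f u - representative g u\<bar>)\<^sup>2 \<partial>nu) * (\<integral>\<^sup>+u. 1\<^sup>2 \<partial>nu)"
    by (rule Cauchy_Schwarz_nn_integral) measurable
  also have "\<dots> = (ennreal (norm (f - g)))\<^sup>2"
    using nn_integral_representative_diff[of f g] by (simp add: prob_nu ennreal_power)
  finally have "(\<integral>\<^sup>+u. ennreal \<bar>representative f u - representative g u\<bar> \<partial>nu)\<^sup>2 \<le> ennreal ((norm (f - g))\<^sup>2)"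
    by (simp add: ennreal_power)
  then show ?thesis
    by (cases "\<integral>\<^sup>+u. ennreal \<bar>representative f u - representative g u\<bar> \<partial>nu")
       (auto simp: ennreal_power power2_le_iff_abs_le top_unique)
qed

lemma rapidly_Cauchy_subseq:
  fixes X :: "nat \<Rightarrow> 'a::real_normed_vector"
  assumes "Cauchy X"
  obtains r :: "nat \<Rightarrow> nat" where "strict_mono r" "\<And>n m. r n \<le> m \<Longrightarrow> norm (X m - X (r n)) < (1/2) ^ n"
proof -
  have ex: "\<exists>k. \<forall>m\<ge>k. norm (X m - X k) < (1/2) ^ n" for n
    using assms unfolding Cauchy_altdef2 dist_norm by simp
  \<comment> \<open>the triangle inequality through \<open>X k\<close> doubles the bound, hence the exponent \<open>Suc n\<close>\<close>
  have ex': "\<exists>k>k0. \<forall>m\<ge>k. norm (X m - X k) < (1/2) ^ n" for n and k0 :: nat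
  proof -
    obtain k where k: "\<And>m. m \<ge> k \<Longrightarrow> norm (X m - X k) < (1/2) ^ Suc n" using ex by metis
    have "norm (X m - X (max k (Suc k0))) < (1/2) ^ n" if "m \<ge> max k (Suc k0)" for m
    proof -
      have "norm (X m - X (max k (Suc k0))) \<le> norm (X m - X k) + norm (X (max k (Suc k0)) - X k)"
        by (metis diff_diff_eq2 diff_add_cancel norm_triangle_ineq4 add_diff_eq)
      also have "\<dots> < (1/2) ^ Suc n + (1/2) ^ Suc n"
        using that by (intro add_strict_mono k) auto
      finally show ?thesis by simp
    qed
    then show ?thesis by (intro exI[of _ "max k (Suc k0)"]) auto
  qed
  obtain r where "\<And>n. (\<forall>m\<ge>r n. norm (X m - X (r n)) < (1/2) ^ n) \<and> r n < r (Suc n)"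
    using dependent_nat_choice[of "\<lambda>n k. \<forall>m\<ge>k. norm (X m - X k) < (1/2) ^ n" "\<lambda>n k k'. k < k'"] ex ex'
    by (metis (no_types, lifting))
  then show ?thesis by (intro that[of r]) (auto simp: strict_mono_Suc_iff)
qed

text \<open>The Riesz--Fischer theorem.  Along a subsequence with geometrically small increments the
  increments have finite sum in \<open>L\<^sup>1\<close>, so the representatives converge almost everywhere; by Fatou's
  lemma the pointwise limit is the limit in \<open>L\<^sup>2\<close>.\<close>

instance L2nu :: complete_space
proof
  fix X :: "nat \<Rightarrow> L2nu" assume X: "Cauchy X"
  obtain r where r: "strict_mono r" and fast: "\<And>n m. r n \<le> m \<Longrightarrow> norm (X m - X (r n)) < (1/2) ^ n"
    using rapidly_Cauchy_subseq[OF X] by blast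
  define Y where "Y n = representative (X (r n))" for n
  have [measurable]: "Y n \<in> borel_measurable borel" for n
    unfolding Y_def using sq_integrable_representative by (rule sq_integrable_measurable)
  have Ysq: "sq_integrable (Y n)" for n unfolding Y_def by (rule sq_integrable_representative)
  have "(\<integral>\<^sup>+u. (\<Sum>n. ennreal \<bar>Y (Suc n) u - Y n u\<bar>) \<partial>nu) = (\<Sum>n. \<integral>\<^sup>+u. ennreal \<bar>Y (Suc n) u - Y n u\<bar> \<partial>nu)"
    by (rule nn_integral_suminf) measurable
  also have "\<dots> \<le> (\<Sum>n. ennreal ((1/2) ^ n))"
  proof (intro suminf_le allI summableI)
    fix n
    have "(\<integral>\<^sup>+u. ennreal \<bar>Y (Suc n) u - Y n u\<bar> \<partial>nu) \<le> ennreal (norm (X (r (Suc n)) - X (r n)))"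
      unfolding Y_def by (rule nn_integral_representative_diff_abs)
    also have "\<dots> \<le> ennreal ((1/2) ^ n)"
      using fast[of n "r (Suc n)"] r by (intro ennreal_leI less_imp_le) (auto simp: strict_mono_less_eq)
    finally show "(\<integral>\<^sup>+u. ennreal \<bar>Y (Suc n) u - Y n u\<bar> \<partial>nu) \<le> ennreal ((1/2) ^ n)" .
  qed
  also have "\<dots> = ennreal (\<Sum>n. (1/2) ^ n)"
    by (rule suminf_ennreal2) (auto intro: summable_geometric)
  also have "\<dots> < \<infinity>" by simp
  finally have "AE u in nu. (\<Sum>n. ennreal \<bar>Y (Suc n) u - Y n u\<bar>) \<noteq> \<infinity>"
    by (intro nn_integral_PInf_AE) auto
  then have conv: "AE u in nu. convergent (\<lambda>n. Y n u)"
  proof eventually_elim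
    case (elim u)
    then have "summable (\<lambda>n. \<bar>Y (Suc n) u - Y n u\<bar>)"
      by (intro summable_suminf_not_top) auto
    then have "summable (\<lambda>n. Y (Suc n) u - Y n u)" by (rule summable_rabs_cancel)
    then have "convergent (\<lambda>n. \<Sum>k<n. Y (Suc k) u - Y k u)" by (simp add: summable_iff_convergent)
    moreover have "(\<Sum>k<n. Y (Suc k) u - Y k u) = Y n u - Y 0 u" for n
      by (rule sum_lessThan_telescope)
    ultimately have "convergent (\<lambda>n. Y n u - Y 0 u)" by (simp only:)
    then show "convergent (\<lambda>n. Y n u)" by (simp add: convergent_diff_const_right_iff)
  qed
  define h where "h u = lim (\<lambda>n. Y n u)" for u
  have [measurable]: "h \<in> borel_measurable borel" unfolding h_def by measurable
  have lim: "AE u in nu. (\<lambda>n. Y n u) \<longlonglongrightarrow> h u"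
    using conv by eventually_elim (simp add: h_def convergent_LIMSEQ_iff)
  have est: "(\<integral>\<^sup>+u. ennreal ((h u - Y n u)\<^sup>2) \<partial>nu) \<le> ennreal (((1/2) ^ n)\<^sup>2)" for n
  proof -
    have "(\<integral>\<^sup>+u. ennreal ((h u - Y n u)\<^sup>2) \<partial>nu) = (\<integral>\<^sup>+u. liminf (\<lambda>m. ennreal ((Y m u - Y n u)\<^sup>2)) \<partial>nu)"
    proof (rule nn_integral_cong_AE)
      show "AE u in nu. ennreal ((h u - Y n u)\<^sup>2) = liminf (\<lambda>m. ennreal ((Y m u - Y n u)\<^sup>2))"
        using lim
      proof eventually_elim
        case (elim u)
        then have "(\<lambda>m. ennreal ((Y m u - Y n u)\<^sup>2)) \<longlonglongrightarrow> ennreal ((h u - Y n u)\<^sup>2)"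
          by (intro tendsto_intros)
        then show ?case by (intro lim_imp_Liminf[symmetric]) auto
      qed
    qed
    also have "\<dots> \<le> liminf (\<lambda>m. \<integral>\<^sup>+u. ennreal ((Y m u - Y n u)\<^sup>2) \<partial>nu)"
      by (rule nn_integral_liminf) measurable
    also have "\<dots> \<le> liminf (\<lambda>m. ennreal (((1/2) ^ n)\<^sup>2))"
    proof (rule Liminf_mono)
      show "\<forall>\<^sub>F m in sequentially. (\<integral>\<^sup>+u. ennreal ((Y m u - Y n u)\<^sup>2) \<partial>nu) \<le> ennreal (((1/2) ^ n)\<^sup>2)"
        using eventually_ge_at_top[of n]
      proof eventually_elim
        case (elim m)
        then have "norm (X (r m) - X (r n)) < (1/2) ^ n"
          using fast[of n "r m"] r by (auto simp: strict_mono_less_eq)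
        then show ?case
          unfolding Y_def nn_integral_representative_diff by (intro ennreal_leI power_mono) auto
      qed
    qed
    also have "\<dots> = ennreal (((1/2) ^ n)\<^sup>2)" by (simp add: Liminf_const)
    finally show ?thesis .
  qed
  have hY: "sq_integrable (\<lambda>u. h u - Y n u)" for n
    unfolding sq_integrable_def
  proof
    show "integrable nu (\<lambda>u. (h u - Y n u)\<^sup>2)"
      using est[of n] by (intro integrableI_bounded) (auto simp: less_top[symmetric] top_unique)
  qed measurable
  have hsq: "sq_integrable h"
    using sq_integrable_add[OF hY[of 0] Ysq[of 0]] by simp
  have "norm (X (r n) - abs_L2nu h) \<le> (1/2) ^ n" for n
  proof -
    have "(norm (abs_L2nu h - X (r n)))\<^sup>2 = (\<integral>u. (h u - Y n u)\<^sup>2 \<partial>nu)"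
      using norm_abs_diff[OF hsq Ysq[of n]] by (simp add: Y_def abs_representative)
    then have "ennreal ((norm (abs_L2nu h - X (r n)))\<^sup>2) \<le> ennreal (((1/2) ^ n)\<^sup>2)"
      using est[of n] hY[of n] by (simp add: nn_integral_eq_integral sq_integrable_def)
    then have "(norm (abs_L2nu h - X (r n)))\<^sup>2 \<le> ((1/2) ^ n)\<^sup>2" by (simp add: ennreal_le_iff)
    then show ?thesis by (subst norm_minus_commute) (rule power2_le_imp_le, simp_all)
  qed
  then have "(\<lambda>n. norm ((X \<circ> r) n - abs_L2nu h)) \<longlonglongrightarrow> 0"
    by (intro tendsto_sandwich[OF _ _ tendsto_const LIMSEQ_power_zero[of "1/2::real"]]) auto
  then have "(X \<circ> r) \<longlonglongrightarrow> abs_L2nu h"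
    by (simp add: LIM_zero_cancel tendsto_norm_zero_iff)
  then show "convergent X"
    using Cauchy_converges_subseq[OF X r] by (auto simp: convergent_def)
qed

section \<open>Splitting the kernel over intervals\<close>

lemma AE_nu_neq: "AE w in nu. w \<noteq> u"
  unfolding nu_def using AE_lborel_singleton[of u] by (subst AE_density) auto

interpretation nu_pair: pair_sigma_finite nu nu ..

text \<open>A point \<open>(x, s)\<close> of the plane with \<open>0 < s\<close> stands for the interval \<open>[x, x + s]\<close>.\<close>

abbreviation plane :: "(real \<times> real) measure" where
  "plane \<equiv> lborel \<Otimes>\<^sub>M lborel"

interpretation plane: sigma_finite_measure plane
  by (simp add: lborel_prod sigma_finite_lborel)

interpretation nu_plane: pair_sigma_finite nu plane ..

interpretation nu_pair_plane: pair_sigma_finite "nu \<Otimes>\<^sub>M nu" plane ..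

text \<open>The height is the square root of \<open>\<alpha> (\<alpha> + 1) s\<^sup>-\<^sup>\<alpha>\<^sup>-\<^sup>2\<close>, the density with which intervals of
  length \<open>s\<close> must be weighted for their indicators X\<close>

definition interval_fun :: "real \<Rightarrow> real \<times> real \<Rightarrow> real \<Rightarrow> real" where
  "interval_fun \<alpha> \<omega> u = (if 0 < snd \<omega> \<and> fst \<omega> \<le> u \<and> u \<le> fst \<omega> + snd \<omega>
     then sqrt (\<alpha> * (\<alpha> + 1)) * snd \<omega> powr (- (\<alpha> / 2 + 1)) else 0)"

lemma interval_fun_measurable [measurable (raw)]:
  assumes [measurable]: "(\<lambda>x. fst (f x)) \<in> borel_measurable M" "(\<lambda>x. snd (f x)) \<in> borel_measurable M"
    "g \<in> borel_measurable M"
  shows "(\<lambda>x. interval_fun \<alpha> (f x) (g x)) \<in> borel_measurable M"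
  unfolding interval_fun_def by measurable

lemma interval_fun_nonneg: "0 < \<alpha> \<Longrightarrow> 0 \<le> interval_fun \<alpha> \<omega> u"
  by (simp add: interval_fun_def)

lemma sq_integrable_interval_fun: "sq_integrable (interval_fun \<alpha> \<omega>)"
  unfolding sq_integrable_def
proof
  show "interval_fun \<alpha> \<omega> \<in> borel_measurable nu" by measurable
  show "integrable nu (\<lambda>u. (interval_fun \<alpha> \<omega> u)\<^sup>2)"
    by (intro nu.integrable_const_bound[where B = "(sqrt (\<alpha> * (\<alpha> + 1)) * snd \<omega> powr (- (\<alpha> / 2 + 1)))\<^sup>2"] AE_I2)
       (simp_all add: interval_fun_def)
qed

text \<open>With \<open>d = \<bar>u - w\<bar>\<close>, the left end points of the intervals of length \<open>s\<close> that contain both \<open>u\<close> and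
  \<open>w\<close> form a segment of length \<open>s - d\<close>, so the integral is
  \<open>\<integral>\<^sub>d\<^sup>\<infinity> \<alpha> (\<alpha> + 1) (s - d) s\<^sup>-\<^sup>\<alpha>\<^sup>-\<^sup>2 ds = d\<^sup>-\<^sup>\<alpha>\<close>.  On the diagonal the integral is infinite whereas
  \<^const>\<open>riesz_kernel\<close> is \<open>0\<close>; the later uses are insensitive to this null set.\<close>

lemma nn_integral_interval_fun:
  assumes \<alpha>: "0 < \<alpha>" "\<alpha> < 1" and "u \<noteq> w"
  shows "(\<integral>\<^sup>+\<omega>. ennreal (interval_fun \<alpha> \<omega> u * interval_fun \<alpha> \<omega> w) \<partial>plane) = ennreal (riesz_kernel \<alpha> u w)"
proof -
  define d where "d = \<bar>u - w\<bar>"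
  have d: "0 < d" using assms by (simp add: d_def)
  have "(\<integral>\<^sup>+\<omega>. ennreal (interval_fun \<alpha> \<omega> u * interval_fun \<alpha> \<omega> w) \<partial>plane) =
    (\<integral>\<^sup>+s. \<integral>\<^sup>+x. ennreal (interval_fun \<alpha> (x, s) u * interval_fun \<alpha> (x, s) w) \<partial>lborel \<partial>lborel)"
    by (rule lborel_pair.nn_integral_snd[symmetric]) measurable
  also have "\<dots> = (\<integral>\<^sup>+s. ennreal (\<alpha> * (\<alpha> + 1) * (s - d) * s powr (- \<alpha> - 2)) * indicator {d..} s \<partial>lborel)"
  proof (rule nn_integral_cong)
    fix s :: real
    define c where "c = \<alpha> * (\<alpha> + 1) * s powr (- \<alpha> - 2)"
    have c0: "0 \<le> c" using \<alpha> by (simp add: c_def)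
    have "interval_fun \<alpha> (x, s) u * interval_fun \<alpha> (x, s) w = c * indicator {max u w - s .. min u w} x" for x
    proof (cases "0 < s \<and> x \<in> {max u w - s .. min u w}")
      case True
      have "s powr (- (\<alpha> / 2 + 1)) * s powr (- (\<alpha> / 2 + 1)) = s powr (- \<alpha> - 2)"
        unfolding powr_add[symmetric] by simp
      moreover have "sqrt (\<alpha> * (\<alpha> + 1)) * sqrt (\<alpha> * (\<alpha> + 1)) = \<alpha> * (\<alpha> + 1)" using \<alpha> by simp
      moreover have "interval_fun \<alpha> (x, s) u * interval_fun \<alpha> (x, s) w =
        (sqrt (\<alpha> * (\<alpha> + 1)) * sqrt (\<alpha> * (\<alpha> + 1))) * (s powr (- (\<alpha> / 2 + 1)) * s powr (- (\<alpha> / 2 + 1)))"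
        using True by (auto simp: interval_fun_def)
      ultimately show ?thesis using True by (simp add: c_def)
    next
      case False
      then show ?thesis using d by (auto simp: interval_fun_def d_def split: split_indicator)
    qed
    then have "(\<integral>\<^sup>+x. ennreal (interval_fun \<alpha> (x, s) u * interval_fun \<alpha> (x, s) w) \<partial>lborel) =
      (\<integral>\<^sup>+x. ennreal c * indicator {max u w - s .. min u w} x \<partial>lborel)"
      using c0 by (intro nn_integral_cong) (auto split: split_indicator)
    also have "\<dots> = ennreal c * emeasure lborel {max u w - s .. min u w}"
      by (rule nn_integral_cmult_indicator) simp
    also have "\<dots> = ennreal c * (if d \<le> s then ennreal (s - d) else 0)"
    proof -
      have *: "min u w - (max u w - s) = s - d" "max u w - s \<le> min u w \<longleftrightarrow> d \<le> s" by (auto simp: d_def)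
      show ?thesis unfolding emeasure_lborel_Icc_eq * by simp
    qed
    also have "\<dots> = ennreal (\<alpha> * (\<alpha> + 1) * (s - d) * s powr (- \<alpha> - 2)) * indicator {d..} s"
      using c0 by (auto simp: c_def mult_ac simp flip: ennreal_mult)
    finally show "(\<integral>\<^sup>+x. ennreal (interval_fun \<alpha> (x, s) u * interval_fun \<alpha> (x, s) w) \<partial>lborel) =
      ennreal (\<alpha> * (\<alpha> + 1) * (s - d) * s powr (- \<alpha> - 2)) * indicator {d..} s" .
  qed
  also have "\<dots> = ennreal (0 - (\<alpha> * d * d powr (- \<alpha> - 1) - (\<alpha> + 1) * d powr (- \<alpha>)))"
  proof (rule nn_integral_FTC_atLeast[where F = "\<lambda>s. \<alpha> * d * s powr (- \<alpha> - 1) - (\<alpha> + 1) * s powr (- \<alpha>)"])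
    show "(\<lambda>s. \<alpha> * (\<alpha> + 1) * (s - d) * s powr (- \<alpha> - 2)) \<in> borel_measurable borel" by measurable
    fix s assume "d \<le> s"
    then have s: "0 < s" using d by simp
    have "1 + (- \<alpha> - 2) = - \<alpha> - 1" by simp
    then have "s powr (- \<alpha> - 1) = s powr 1 * s powr (- \<alpha> - 2)"
      by (metis powr_add)
    then have "s powr (- \<alpha> - 1) = s * s powr (- \<alpha> - 2)" using s by simp
    \<comment> \<open>the antiderivative tends to \<open>0\<close> at infinity and equals \<open>- d powr (- \<alpha>)\<close> at \<open>d\<close>\<close>
    then show "((\<lambda>s. \<alpha> * d * s powr (- \<alpha> - 1) - (\<alpha> + 1) * s powr (- \<alpha>)) has_real_derivative
      \<alpha> * (\<alpha> + 1) * (s - d) * s powr (- \<alpha> - 2)) (at s)"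
      using s by (auto intro!: derivative_eq_intros simp: algebra_simps)
    show "0 \<le> \<alpha> * (\<alpha> + 1) * (s - d) * s powr (- \<alpha> - 2)"
      using \<alpha> \<open>d \<le> s\<close> by simp
  next
    have "((\<lambda>s. \<alpha> * d * s powr (- \<alpha> - 1) - (\<alpha> + 1) * s powr (- \<alpha>)) \<longlongrightarrow> \<alpha> * d * 0 - (\<alpha> + 1) * 0) at_top"
      using \<alpha> by (intro tendsto_intros tendsto_neg_powr filterlim_ident) auto
    then show "((\<lambda>s. \<alpha> * d * s powr (- \<alpha> - 1) - (\<alpha> + 1) * s powr (- \<alpha>)) \<longlongrightarrow> 0) at_top" by simp
  qed
  also have "0 - (\<alpha> * d * d powr (- \<alpha> - 1) - (\<alpha> + 1) * d powr (- \<alpha>)) = riesz_kernel \<alpha> u w"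
  proof -
    have "d * d powr (- \<alpha> - 1) = d powr 1 * d powr (- \<alpha> - 1)" using d by simp
    also have "\<dots> = d powr (- \<alpha>)" unfolding powr_add[symmetric] by simp
    finally show ?thesis by (simp add: riesz_kernel_def d_def algebra_simps)
  qed
  finally show ?thesis .
qed

text \<open>Schur's test: \<open>\<bar>f(u) g(v)\<bar> \<le> f(u)\<^sup>2 + g(v)\<^sup>2\<close>, and the kernel has uniformly bounded marginals.\<close>

lemma integrable_riesz_product:
  assumes \<alpha>: "0 < \<alpha>" "\<alpha> < 1" and f: "sq_integrable f" and g: "sq_integrable g"
  shows "integrable (nu \<Otimes>\<^sub>M nu) (\<lambda>(u, v). riesz_kernel \<alpha> u v * (f u * g v))"
proof (rule integrableI_bounded)
  have [measurable]: "f \<in> borel_measurable borel" "g \<in> borel_measurable borel"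
    using f g by (auto intro: sq_integrable_measurable)
  show "(\<lambda>(u, v). riesz_kernel \<alpha> u v * (f u * g v)) \<in> borel_measurable (nu \<Otimes>\<^sub>M nu)"
    by measurable
  have fin: "(\<integral>\<^sup>+u. ennreal ((h u)\<^sup>2) * (\<integral>\<^sup>+v. riesz_kernel \<alpha> u v \<partial>nu) \<partial>nu) < \<infinity>" if "sq_integrable h" for h
  proof -
    have "(\<integral>\<^sup>+u. ennreal ((h u)\<^sup>2) * (\<integral>\<^sup>+v. riesz_kernel \<alpha> u v \<partial>nu) \<partial>nu) \<le> (\<integral>\<^sup>+u. ennreal ((h u)\<^sup>2) * ennreal (schur_const \<alpha>) \<partial>nu)"
      by (intro nn_integral_mono mult_left_mono nn_integral_riesz_kernel_le \<alpha>) auto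
    also have "\<dots> = (\<integral>\<^sup>+u. ennreal ((h u)\<^sup>2) \<partial>nu) * ennreal (schur_const \<alpha>)"
      using that by (intro nn_integral_multc) (auto simp: sq_integrable_def)
    also have "\<dots> < \<infinity>"
    proof -
      have "(\<integral>\<^sup>+u. ennreal ((h u)\<^sup>2) \<partial>nu) < \<infinity>"
        using that by (auto simp: sq_integrable_def integrable_iff_bounded)
      then show ?thesis by (simp add: ennreal_mult_less_top)
    qed
    finally show ?thesis .
  qed
  have "(\<integral>\<^sup>+p. ennreal (norm ((\<lambda>(u, v). riesz_kernel \<alpha> u v * (f u * g v)) p)) \<partial>(nu \<Otimes>\<^sub>M nu))
     = (\<integral>\<^sup>+u. \<integral>\<^sup>+v. ennreal (riesz_kernel \<alpha> u v * (\<bar>f u\<bar> * \<bar>g v\<bar>)) \<partial>nu \<partial>nu)"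
    by (subst nu.nn_integral_fst[symmetric]) (auto simp: abs_mult)
  also have "\<dots> \<le> (\<integral>\<^sup>+u. \<integral>\<^sup>+v. ennreal ((f u)\<^sup>2) * ennreal (riesz_kernel \<alpha> u v) + ennreal ((g v)\<^sup>2) * ennreal (riesz_kernel \<alpha> v u) \<partial>nu \<partial>nu)"
  proof (intro nn_integral_mono)
    fix u v
    have "\<bar>f u\<bar> * \<bar>g v\<bar> \<le> (f u)\<^sup>2 + (g v)\<^sup>2"
      using sum_squares_bound[of "\<bar>f u\<bar>" "\<bar>g v\<bar>"] mult_nonneg_nonneg[of "\<bar>f u\<bar>" "\<bar>g v\<bar>"] by (simp del: mult_nonneg_nonneg)
    then have "riesz_kernel \<alpha> u v * (\<bar>f u\<bar> * \<bar>g v\<bar>) \<le> riesz_kernel \<alpha> u v * ((f u)\<^sup>2 + (g v)\<^sup>2)"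
      by (rule mult_left_mono) simp
    then show "ennreal (riesz_kernel \<alpha> u v * (\<bar>f u\<bar> * \<bar>g v\<bar>)) \<le> ennreal ((f u)\<^sup>2) * ennreal (riesz_kernel \<alpha> u v) + ennreal ((g v)\<^sup>2) * ennreal (riesz_kernel \<alpha> v u)"
      by (simp add: riesz_kernel_commute[of \<alpha> v u] algebra_simps flip: ennreal_mult' ennreal_plus)
  qed
  also have "\<dots> = (\<integral>\<^sup>+u. \<integral>\<^sup>+v. ennreal ((f u)\<^sup>2) * ennreal (riesz_kernel \<alpha> u v) \<partial>nu \<partial>nu) +
     (\<integral>\<^sup>+u. \<integral>\<^sup>+v. ennreal ((g v)\<^sup>2) * ennreal (riesz_kernel \<alpha> v u) \<partial>nu \<partial>nu)"
    by (simp add: nn_integral_add)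
  also have "(\<integral>\<^sup>+u. \<integral>\<^sup>+v. ennreal ((g v)\<^sup>2) * ennreal (riesz_kernel \<alpha> v u) \<partial>nu \<partial>nu) =
     (\<integral>\<^sup>+v. \<integral>\<^sup>+u. ennreal ((g v)\<^sup>2) * ennreal (riesz_kernel \<alpha> v u) \<partial>nu \<partial>nu)"
    by (rule nu_pair.Fubini') measurable
  also have "(\<integral>\<^sup>+u. \<integral>\<^sup>+v. ennreal ((f u)\<^sup>2) * ennreal (riesz_kernel \<alpha> u v) \<partial>nu \<partial>nu) + \<dots> < \<infinity>"
    using fin[OF f] fin[OF g] by (simp add: nn_integral_cmult)
  finally show "(\<integral>\<^sup>+p. ennreal (norm ((\<lambda>(u, v). riesz_kernel \<alpha> u v * (f u * g v)) p)) \<partial>(nu \<Otimes>\<^sub>M nu)) < \<infinity>" .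
qed

lemma riesz_form_symmetric:
  assumes \<alpha>: "0 < \<alpha>" "\<alpha> < 1" and f: "sq_integrable f" and g: "sq_integrable g"
  shows "(\<integral>u. (\<integral>v. riesz_kernel \<alpha> u v * f v \<partial>nu) * g u \<partial>nu) = (\<integral>u. f u * (\<integral>v. riesz_kernel \<alpha> u v * g v \<partial>nu) \<partial>nu)"
proof -
  have "(\<integral>u. f u * (\<integral>v. riesz_kernel \<alpha> u v * g v \<partial>nu) \<partial>nu) = (\<integral>u. \<integral>v. riesz_kernel \<alpha> u v * (f u * g v) \<partial>nu \<partial>nu)"
    by (simp add: mult_ac flip: integral_mult_right_zero)
  also have "\<dots> = (\<integral>v. \<integral>u. riesz_kernel \<alpha> u v * (f u * g v) \<partial>nu \<partial>nu)"
    by (rule nu_pair.Fubini_integral[symmetric, OF integrable_riesz_product[OF assms]])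
  also have "\<dots> = (\<integral>u. (\<integral>v. riesz_kernel \<alpha> u v * f v \<partial>nu) * g u \<partial>nu)"
    by (simp add: mult_ac riesz_kernel_commute flip: integral_mult_right_zero)
  finally show ?thesis ..
qed

lemma integral_tensor_square:
  fixes g :: "real \<Rightarrow> real"
  assumes g: "integrable nu g"
  shows "(\<integral>p. g (fst p) * g (snd p) \<partial>(nu \<Otimes>\<^sub>M nu)) = (\<integral>u. g u \<partial>nu)\<^sup>2"
proof -
  have [measurable]: "g \<in> borel_measurable nu" using g by simp
  have "integrable (nu \<Otimes>\<^sub>M nu) (\<lambda>p. g (fst p) * g (snd p))"
  proof (rule nu_pair.Fubini_integrable)
    show "integrable nu (\<lambda>x. \<integral>y. norm (g (fst (x, y)) * g (snd (x, y))) \<partial>nu)"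
      using g by (simp add: abs_mult)
    show "AE x in nu. integrable nu (\<lambda>y. g (fst (x, y)) * g (snd (x, y)))"
      using g by simp
  qed measurable
  then have "(\<integral>p. g (fst p) * g (snd p) \<partial>(nu \<Otimes>\<^sub>M nu)) = (\<integral>u. \<integral>v. g u * g v \<partial>nu \<partial>nu)"
    by (subst nu_pair.integral_fst'[symmetric]) auto
  then show ?thesis by (simp add: power2_eq_square)
qed

text \<open>Insert the interval representation of the kernel into \<open>\<langle>f, S f\<rangle>\<close> and exchange the integrals.
  Fubini's theorem applies because the factors \<open>\<phi>\<^sub>\<omega>\<close> are nonnegative: the integral of the absolute
  value is again a kernel integral, now of \<open>\<bar>f(u)\<bar> \<bar>f(v)\<bar>\<close>.\<close>

lemma riesz_quadratic_form:
  assumes \<alpha>: "0 < \<alpha>" "\<alpha> < 1" and f: "sq_integrable f"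
  shows "integrable plane (\<lambda>\<omega>. (\<integral>u. interval_fun \<alpha> \<omega> u * f u \<partial>nu)\<^sup>2)"
    and "(\<integral>u. f u * (\<integral>v. riesz_kernel \<alpha> u v * f v \<partial>nu) \<partial>nu) = (\<integral>\<omega>. (\<integral>u. interval_fun \<alpha> \<omega> u * f u \<partial>nu)\<^sup>2 \<partial>plane)"
proof -
  have [measurable]: "f \<in> borel_measurable borel"
    using f by (auto intro: sq_integrable_measurable)
  define F where "F p \<omega> = (interval_fun \<alpha> \<omega> (fst p) * f (fst p)) * (interval_fun \<alpha> \<omega> (snd p) * f (snd p))" for p \<omega>
  have Fm [measurable]: "case_prod F \<in> borel_measurable ((nu \<Otimes>\<^sub>M nu) \<Otimes>\<^sub>M plane)"
    unfolding F_def by measurable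
  \<comment> \<open>the interval representation of the kernel fails on the diagonal, which is a null set\<close>
  have AE: "AE p in nu \<Otimes>\<^sub>M nu. snd p \<noteq> fst p"
  proof (rule nu_pair.AE_pair_measure)
    show "{p \<in> space (nu \<Otimes>\<^sub>M nu). snd p \<noteq> fst p} \<in> sets (nu \<Otimes>\<^sub>M nu)" by measurable
    show "AE x in nu. AE y in nu. snd (x, y) \<noteq> fst (x, y)" using AE_nu_neq by simp
  qed
  have H: "has_bochner_integral plane (\<lambda>\<omega>. interval_fun \<alpha> \<omega> u * interval_fun \<alpha> \<omega> w) (riesz_kernel \<alpha> u w)"
    if "w \<noteq> u" for u w
    using that \<alpha> by (intro has_bochner_integral_nn_integral)
      (auto simp: interval_fun_nonneg nn_integral_interval_fun)
  have HF: "has_bochner_integral plane (F p) (riesz_kernel \<alpha> (fst p) (snd p) * (f (fst p) * f (snd p)))"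
    and HFn: "has_bochner_integral plane (\<lambda>\<omega>. norm (F p \<omega>)) (norm (riesz_kernel \<alpha> (fst p) (snd p) * (f (fst p) * f (snd p))))"
    if "snd p \<noteq> fst p" for p
  proof -
    from has_bochner_integral_mult_left[OF H[OF that], of "f (fst p) * f (snd p)"]
    show "has_bochner_integral plane (F p) (riesz_kernel \<alpha> (fst p) (snd p) * (f (fst p) * f (snd p)))"
      by (simp add: F_def[abs_def] mult_ac)
    from has_bochner_integral_mult_left[OF H[OF that], of "\<bar>f (fst p) * f (snd p)\<bar>"]
    show "has_bochner_integral plane (\<lambda>\<omega>. norm (F p \<omega>)) (norm (riesz_kernel \<alpha> (fst p) (snd p) * (f (fst p) * f (snd p))))"
      using \<alpha> by (simp add: F_def[abs_def] abs_mult interval_fun_nonneg mult_ac)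
  qed
  have K: "integrable (nu \<Otimes>\<^sub>M nu) (\<lambda>p. riesz_kernel \<alpha> (fst p) (snd p) * (f (fst p) * f (snd p)))"
    using integrable_riesz_product[OF \<alpha> f f] by (simp add: case_prod_unfold)
  have int: "integrable ((nu \<Otimes>\<^sub>M nu) \<Otimes>\<^sub>M plane) (case_prod F)"
  proof (rule nu_pair_plane.Fubini_integrable)
    have "AE p in nu \<Otimes>\<^sub>M nu. norm (riesz_kernel \<alpha> (fst p) (snd p) * (f (fst p) * f (snd p))) = (\<integral>\<omega>. norm (case_prod F (p, \<omega>)) \<partial>plane)"
      using AE by eventually_elim (use HFn has_bochner_integral_integral_eq in force)
    then show "integrable (nu \<Otimes>\<^sub>M nu) (\<lambda>p. \<integral>\<omega>. norm (case_prod F (p, \<omega>)) \<partial>plane)"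
      by (rule integrable_cong_AE_imp[OF integrable_norm[OF K], rotated]) measurable
    show "AE p in nu \<Otimes>\<^sub>M nu. integrable plane (\<lambda>\<omega>. case_prod F (p, \<omega>))"
      using AE by eventually_elim (use HF in \<open>force simp: has_bochner_integral_iff\<close>)
  qed measurable
  have inner: "(\<integral>p. F p \<omega> \<partial>(nu \<Otimes>\<^sub>M nu)) = (\<integral>u. interval_fun \<alpha> \<omega> u * f u \<partial>nu)\<^sup>2" for \<omega>
    unfolding F_def using sq_integrable_mult[OF sq_integrable_interval_fun f]
    by (intro integral_tensor_square)
  show "integrable plane (\<lambda>\<omega>. (\<integral>u. interval_fun \<alpha> \<omega> u * f u \<partial>nu)\<^sup>2)"
    using nu_pair_plane.integrable_snd[OF int] by (simp add: inner)
  have "(\<integral>u. f u * (\<integral>v. riesz_kernel \<alpha> u v * f v \<partial>nu) \<partial>nu) = (\<integral>u. \<integral>v. riesz_kernel \<alpha> u v * (f u * f v) \<partial>nu \<partial>nu)"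
    by (simp add: mult_ac flip: integral_mult_right_zero)
  also have "\<dots> = (\<integral>p. riesz_kernel \<alpha> (fst p) (snd p) * (f (fst p) * f (snd p)) \<partial>(nu \<Otimes>\<^sub>M nu))"
    using nu_pair.integral_fst'[OF K] by simp
  also have "\<dots> = (\<integral>p. \<integral>\<omega>. F p \<omega> \<partial>plane \<partial>(nu \<Otimes>\<^sub>M nu))"
  proof (rule integral_cong_AE)
    show "AE p in nu \<Otimes>\<^sub>M nu. riesz_kernel \<alpha> (fst p) (snd p) * (f (fst p) * f (snd p)) = (\<integral>\<omega>. F p \<omega> \<partial>plane)"
      using AE by eventually_elim (use HF has_bochner_integral_integral_eq in force)
  qed (use K in auto)
  also have "\<dots> = (\<integral>\<omega>. \<integral>p. F p \<omega> \<partial>(nu \<Otimes>\<^sub>M nu) \<partial>plane)"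
    by (rule nu_pair_plane.Fubini_integral[symmetric, OF int])
  finally show "(\<integral>u. f u * (\<integral>v. riesz_kernel \<alpha> u v * f v \<partial>nu) \<partial>nu) = (\<integral>\<omega>. (\<integral>u. interval_fun \<alpha> \<omega> u * f u \<partial>nu)\<^sup>2 \<partial>plane)"
    by (simp add: inner)
qed

text \<open>Both sides are the trace of the cube of the operator.  Expanding the square gives a product
  \<open>\<phi>\<^sub>\<omega>(u) \<phi>\<^sub>\<omega>(w)\<close>, and its integral over \<open>\<omega>\<close> is the third kernel.\<close>

lemma nn_integral_riesz_interval_fun:
  assumes \<alpha>: "0 < \<alpha>" "\<alpha> < 1"
  shows "(\<integral>\<^sup>+\<omega>. ennreal (\<integral>v. (\<integral>u. riesz_kernel \<alpha> v u * interval_fun \<alpha> \<omega> u \<partial>nu)\<^sup>2 \<partial>nu) \<partial>plane)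
    = (\<integral>\<^sup>+u. \<integral>\<^sup>+v. \<integral>\<^sup>+w. ennreal (riesz_kernel \<alpha> u v * riesz_kernel \<alpha> u w * riesz_kernel \<alpha> v w) \<partial>nu \<partial>nu \<partial>nu)"
proof -
  have 1: "ennreal (\<integral>v. (\<integral>u. riesz_kernel \<alpha> v u * interval_fun \<alpha> \<omega> u \<partial>nu)\<^sup>2 \<partial>nu)
    = (\<integral>\<^sup>+v. \<integral>\<^sup>+u. \<integral>\<^sup>+w. ennreal (riesz_kernel \<alpha> v u * riesz_kernel \<alpha> v w) * ennreal (interval_fun \<alpha> \<omega> u * interval_fun \<alpha> \<omega> w) \<partial>nu \<partial>nu \<partial>nu)" for \<omega>
  proof -
    have sq: "sq_integrable (\<lambda>v. \<integral>u. riesz_kernel \<alpha> v u * interval_fun \<alpha> \<omega> u \<partial>nu)"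
      using \<alpha> by (intro schur_bound_real(2) sq_integrable_interval_fun)
    have "ennreal (\<integral>v. (\<integral>u. riesz_kernel \<alpha> v u * interval_fun \<alpha> \<omega> u \<partial>nu)\<^sup>2 \<partial>nu) =
      (\<integral>\<^sup>+v. ennreal ((\<integral>u. riesz_kernel \<alpha> v u * interval_fun \<alpha> \<omega> u \<partial>nu)\<^sup>2) \<partial>nu)"
      using sq by (intro nn_integral_eq_integral[symmetric]) (auto simp: sq_integrable_def)
    also have "\<dots> = (\<integral>\<^sup>+v. \<integral>\<^sup>+u. \<integral>\<^sup>+w. ennreal (riesz_kernel \<alpha> v u * riesz_kernel \<alpha> v w) * ennreal (interval_fun \<alpha> \<omega> u * interval_fun \<alpha> \<omega> w) \<partial>nu \<partial>nu \<partial>nu)"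
    proof (rule nn_integral_cong_AE)
      have "AE v in nu. integrable nu (\<lambda>u. riesz_kernel \<alpha> v u * interval_fun \<alpha> \<omega> u)"
        using \<alpha> by (intro schur_bound_real(1) sq_integrable_interval_fun)
      then show "AE v in nu. ennreal ((\<integral>u. riesz_kernel \<alpha> v u * interval_fun \<alpha> \<omega> u \<partial>nu)\<^sup>2) =
        (\<integral>\<^sup>+u. \<integral>\<^sup>+w. ennreal (riesz_kernel \<alpha> v u * riesz_kernel \<alpha> v w) * ennreal (interval_fun \<alpha> \<omega> u * interval_fun \<alpha> \<omega> w) \<partial>nu \<partial>nu)"
      proof eventually_elim
        case (elim v)
        have "ennreal ((\<integral>u. riesz_kernel \<alpha> v u * interval_fun \<alpha> \<omega> u \<partial>nu)\<^sup>2) = (ennreal (\<integral>u. riesz_kernel \<alpha> v u * interval_fun \<alpha> \<omega> u \<partial>nu))\<^sup>2"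
          using \<alpha> by (intro ennreal_power[symmetric]) (auto simp: interval_fun_nonneg)
        also have "ennreal (\<integral>u. riesz_kernel \<alpha> v u * interval_fun \<alpha> \<omega> u \<partial>nu) = (\<integral>\<^sup>+u. ennreal (riesz_kernel \<alpha> v u * interval_fun \<alpha> \<omega> u) \<partial>nu)"
          using elim \<alpha> by (intro nn_integral_eq_integral[symmetric]) (auto simp: interval_fun_nonneg)
        also have "\<dots>\<^sup>2 = (\<integral>\<^sup>+u. \<integral>\<^sup>+w. ennreal (riesz_kernel \<alpha> v u * interval_fun \<alpha> \<omega> u) * ennreal (riesz_kernel \<alpha> v w * interval_fun \<alpha> \<omega> w) \<partial>nu \<partial>nu)"
          by (simp add: power2_eq_square nn_integral_cmult nn_integral_multc)
        also have "\<dots> = (\<integral>\<^sup>+u. \<integral>\<^sup>+w. ennreal (riesz_kernel \<alpha> v u * riesz_kernel \<alpha> v w) * ennreal (interval_fun \<alpha> \<omega> u * interval_fun \<alpha> \<omega> w) \<partial>nu \<partial>nu)"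
          using \<alpha> by (intro nn_integral_cong) (simp add: interval_fun_nonneg mult_ac flip: ennreal_mult)
        finally show ?case .
      qed
    qed
    finally show ?thesis .
  qed
  have "(\<integral>\<^sup>+\<omega>. ennreal (\<integral>v. (\<integral>u. riesz_kernel \<alpha> v u * interval_fun \<alpha> \<omega> u \<partial>nu)\<^sup>2 \<partial>nu) \<partial>plane)
    = (\<integral>\<^sup>+v. \<integral>\<^sup>+\<omega>. \<integral>\<^sup>+u. \<integral>\<^sup>+w. ennreal (riesz_kernel \<alpha> v u * riesz_kernel \<alpha> v w) * ennreal (interval_fun \<alpha> \<omega> u * interval_fun \<alpha> \<omega> w) \<partial>nu \<partial>nu \<partial>plane \<partial>nu)"
    unfolding 1 by (rule nu_plane.Fubini') measurable
  also have "\<dots> = (\<integral>\<^sup>+v. \<integral>\<^sup>+u. \<integral>\<^sup>+\<omega>. \<integral>\<^sup>+w. ennreal (riesz_kernel \<alpha> v u * riesz_kernel \<alpha> v w) * ennreal (interval_fun \<alpha> \<omega> u * interval_fun \<alpha> \<omega> w) \<partial>nu \<partial>plane \<partial>nu \<partial>nu)"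
    by (rule nn_integral_cong, rule nu_plane.Fubini') measurable
  also have "\<dots> = (\<integral>\<^sup>+v. \<integral>\<^sup>+u. \<integral>\<^sup>+w. \<integral>\<^sup>+\<omega>. ennreal (riesz_kernel \<alpha> v u * riesz_kernel \<alpha> v w) * ennreal (interval_fun \<alpha> \<omega> u * interval_fun \<alpha> \<omega> w) \<partial>plane \<partial>nu \<partial>nu \<partial>nu)"
    by (rule nn_integral_cong, rule nn_integral_cong, rule nu_plane.Fubini') measurable
  also have "\<dots> = (\<integral>\<^sup>+v. \<integral>\<^sup>+u. \<integral>\<^sup>+w. ennreal (riesz_kernel \<alpha> v u * riesz_kernel \<alpha> v w * riesz_kernel \<alpha> u w) \<partial>nu \<partial>nu \<partial>nu)"
  proof (rule nn_integral_cong, rule nn_integral_cong, rule nn_integral_cong_AE)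
    fix v u
    show "AE w in nu. (\<integral>\<^sup>+\<omega>. ennreal (riesz_kernel \<alpha> v u * riesz_kernel \<alpha> v w) * ennreal (interval_fun \<alpha> \<omega> u * interval_fun \<alpha> \<omega> w) \<partial>plane) = ennreal (riesz_kernel \<alpha> v u * riesz_kernel \<alpha> v w * riesz_kernel \<alpha> u w)"
      using AE_nu_neq[of u]
    proof eventually_elim
      case (elim w)
      then show ?case
        using \<alpha> nn_integral_interval_fun[of \<alpha> u w] by (simp add: nn_integral_cmult ennreal_mult'')
    qed
  qed
  finally show ?thesis .
qed

section \<open>The double and triple kernel integrals\<close>

lemma nn_integral_Gamma_rate:
  fixes p c :: real
  assumes p: "0 < p" and c: "0 < c"
  shows "(\<integral>\<^sup>+x. ennreal (if 0 < x then x powr (p - 1) * exp (- (c * x)) else 0) \<partial>lborel) = ennreal (Gamma p / c powr p)"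
    (is "?I = _")
proof -
  have "ennreal (Gamma p) = ennreal \<bar>c\<bar> * (\<integral>\<^sup>+x. ennreal (indicator {0..} (0 + c * x) * (0 + c * x) powr (p - 1) / exp (0 + c * x)) \<partial>lborel)"
    unfolding Gamma_conv_nn_integral_real[OF p] using c by (intro nn_integral_real_affine) auto
  also have "(\<integral>\<^sup>+x. ennreal (indicator {0..} (0 + c * x) * (0 + c * x) powr (p - 1) / exp (0 + c * x)) \<partial>lborel)
      = (\<integral>\<^sup>+x. ennreal (c powr (p - 1)) * ennreal (if 0 < x then x powr (p - 1) * exp (- (c * x)) else 0) \<partial>lborel)"
    using c by (intro nn_integral_cong)
      (auto simp: indicator_def powr_mult exp_minus field_simps zero_le_mult_iff simp flip: ennreal_mult')
  also have "\<dots> = ennreal (c powr (p - 1)) * ?I"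
    by (intro nn_integral_cmult) measurable
  finally have "ennreal (Gamma p) = ennreal (c powr p) * ?I"
    using c by (simp add: powr_diff flip: mult.assoc ennreal_mult')
  then have "ennreal (1 / c powr p) * ennreal (Gamma p) = ennreal (1 / c powr p) * ennreal (c powr p) * ?I"
    by (simp add: mult.assoc)
  then show ?thesis using c by (simp flip: ennreal_mult')
qed

text \<open>The weight is written with a strict inequality, so that the origin drops out of all later case
  distinctions.\<close>

lemma nn_integral_nu:
  assumes [measurable]: "f \<in> borel_measurable borel"
  shows "(\<integral>\<^sup>+u. f u \<partial>nu) = (\<integral>\<^sup>+u. ennreal (if 0 < u then exp (- u) else 0) * f u \<partial>lborel)"
proof -
  have "(\<integral>\<^sup>+u. f u \<partial>nu) = (\<integral>\<^sup>+u. ennreal (exp (- u)) * indicator {0..} u * f u \<partial>lborel)"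
    unfolding nu_def by (rule nn_integral_density) auto
  also have "\<dots> = (\<integral>\<^sup>+u. ennreal (if 0 < u then exp (- u) else 0) * f u \<partial>lborel)"
    using AE_lborel_singleton[of "0::real"]
    by (intro nn_integral_cong_AE) (auto elim!: eventually_mono split: split_indicator)
  finally show ?thesis .
qed

lemma nn_integral_shift:
  fixes f :: "real \<Rightarrow> ennreal"
  assumes [measurable]: "f \<in> borel_measurable borel"
  shows "(\<integral>\<^sup>+v. f v \<partial>lborel) = (\<integral>\<^sup>+x. f (u + x) \<partial>lborel)"
  using nn_integral_real_affine[OF assms, of 1 u] by simp

lemma nn_integral_exp:
  fixes c :: real
  assumes "0 < c"
  shows "(\<integral>\<^sup>+x. ennreal (if 0 < x then exp (- (c * x)) else 0) \<partial>lborel) = ennreal (1 / c)"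
proof -
  have "(\<integral>\<^sup>+x. ennreal (if 0 < x then exp (- (c * x)) else 0) \<partial>lborel) =
    (\<integral>\<^sup>+x. ennreal (if 0 < x then x powr (1 - 1) * exp (- (c * x)) else 0) \<partial>lborel)"
    by (intro nn_integral_cong) auto
  then show ?thesis using nn_integral_Gamma_rate[of 1 c] assms by simp
qed

text \<open>Split into \<open>u < v\<close> and \<open>v < u\<close>, and integrate first over the smaller variable and the distance.
  For \<open>s = 0\<close> this is \<open>\<langle>1, S 1\<rangle> = a\<^sub>0\<close>; for \<open>s = 1\<close> it tests \<open>S 1\<close> against a second function, which shows
  that \<open>S 1\<close> is not constant.\<close>

lemma riesz_form_exp:
  assumes \<alpha>: "\<alpha> < 1" and s: "0 \<le> s"
  shows "(\<integral>\<^sup>+u. ennreal (exp (- (s * u))) * (\<integral>\<^sup>+v. riesz_kernel \<alpha> u v \<partial>nu) \<partial>nu)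
    = ennreal (Gamma (1 - \<alpha>) * (1 + (1 + s) powr (\<alpha> - 1)) / (2 + s))"
proof -
  define F where "F u v = ennreal (if 0 < u \<and> u < v then \<bar>u - v\<bar> powr (- \<alpha>) * exp (- ((1 + s) * u + v)) else 0)" for u v :: real
  define F' where "F' u v = ennreal (if 0 < u \<and> u < v then \<bar>u - v\<bar> powr (- \<alpha>) * exp (- (u + (1 + s) * v)) else 0)" for u v :: real
  have Fm [measurable]: "case_prod F \<in> borel_measurable (borel \<Otimes>\<^sub>M borel)"
    unfolding F_def by measurable
  have Fm' [measurable]: "case_prod F' \<in> borel_measurable (borel \<Otimes>\<^sub>M borel)"
    unfolding F'_def by measurable
  have G: "(\<integral>\<^sup>+x. ennreal (if 0 < x then x powr (- \<alpha>) * exp (- (c * x)) else 0) \<partial>lborel) = ennreal (Gamma (1 - \<alpha>) / c powr (1 - \<alpha>))"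
    if "0 < c" for c
  proof -
    have *: "1 - \<alpha> - 1 = - \<alpha>" by simp
    show ?thesis
      using nn_integral_Gamma_rate[of "1 - \<alpha>" c] \<alpha> that unfolding * by simp
  qed
  have "(\<integral>\<^sup>+u. ennreal (exp (- (s * u))) * (\<integral>\<^sup>+v. riesz_kernel \<alpha> u v \<partial>nu) \<partial>nu) =
    (\<integral>\<^sup>+u. ennreal (if 0 < u then exp (- u) else 0) * (ennreal (exp (- (s * u))) *
       (\<integral>\<^sup>+v. ennreal (if 0 < v then exp (- v) else 0) * riesz_kernel \<alpha> u v \<partial>lborel)) \<partial>lborel)"
    by (simp add: nn_integral_nu riesz_kernel_def)
  also have "\<dots> = (\<integral>\<^sup>+u. \<integral>\<^sup>+v. F u v + F' v u \<partial>lborel \<partial>lborel)"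
  proof (intro nn_integral_cong)
    fix u :: real
    have "ennreal (if 0 < u then exp (- u) else 0) * (ennreal (exp (- (s * u))) *
       (ennreal (if 0 < v then exp (- v) else 0) * riesz_kernel \<alpha> u v)) = F u v + F' v u" for v
      by (auto simp: F_def F'_def riesz_kernel_def abs_minus_commute algebra_simps simp flip: ennreal_mult' exp_add)
    note * = this
    show "ennreal (if 0 < u then exp (- u) else 0) * (ennreal (exp (- (s * u))) *
       (\<integral>\<^sup>+v. ennreal (if 0 < v then exp (- v) else 0) * riesz_kernel \<alpha> u v \<partial>lborel)) = (\<integral>\<^sup>+v. F u v + F' v u \<partial>lborel)"
      by (simp add: nn_integral_cmult flip: *)
  qed
  also have "\<dots> = (\<integral>\<^sup>+u. \<integral>\<^sup>+v. F u v \<partial>lborel \<partial>lborel) + (\<integral>\<^sup>+u. \<integral>\<^sup>+v. F' v u \<partial>lborel \<partial>lborel)"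
    by (subst nn_integral_add[symmetric], measurable) (simp add: nn_integral_add)
  also have "(\<integral>\<^sup>+u. \<integral>\<^sup>+v. F' v u \<partial>lborel \<partial>lborel) = (\<integral>\<^sup>+u. \<integral>\<^sup>+v. F' u v \<partial>lborel \<partial>lborel)"
    by (rule lborel_pair.Fubini') measurable
  also have "(\<integral>\<^sup>+u. \<integral>\<^sup>+v. F u v \<partial>lborel \<partial>lborel) = (\<integral>\<^sup>+u. \<integral>\<^sup>+x. F u (u + x) \<partial>lborel \<partial>lborel)"
    by (intro nn_integral_cong nn_integral_shift) measurable
  also have "\<dots> = (\<integral>\<^sup>+u. ennreal (if 0 < u then exp (- ((2 + s) * u)) else 0) *
       (\<integral>\<^sup>+x. ennreal (if 0 < x then x powr (- \<alpha>) * exp (- (1 * x)) else 0) \<partial>lborel) \<partial>lborel)"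
    by (subst nn_integral_cmult[symmetric], measurable, intro nn_integral_cong)
       (auto simp: F_def algebra_simps simp flip: ennreal_mult' exp_add)
  also have "\<dots> = ennreal (1 / (2 + s)) * ennreal (Gamma (1 - \<alpha>))"
    using s by (subst G) (auto simp: nn_integral_multc nn_integral_exp)
  also have "(\<integral>\<^sup>+u. \<integral>\<^sup>+v. F' u v \<partial>lborel \<partial>lborel) = (\<integral>\<^sup>+u. \<integral>\<^sup>+x. F' u (u + x) \<partial>lborel \<partial>lborel)"
    by (intro nn_integral_cong nn_integral_shift) measurable
  also have "\<dots> = (\<integral>\<^sup>+u. ennreal (if 0 < u then exp (- ((2 + s) * u)) else 0) *
       (\<integral>\<^sup>+x. ennreal (if 0 < x then x powr (- \<alpha>) * exp (- ((1 + s) * x)) else 0) \<partial>lborel) \<partial>lborel)"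
    by (subst nn_integral_cmult[symmetric], measurable, intro nn_integral_cong)
       (auto simp: F'_def algebra_simps simp flip: ennreal_mult' exp_add)
  also have "\<dots> = ennreal (1 / (2 + s)) * ennreal (Gamma (1 - \<alpha>) / (1 + s) powr (1 - \<alpha>))"
    using s by (subst G) (auto simp: nn_integral_multc nn_integral_exp)
  also have "ennreal (1 / (2 + s)) * ennreal (Gamma (1 - \<alpha>)) + ennreal (1 / (2 + s)) * ennreal (Gamma (1 - \<alpha>) / (1 + s) powr (1 - \<alpha>))
    = ennreal (1 / (2 + s) * Gamma (1 - \<alpha>) + 1 / (2 + s) * (Gamma (1 - \<alpha>) / (1 + s) powr (1 - \<alpha>)))"
    using s \<alpha> Gamma_real_pos[of "1 - \<alpha>"] by (simp flip: ennreal_mult' ennreal_plus)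
  also have "1 / (2 + s) * Gamma (1 - \<alpha>) + 1 / (2 + s) * (Gamma (1 - \<alpha>) / (1 + s) powr (1 - \<alpha>))
    = Gamma (1 - \<alpha>) * (1 + (1 + s) powr (\<alpha> - 1)) / (2 + s)"
    using powr_minus_divide[of "1 + s" "1 - \<alpha>"] by (simp add: divide_inverse algebra_simps)
  finally show ?thesis .
qed

lemma Gamma_duplication_real:
  fixes z :: real
  assumes "0 < z"
  shows "Gamma z * Gamma (z + 1/2) = 2 powr (1 - 2 * z) * sqrt pi * Gamma (2 * z)"
proof -
  have "complex_of_real z \<notin> \<int>\<^sub>\<le>\<^sub>0" "complex_of_real z + 1/2 \<notin> \<int>\<^sub>\<le>\<^sub>0"
    using assms by (auto elim!: nonpos_Ints_cases simp: complex_eq_iff)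
  then have "complex_of_real (Gamma z * Gamma (z + 1/2)) =
    complex_of_real (exp ((1 - 2 * z) * ln 2) * sqrt pi * Gamma (2 * z))"
    using Gamma_legendre_duplication[of "complex_of_real z"]
    by (simp add: Gamma_complex_of_real[symmetric] flip: exp_of_real)
  then show ?thesis unfolding of_real_eq_iff by (simp add: powr_def)
qed

text \<open>The integral is a hypergeometric function at \<open>-1\<close> to which Kummer's theorem applies, and the
  substitution \<open>z = (s / (2 + s))\<^sup>2\<close> is the quadratic transformation behind that theorem: since
  \<open>1 - z = 4 (1 + s) / (2 + s)\<^sup>2\<close>, all three factors become powers of \<open>z\<close> and \<open>1 - z\<close>.\<close>

lemma nn_integral_quadratic_beta:
  fixes \<alpha> :: real
  assumes \<alpha>: "0 < \<alpha>" "\<alpha> < 2/3"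
  shows "(\<integral>\<^sup>+s. ennreal (if 0 < s then s powr (- \<alpha>) * (1 + s) powr (- \<alpha>) * (2 + s) powr (3 * \<alpha> - 2) else 0) \<partial>lborel)
    = ennreal (4 powr (\<alpha> - 1) * Beta ((1 - \<alpha>) / 2) (1 - \<alpha>))"
proof -
  define g :: "real \<Rightarrow> real" where "g s = (s / (2 + s))\<^sup>2" for s
  define g' :: "real \<Rightarrow> real" where "g' s = 4 * s / (2 + s) ^ 3" for s
  define f :: "real \<Rightarrow> real" where "f z = z powr ((1 - \<alpha>) / 2 - 1) * (1 - z) powr (1 - \<alpha> - 1)" for z
  \<comment> \<open>the preimage of \<open>z = t\<^sup>2\<close> is \<open>s = 2 t / (1 - t)\<close>\<close>
  have img: "g ` {0<..} = {0<..<1}"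
  proof (intro equalityI subsetI)
    fix z :: real assume z: "z \<in> {0<..<1}"
    define t where "t = sqrt z"
    have t: "0 < t" "t < 1" "z = t\<^sup>2" using z by (auto simp: t_def)
    have "2 * t / (1 - t) / (2 + 2 * t / (1 - t)) = t" using t by (simp add: field_simps)
    then have "z = g (2 * t / (1 - t))" unfolding g_def using t by simp
    moreover have "0 < 2 * t / (1 - t)" using t by simp
    ultimately show "z \<in> g ` {0<..}" by blast
  next
    fix z assume "z \<in> g ` {0<..}"
    then obtain s where s: "0 < s" "z = (s / (2 + s))\<^sup>2" by (auto simp: g_def)
    have "(s / (2 + s))\<^sup>2 < 1\<^sup>2" using s by (intro power_strict_mono) auto
    then show "z \<in> {0<..<1}" using s by simp
  qed
  have inj: "inj_on g {0<..}"
  proof (rule inj_onI)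
    fix s t :: real assume *: "s \<in> {0<..}" "t \<in> {0<..}" "g s = g t"
    have "(s / (2 + s))\<^sup>2 = (t / (2 + t))\<^sup>2" using *(3) by (simp only: g_def)
    then have "s / (2 + s) = t / (2 + t)" by (rule power2_eq_imp_eq) (use *(1,2) in simp_all)
    then show "s = t" using * by (simp add: field_simps)
  qed
  have der: "(g has_field_derivative g' s) (at s within {0<..})" if "s \<in> {0<..}" for s
  proof -
    have "((\<lambda>s. s / (2 + s)) has_field_derivative 2 / (2 + s)\<^sup>2) (at s within {0<..})"
      using that by (auto intro!: derivative_eq_intros simp: power2_eq_square)
    from DERIV_power[OF this, of 2] show ?thesis
      by (simp add: g_def[abs_def] g'_def power2_eq_square power3_eq_cube mult_ac)
  qed
  have eq: "\<bar>g' s\<bar> * f (g s) = 4 powr (1 - \<alpha>) * (s powr (- \<alpha>) * (1 + s) powr (- \<alpha>) * (2 + s) powr (3 * \<alpha> - 2))"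
    if s: "s \<in> {0<..}" for s
  proof -
    have "1 - g s = 4 * (1 + s) * (2 + s) powr (-2)"
    proof -
      have "1 - g s = ((2 + s)\<^sup>2 - s\<^sup>2) / (2 + s)\<^sup>2"
        using s by (simp add: g_def power_divide diff_divide_distrib)
      also have "(2 + s)\<^sup>2 - s\<^sup>2 = 4 * (1 + s)" by (simp add: power2_eq_square algebra_simps)
      finally show ?thesis using s by (simp add: powr_minus_divide powr_numeral)
    qed
    then have "(1 - g s) powr (- \<alpha>) = 4 powr (- \<alpha>) * (1 + s) powr (- \<alpha>) * (2 + s) powr (2 * \<alpha>)"
      using s by (simp add: powr_mult powr_powr del: distrib_left_numeral)
    moreover have "g s powr ((1 - \<alpha>) / 2 - 1) = s powr (- \<alpha> - 1) * (2 + s) powr (\<alpha> + 1)"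
    proof -
      have "g s = s powr 2 * (2 + s) powr (-2)"
        using s by (simp add: g_def powr_minus_divide power_divide powr_numeral)
      moreover have "2 * ((1 - \<alpha>) / 2 - 1) = - \<alpha> - 1" "-2 * ((1 - \<alpha>) / 2 - 1) = \<alpha> + 1"
        by (simp_all add: field_simps)
      ultimately show ?thesis
        by (simp only: powr_mult powr_powr powr_ge_zero)
    qed
    moreover have "\<bar>g' s\<bar> = 4 powr 1 * s powr 1 * (2 + s) powr (-3)"
      using s by (simp add: g'_def powr_minus_divide powr_numeral)
    ultimately have "\<bar>g' s\<bar> * f (g s) = (4 powr 1 * 4 powr (- \<alpha>)) * ((s powr 1 * s powr (- \<alpha> - 1)) * (1 + s) powr (- \<alpha>) *
       ((2 + s) powr (-3) * (2 + s) powr (\<alpha> + 1) * (2 + s) powr (2 * \<alpha>)))"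
      by (simp add: f_def mult_ac)
    also have "\<dots> = 4 powr (1 - \<alpha>) * (s powr (- \<alpha>) * (1 + s) powr (- \<alpha>) * (2 + s) powr (3 * \<alpha> - 2))"
      unfolding powr_add[symmetric] by (simp add: algebra_simps)
    finally show ?thesis .
  qed
  have "(f has_integral Beta ((1 - \<alpha>) / 2) (1 - \<alpha>)) {0..1}"
    unfolding f_def using \<alpha> by (intro has_integral_Beta_real) auto
  then have Bint: "(f has_integral Beta ((1 - \<alpha>) / 2) (1 - \<alpha>)) {0<..<1}"
    by (simp add: has_integral_Icc_iff_Ioo)
  have "f absolutely_integrable_on g ` {0<..}"
    unfolding img using Bint
    by (intro nonnegative_absolutely_integrable_1) (auto simp: f_def)
  with Bint have "(\<lambda>s. \<bar>g' s\<bar> * f (g s)) absolutely_integrable_on {0<..} \<and>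
      integral {0<..} (\<lambda>s. \<bar>g' s\<bar> * f (g s)) = Beta ((1 - \<alpha>) / 2) (1 - \<alpha>)"
    by (subst has_absolute_integral_change_of_variables_1'[OF _ der inj]) (auto simp: img)
  then have "((\<lambda>s. \<bar>g' s\<bar> * f (g s)) has_integral Beta ((1 - \<alpha>) / 2) (1 - \<alpha>)) {0<..}"
    by (metis absolutely_integrable_on_def integrable_integral)
  then have "((\<lambda>s. 4 powr (1 - \<alpha>) * (s powr (- \<alpha>) * (1 + s) powr (- \<alpha>) * (2 + s) powr (3 * \<alpha> - 2)))
     has_integral Beta ((1 - \<alpha>) / 2) (1 - \<alpha>)) {0<..}"
    by (rule has_integral_eq[rotated]) (rule eq)
  from has_integral_mult_right[OF this, of "4 powr (\<alpha> - 1)"]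
  have "((\<lambda>s. s powr (- \<alpha>) * (1 + s) powr (- \<alpha>) * (2 + s) powr (3 * \<alpha> - 2))
     has_integral 4 powr (\<alpha> - 1) * Beta ((1 - \<alpha>) / 2) (1 - \<alpha>)) {0<..}"
    by (simp flip: mult.assoc powr_add)
  from nn_integral_has_integral_lebesgue[OF _ this]
  have "(\<integral>\<^sup>+s. ennreal (indicator {0<..} s * (s powr (- \<alpha>) * (1 + s) powr (- \<alpha>) * (2 + s) powr (3 * \<alpha> - 2))) \<partial>lborel) =
    ennreal (4 powr (\<alpha> - 1) * Beta ((1 - \<alpha>) / 2) (1 - \<alpha>))" by simp
  moreover have "(\<integral>\<^sup>+s. ennreal (if 0 < s then s powr (- \<alpha>) * (1 + s) powr (- \<alpha>) * (2 + s) powr (3 * \<alpha> - 2) else 0) \<partial>lborel)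
    = (\<integral>\<^sup>+s. ennreal (indicator {0<..} s * (s powr (- \<alpha>) * (1 + s) powr (- \<alpha>) * (2 + s) powr (3 * \<alpha> - 2))) \<partial>lborel)"
    by (intro nn_integral_cong) auto
  ultimately show ?thesis by simp
qed

text \<open>Two applications of the duplication formula, one to the product of the Gamma values at
  \<open>(1 - \<alpha>) / 2\<close> and \<open>1 - \<alpha> / 2\<close>, and one at \<open>1 - 3 \<alpha> / 2\<close> and \<open>3 (1 - \<alpha>) / 2\<close>.\<close>

lemma Q3_eq_Beta:
  fixes \<alpha> :: real
  assumes \<alpha>: "0 < \<alpha>" "\<alpha> < 2/3"
  shows "2 * (Gamma (2 - 3 * \<alpha>) * (4 powr (\<alpha> - 1) * Beta ((1 - \<alpha>) / 2) (1 - \<alpha>))) = Q3 \<alpha>"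
proof -
  define A B C D E where "A = Gamma ((1 - \<alpha>) / 2)" and "B = Gamma (1 - \<alpha>)" and "C = Gamma (1 - 3 * \<alpha> / 2)"
    and "D = Gamma (1 - \<alpha> / 2)" and "E = Gamma (3 * (1 - \<alpha>) / 2)"
  have pos: "0 < A" "0 < B" "0 < C" "0 < D" "0 < E"
    using \<alpha> by (auto simp: A_def B_def C_def D_def E_def)
  have 1: "A * D = 2 powr \<alpha> * sqrt pi * B"
    using Gamma_duplication_real[of "(1 - \<alpha>) / 2"] \<alpha> by (simp add: A_def B_def D_def add_divide_distrib diff_divide_distrib)
  have 2: "C * E = 2 powr (3 * \<alpha> - 1) * sqrt pi * Gamma (2 - 3 * \<alpha>)"
    using Gamma_duplication_real[of "1 - 3 * \<alpha> / 2"] \<alpha> by (simp add: C_def E_def add_divide_distrib diff_divide_distrib)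
  have Beta: "Beta ((1 - \<alpha>) / 2) (1 - \<alpha>) = A * B / E"
    by (simp add: Beta_def A_def B_def E_def field_simps)
  have four: "(4::real) powr (\<alpha> - 1) = 2 powr (2 * \<alpha> - 2)"
    using powr_powr[of 2 2 "\<alpha> - 1"] by (simp add: algebra_simps)
  have "2 * (Gamma (2 - 3 * \<alpha>) * (4 powr (\<alpha> - 1) * Beta ((1 - \<alpha>) / 2) (1 - \<alpha>))) * D * (2 powr (3 * \<alpha> - 1) * sqrt pi)
    = 2 * (C * E) * (2 powr (2 * \<alpha> - 2) * (A * B / E)) * D"
    unfolding 2 Beta four by (simp add: mult_ac)
  also have "\<dots> = 2 * 2 powr (2 * \<alpha> - 2) * C * B * (A * D)"
    using pos by (simp add: mult_ac)
  also have "\<dots> = (2 powr 1 * 2 powr (2 * \<alpha> - 2) * 2 powr \<alpha>) * sqrt pi * C * B\<^sup>2"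
    unfolding 1 by (simp add: mult_ac power2_eq_square)
  also have "\<dots> = 2 powr (3 * \<alpha> - 1) * sqrt pi * C * B\<^sup>2"
    unfolding powr_add[symmetric] by simp
  finally have "2 * (Gamma (2 - 3 * \<alpha>) * (4 powr (\<alpha> - 1) * Beta ((1 - \<alpha>) / 2) (1 - \<alpha>))) * D = C * B\<^sup>2"
    by (simp add: mult_ac)
  then have "2 * (Gamma (2 - 3 * \<alpha>) * (4 powr (\<alpha> - 1) * Beta ((1 - \<alpha>) / 2) (1 - \<alpha>))) = B\<^sup>2 * C / D"
    using pos by (simp add: nonzero_eq_divide_eq mult.commute)
  then show ?thesis unfolding Q3_def B_def C_def D_def .
qed

text \<open>By symmetry it suffices to integrate over \<open>x < y\<close>, twice.  The substitution \<open>y = x (1 + s)\<close>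
  collects the powers of \<open>x\<close>, and the integral over \<open>x\<close> becomes a Gamma integral with rate \<open>2 + s\<close>.\<close>

lemma nn_integral_double_kernel:
  fixes \<alpha> :: real
  assumes \<alpha>: "0 < \<alpha>" "\<alpha> < 2/3"
  shows "(\<integral>\<^sup>+x. \<integral>\<^sup>+y. ennreal (if 0 < x \<and> 0 < y then x powr (- \<alpha>) * y powr (- \<alpha>) * \<bar>x - y\<bar> powr (- \<alpha>) * exp (- (x + y)) else 0)
    \<partial>lborel \<partial>lborel) = ennreal (Q3 \<alpha>)"
proof -
  define g where "g x y = ennreal (if 0 < x \<and> x < y then x powr (- \<alpha>) * y powr (- \<alpha>) * \<bar>x - y\<bar> powr (- \<alpha>) * exp (- (x + y)) else 0)"
    for x y :: real
  define h where "h s x = ennreal (if 0 < s then s powr (- \<alpha>) * (1 + s) powr (- \<alpha>) else 0) *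
      ennreal (if 0 < x then x powr (2 - 3 * \<alpha> - 1) * exp (- ((2 + s) * x)) else 0)" for s x :: real
  have [measurable]: "case_prod g \<in> borel_measurable (borel \<Otimes>\<^sub>M borel)"
    unfolding g_def by measurable
  have [measurable]: "case_prod h \<in> borel_measurable (borel \<Otimes>\<^sub>M borel)"
    unfolding h_def by measurable
  have "(\<integral>\<^sup>+x. \<integral>\<^sup>+y. ennreal (if 0 < x \<and> 0 < y then x powr (- \<alpha>) * y powr (- \<alpha>) * \<bar>x - y\<bar> powr (- \<alpha>) * exp (- (x + y)) else 0)
    \<partial>lborel \<partial>lborel) = (\<integral>\<^sup>+x. \<integral>\<^sup>+y. g x y + g y x \<partial>lborel \<partial>lborel)"
    by (intro nn_integral_cong) (auto simp: g_def abs_minus_commute mult_ac add_ac)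
  also have "\<dots> = (\<integral>\<^sup>+x. \<integral>\<^sup>+y. g x y \<partial>lborel \<partial>lborel) + (\<integral>\<^sup>+x. \<integral>\<^sup>+y. g y x \<partial>lborel \<partial>lborel)"
    by (subst nn_integral_add[symmetric], measurable) (simp add: nn_integral_add)
  also have "(\<integral>\<^sup>+x. \<integral>\<^sup>+y. g y x \<partial>lborel \<partial>lborel) = (\<integral>\<^sup>+x. \<integral>\<^sup>+y. g x y \<partial>lborel \<partial>lborel)"
    by (rule lborel_pair.Fubini') measurable
  also have "(\<integral>\<^sup>+x. \<integral>\<^sup>+y. g x y \<partial>lborel \<partial>lborel) = (\<integral>\<^sup>+x. \<integral>\<^sup>+s. h s x \<partial>lborel \<partial>lborel)"
  proof (rule nn_integral_cong)
    fix x :: real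
    show "(\<integral>\<^sup>+y. g x y \<partial>lborel) = (\<integral>\<^sup>+s. h s x \<partial>lborel)"
    proof (cases "0 < x")
      case False
      then show ?thesis by (simp add: g_def h_def)
    next
      case x: True
      have "(\<integral>\<^sup>+y. g x y \<partial>lborel) = ennreal \<bar>x\<bar> * (\<integral>\<^sup>+s. g x (x + x * s) \<partial>lborel)"
        using x by (intro nn_integral_real_affine) auto
      also have "\<dots> = (\<integral>\<^sup>+s. ennreal \<bar>x\<bar> * g x (x + x * s) \<partial>lborel)"
        by (rule nn_integral_cmult[symmetric]) measurable
      also have "\<dots> = (\<integral>\<^sup>+s. h s x \<partial>lborel)"
      proof (intro nn_integral_cong)
        fix s :: real
        have "x * (x powr (- \<alpha>) * (x + x * s) powr (- \<alpha>) * (x * s) powr (- \<alpha>)) =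
           s powr (- \<alpha>) * (1 + s) powr (- \<alpha>) * x powr (2 - 3 * \<alpha> - 1)" if "0 < s"
        proof -
          have "x + x * s = x * (1 + s)" by (simp add: algebra_simps)
          then have "x * (x powr (- \<alpha>) * (x + x * s) powr (- \<alpha>) * (x * s) powr (- \<alpha>)) =
             s powr (- \<alpha>) * (1 + s) powr (- \<alpha>) * (x powr 1 * x powr (- \<alpha>) * x powr (- \<alpha>) * x powr (- \<alpha>))"
            using x that by (simp add: powr_mult mult_ac)
          then show ?thesis unfolding powr_add[symmetric] by (simp add: algebra_simps)
        qed
        then show "ennreal \<bar>x\<bar> * g x (x + x * s) = h s x"
          using x by (auto simp: g_def h_def zero_less_mult_iff algebra_simps simp flip: ennreal_mult')
      qed
      finally show ?thesis .
    qed
  qed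
  also have "\<dots> = (\<integral>\<^sup>+s. \<integral>\<^sup>+x. h s x \<partial>lborel \<partial>lborel)"
    by (rule lborel_pair.Fubini') measurable
  also have "\<dots> = (\<integral>\<^sup>+s. ennreal (Gamma (2 - 3 * \<alpha>)) * ennreal (if 0 < s then s powr (- \<alpha>) * (1 + s) powr (- \<alpha>) * (2 + s) powr (3 * \<alpha> - 2) else 0) \<partial>lborel)"
  proof (intro nn_integral_cong)
    fix s :: real
    show "(\<integral>\<^sup>+x. h s x \<partial>lborel) = ennreal (Gamma (2 - 3 * \<alpha>)) * ennreal (if 0 < s then s powr (- \<alpha>) * (1 + s) powr (- \<alpha>) * (2 + s) powr (3 * \<alpha> - 2) else 0)"
    proof (cases "0 < s")
      case False
      then show ?thesis by (simp add: h_def)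
    next
      case True
      have "(\<integral>\<^sup>+x. h s x \<partial>lborel) = ennreal (s powr (- \<alpha>) * (1 + s) powr (- \<alpha>)) * ennreal (Gamma (2 - 3 * \<alpha>) / (2 + s) powr (2 - 3 * \<alpha>))"
        unfolding h_def using True \<alpha>
        by (subst nn_integral_cmult, measurable) (subst nn_integral_Gamma_rate, auto)
      then show ?thesis using True \<alpha> powr_minus_divide[of "2 + s" "2 - 3 * \<alpha>"]
        by (simp add: mult_ac flip: ennreal_mult')
    qed
  qed
  also have "\<dots> = ennreal (Gamma (2 - 3 * \<alpha>)) * ennreal (4 powr (\<alpha> - 1) * Beta ((1 - \<alpha>) / 2) (1 - \<alpha>))"
    by (subst nn_integral_cmult, measurable) (simp only: nn_integral_quadratic_beta[OF \<alpha>])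
  also have "\<dots> = ennreal (Gamma (2 - 3 * \<alpha>) * (4 powr (\<alpha> - 1) * Beta ((1 - \<alpha>) / 2) (1 - \<alpha>)))"
    using \<alpha> by (intro ennreal_mult'[symmetric]) auto
  also have "\<dots> + \<dots> = ennreal (Q3 \<alpha>)"
  proof -
    have q: "0 \<le> Gamma (2 - 3 * \<alpha>) * (4 powr (\<alpha> - 1) * Beta ((1 - \<alpha>) / 2) (1 - \<alpha>))"
      unfolding Beta_def using \<alpha>
      by (intro less_imp_le mult_pos_pos divide_pos_pos Gamma_real_pos) (auto simp: field_simps)
    show ?thesis
      unfolding ennreal_plus[OF q q, symmetric] by (simp only: mult_2[symmetric] Q3_eq_Beta[OF \<alpha>])
  qed
  finally show ?thesis .
qed

text \<open>The integrand is symmetric, so the integral is three times that over the region where \<open>u\<close> is the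
  smallest variable.  Measuring \<open>v\<close> and \<open>w\<close> from \<open>u\<close> separates off the factor \<open>\<integral> e\<^sup>-\<^sup>3\<^sup>u du = 1/3\<close>.\<close>

lemma riesz_triple_integral:
  fixes \<alpha> :: real
  assumes \<alpha>: "0 < \<alpha>" "\<alpha> < 2/3"
  shows "(\<integral>\<^sup>+u. \<integral>\<^sup>+v. \<integral>\<^sup>+w. ennreal (riesz_kernel \<alpha> u v * riesz_kernel \<alpha> u w * riesz_kernel \<alpha> v w) \<partial>nu \<partial>nu \<partial>nu) = ennreal (Q3 \<alpha>)"
proof -
  define e :: "real \<Rightarrow> real" where "e u = (if 0 < u then exp (- u) else 0)" for u
  have e0: "0 \<le> e u" for u by (simp add: e_def)
  have [measurable]: "e \<in> borel_measurable borel" unfolding e_def by measurable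
  define G where "G = (\<lambda>(u, v, w). ennreal (e u * e v * e w * (riesz_kernel \<alpha> u v * riesz_kernel \<alpha> u w * riesz_kernel \<alpha> v w)))"
  define H where "H = (\<lambda>(u, v, w). if u < v \<and> u < w then G (u, v, w) else 0)"
  have Gm [measurable]: "G \<in> borel_measurable (borel \<Otimes>\<^sub>M borel \<Otimes>\<^sub>M borel)"
    unfolding G_def by measurable
  have Hm [measurable]: "H \<in> borel_measurable (borel \<Otimes>\<^sub>M borel \<Otimes>\<^sub>M borel)"
    unfolding H_def by measurable
  have "(\<integral>\<^sup>+u. \<integral>\<^sup>+v. \<integral>\<^sup>+w. ennreal (riesz_kernel \<alpha> u v * riesz_kernel \<alpha> u w * riesz_kernel \<alpha> v w) \<partial>nu \<partial>nu \<partial>nu)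
    = (\<integral>\<^sup>+u. \<integral>\<^sup>+v. \<integral>\<^sup>+w. G (u, v, w) \<partial>lborel \<partial>lborel \<partial>lborel)"
  proof -
    have 1: "(\<integral>\<^sup>+w. ennreal (riesz_kernel \<alpha> u v * riesz_kernel \<alpha> u w * riesz_kernel \<alpha> v w) \<partial>nu) =
      (\<integral>\<^sup>+w. ennreal (e w * (riesz_kernel \<alpha> u v * riesz_kernel \<alpha> u w * riesz_kernel \<alpha> v w)) \<partial>lborel)" for u v
      by (subst nn_integral_nu) (auto simp: ennreal_mult' e0 simp flip: e_def)
    have 2: "(\<integral>\<^sup>+v. \<integral>\<^sup>+w. ennreal (riesz_kernel \<alpha> u v * riesz_kernel \<alpha> u w * riesz_kernel \<alpha> v w) \<partial>nu \<partial>nu) =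
      (\<integral>\<^sup>+v. \<integral>\<^sup>+w. ennreal (e v * (e w * (riesz_kernel \<alpha> u v * riesz_kernel \<alpha> u w * riesz_kernel \<alpha> v w))) \<partial>lborel \<partial>lborel)" for u
      unfolding 1 by (subst nn_integral_nu) (auto simp: ennreal_mult' e0 nn_integral_cmult simp flip: e_def)
    show ?thesis
      unfolding 2 by (subst nn_integral_nu)
        (auto simp: ennreal_mult' e0 G_def nn_integral_cmult mult.assoc intro!: nn_integral_cong simp flip: e_def)
  qed
  also have "\<dots> = (\<integral>\<^sup>+u. \<integral>\<^sup>+v. \<integral>\<^sup>+w. H (u, v, w) + (H (v, u, w) + H (w, u, v)) \<partial>lborel \<partial>lborel \<partial>lborel)"
  proof (intro nn_integral_cong)
    fix u v w :: real
    \<comment> \<open>the kernel is \<open>0\<close> on the diagonal, so exactly one of the three terms is nonzero wherever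
      \<open>G\<close> is, even without discarding null sets\<close>
    have "u \<noteq> v \<and> v \<noteq> w \<and> u \<noteq> w \<or> G (u, v, w) = 0 \<and> G (v, u, w) = 0 \<and> G (w, u, v) = 0" by (auto simp: G_def riesz_kernel_def)
    moreover have "G (v, u, w) = G (u, v, w)" "G (w, u, v) = G (u, v, w)"
      by (simp_all add: G_def mult_ac riesz_kernel_commute)
    moreover have "H (a, b, c) = (if a < b \<and> a < c then G (a, b, c) else 0)" for a b c
      by (simp add: H_def)
    ultimately show "G (u, v, w) = H (u, v, w) + (H (v, u, w) + H (w, u, v))"
      by (smt (verit) add.commute add_0)
  qed
  also have "\<dots> = (\<integral>\<^sup>+u. \<integral>\<^sup>+v. \<integral>\<^sup>+w. H (u, v, w) \<partial>lborel \<partial>lborel \<partial>lborel) +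
     ((\<integral>\<^sup>+u. \<integral>\<^sup>+v. \<integral>\<^sup>+w. H (v, u, w) \<partial>lborel \<partial>lborel \<partial>lborel) + (\<integral>\<^sup>+u. \<integral>\<^sup>+v. \<integral>\<^sup>+w. H (w, u, v) \<partial>lborel \<partial>lborel \<partial>lborel))"
    by (simp add: nn_integral_add)
  also have "(\<integral>\<^sup>+u. \<integral>\<^sup>+v. \<integral>\<^sup>+w. H (v, u, w) \<partial>lborel \<partial>lborel \<partial>lborel) = (\<integral>\<^sup>+u. \<integral>\<^sup>+v. \<integral>\<^sup>+w. H (u, v, w) \<partial>lborel \<partial>lborel \<partial>lborel)"
    by (rule lborel_pair.Fubini') measurable
  also have "(\<integral>\<^sup>+u. \<integral>\<^sup>+v. \<integral>\<^sup>+w. H (w, u, v) \<partial>lborel \<partial>lborel \<partial>lborel) = (\<integral>\<^sup>+u. \<integral>\<^sup>+v. \<integral>\<^sup>+w. H (u, v, w) \<partial>lborel \<partial>lborel \<partial>lborel)"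
  proof -
    have "(\<integral>\<^sup>+u. \<integral>\<^sup>+v. \<integral>\<^sup>+w. H (w, u, v) \<partial>lborel \<partial>lborel \<partial>lborel) = (\<integral>\<^sup>+u. \<integral>\<^sup>+w. \<integral>\<^sup>+v. H (w, u, v) \<partial>lborel \<partial>lborel \<partial>lborel)"
      by (intro nn_integral_cong lborel_pair.Fubini') measurable
    also have "\<dots> = (\<integral>\<^sup>+w. \<integral>\<^sup>+u. \<integral>\<^sup>+v. H (w, u, v) \<partial>lborel \<partial>lborel \<partial>lborel)"
      by (rule lborel_pair.Fubini') measurable
    finally show ?thesis .
  qed
  also have "(\<integral>\<^sup>+u. \<integral>\<^sup>+v. \<integral>\<^sup>+w. H (u, v, w) \<partial>lborel \<partial>lborel \<partial>lborel) = (\<integral>\<^sup>+u. ennreal (if 0 < u then exp (- (3 * u)) else 0) * ennreal (Q3 \<alpha>) \<partial>lborel)"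
  proof (intro nn_integral_cong)
    fix u :: real
    have "(\<integral>\<^sup>+v. \<integral>\<^sup>+w. H (u, v, w) \<partial>lborel \<partial>lborel) = (\<integral>\<^sup>+x. \<integral>\<^sup>+w. H (u, u + x, w) \<partial>lborel \<partial>lborel)"
      by (rule nn_integral_shift) measurable
    also have "\<dots> = (\<integral>\<^sup>+x. \<integral>\<^sup>+y. H (u, u + x, u + y) \<partial>lborel \<partial>lborel)"
      by (intro nn_integral_cong nn_integral_shift) measurable
    also have "\<dots> = (\<integral>\<^sup>+x. \<integral>\<^sup>+y. ennreal (if 0 < u then exp (- (3 * u)) else 0) *
       ennreal (if 0 < x \<and> 0 < y then x powr (- \<alpha>) * y powr (- \<alpha>) * \<bar>x - y\<bar> powr (- \<alpha>) * exp (- (x + y)) else 0) \<partial>lborel \<partial>lborel)"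
    proof (intro nn_integral_cong)
      fix x y :: real
      have "exp (- (3 * u)) * exp (- (x + y)) = exp (- u) * exp (- (u + x)) * exp (- (u + y))"
        by (simp flip: exp_add)
      then show "H (u, u + x, u + y) = ennreal (if 0 < u then exp (- (3 * u)) else 0) *
       ennreal (if 0 < x \<and> 0 < y then x powr (- \<alpha>) * y powr (- \<alpha>) * \<bar>x - y\<bar> powr (- \<alpha>) * exp (- (x + y)) else 0)"
        by (auto simp: H_def G_def e_def riesz_kernel_def mult_ac simp flip: ennreal_mult')
    qed
    also have "\<dots> = ennreal (if 0 < u then exp (- (3 * u)) else 0) * ennreal (Q3 \<alpha>)"
      by (simp add: nn_integral_cmult nn_integral_double_kernel[OF \<alpha>])
    finally show "(\<integral>\<^sup>+v. \<integral>\<^sup>+w. H (u, v, w) \<partial>lborel \<partial>lborel) = ennreal (if 0 < u then exp (- (3 * u)) else 0) * ennreal (Q3 \<alpha>)" .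
  qed
  also have "\<dots> = ennreal (1 / 3 * Q3 \<alpha>)"
    by (subst nn_integral_multc, measurable) (subst nn_integral_exp, simp_all flip: ennreal_mult')
  also have "ennreal (1 / 3 * Q3 \<alpha>) + (ennreal (1 / 3 * Q3 \<alpha>) + ennreal (1 / 3 * Q3 \<alpha>)) = ennreal (Q3 \<alpha>)"
  proof -
    have "0 \<le> Q3 \<alpha>" using \<alpha> by (auto simp: Q3_def intro!: mult_nonneg_nonneg divide_nonneg_nonneg less_imp_le)
    then show ?thesis by (simp flip: ennreal_plus)
  qed
  finally show ?thesis .
qed

section \<open>The constants\<close>

definition ln_Gamma_ratio :: "real \<Rightarrow> real" where
  "ln_Gamma_ratio \<alpha> = ln_Gamma (1 - 3 * \<alpha> / 2) - ln_Gamma (1 - \<alpha> / 2) - ln_Gamma (1 - \<alpha>)"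

lemma has_derivative_ln_Gamma_ratio:
  assumes "0 \<le> t" "t < 2/3"
  shows "(ln_Gamma_ratio has_field_derivative
      (Digamma (1 - t) - Digamma (1 - 3*t/2)) + (Digamma (1 - t/2) - Digamma (1 - 3*t/2)) / 2) (at t within S)"
  unfolding ln_Gamma_ratio_def using assms
  by (auto intro!: derivative_eq_intros simp: field_simps)

text \<open>The derivative is a positive combination of differences of digamma values, and
  \<open>1 - 3 \<alpha> / 2\<close> is the smallest of the three arguments.\<close>

lemma ln_Gamma_ratio_strict_mono:
  assumes "0 \<le> x" "x < y" "y < 2/3"
  shows "ln_Gamma_ratio x < ln_Gamma_ratio y"
proof (rule DERIV_pos_imp_increasing_open[OF assms(2)])
  fix t assume t: "x < t" "t < y"
  have "Digamma (1 - 3*t/2) < Digamma (1 - t)" "Digamma (1 - 3*t/2) < Digamma (1 - t/2)"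
    using assms t by (auto intro!: Digamma_real_strict_mono simp: field_simps)
  then have "0 < (Digamma (1 - t) - Digamma (1 - 3*t/2)) + (Digamma (1 - t/2) - Digamma (1 - 3*t/2)) / 2"
    by argo
  with has_derivative_ln_Gamma_ratio[of t] show "\<exists>d. (ln_Gamma_ratio has_real_derivative d) (at t) \<and> d > 0"
    using assms t by auto
next
  show "continuous_on {x..y} ln_Gamma_ratio"
    using assms by (intro DERIV_continuous_on[OF has_derivative_ln_Gamma_ratio]) auto
qed

lemma Q3_ratio_eq_exp:
  assumes "0 \<le> \<alpha>" "\<alpha> < 2/3"
  shows "Q3 \<alpha> / a0 \<alpha> ^ 3 = exp (ln_Gamma_ratio \<alpha>)"
  using assms unfolding Q3_def a0_def ln_Gamma_ratio_def
  by (simp add: Gamma_real_pos_exp exp_diff power2_eq_square power3_eq_cube)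

lemma r_alpha_pos:
  assumes "0 < \<alpha>" "\<alpha> < 2/3"
  shows "0 < r_alpha \<alpha>"
proof -
  have "ln_Gamma_ratio 0 < ln_Gamma_ratio \<alpha>" using assms by (intro ln_Gamma_ratio_strict_mono) auto
  moreover have "ln_Gamma_ratio 0 = 0" by (simp add: ln_Gamma_ratio_def ln_Gamma_real_pos)
  ultimately show ?thesis using assms by (simp add: r_alpha_def Q3_ratio_eq_exp)
qed

lemma r_alpha_mono:
  assumes "0 \<le> \<alpha>" "\<alpha> \<le> \<beta>" "\<beta> < 2/3"
  shows "r_alpha \<alpha> \<le> r_alpha \<beta>"
proof (cases "\<alpha> = \<beta>")
  case False
  then have "ln_Gamma_ratio \<alpha> < ln_Gamma_ratio \<beta>" using assms by (intro ln_Gamma_ratio_strict_mono) auto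
  then show ?thesis using assms by (simp add: r_alpha_def Q3_ratio_eq_exp)
qed simp

lemma r_alpha_half: "r_alpha (1/2) = r_star"
proof -
  have "Gamma (3/4::real) > 0" "Gamma (1/4::real) > 0" by auto
  moreover have "Gamma (1/2::real) > 0" by simp
  ultimately show ?thesis
  unfolding r_alpha_def r_star_def Q3_def a0_def Gamma_one_half_real[symmetric]
  by (simp add: power2_eq_square power3_eq_cube field_simps)
qed

text \<open>With \<open>G = \<Gamma>(1/4)\<close> the claim is \<open>G / (\<surd>\<pi> \<Gamma>(3/4)) < 2\<close>.  The reflection formula removes \<open>\<Gamma>(3/4)\<close> and
  leaves an upper bound for \<open>G\<^sup>2\<close> to be shown.  The bound \<open>\<Gamma>(5/4) \<le> 1\<close> would be too weak; log-convexity
  between \<open>1\<close> and \<open>3/2\<close> suffices.\<close>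

lemma r_star_less_1: "r_star < 1"
proof -
  define G :: real where "G = Gamma (1/4)"
  have G: "G > 0" by (simp add: G_def)
  \<comment> \<open>reflection formula at \<open>1/4\<close>\<close>
  have refl: "G * Gamma (3/4) = sqrt 2 * pi"
  proof -
    have "Gamma (complex_of_real (1/4)) * Gamma (1 - complex_of_real (1/4)) =
       of_real pi / sin (of_real pi * of_real (1/4))" by (rule Gamma_reflection_complex)
    also have "\<dots> = of_real (pi / sin (pi * (1/4)))"
      by (simp only: of_real_divide sin_of_real[symmetric] of_real_mult)
    also have "1 - complex_of_real (1/4) = of_real (1 - 1/4)" by simp
    finally have "complex_of_real (G * Gamma (1 - 1/4)) = of_real (pi / sin (pi * (1/4)))"
      unfolding Gamma_complex_of_real G_def by simp
    then have "G * Gamma (1 - 1/4) = pi / sin (pi * (1/4))" using of_real_eq_iff by blast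
    then have "G * Gamma (3/4) = pi / (sqrt 2 / 2)" by (simp add: sin_45)
    also have "\<dots> = (sqrt 2 * sqrt 2) * pi / sqrt 2" by simp
    also have "\<dots> = sqrt 2 * pi" by (simp del: real_sqrt_mult_self)
    finally show ?thesis .
  qed
  have "G\<^sup>2 \<le> 8 * sqrt pi"
  proof -
    \<comment> \<open>log-convexity at the midpoint \<open>5/4\<close> of \<open>1\<close> and \<open>3/2\<close>\<close>
    have "(ln \<circ> Gamma) ((1 - 1/2) *\<^sub>R 1 + (1/2) *\<^sub>R (3/2)) \<le> (1 - 1/2) * (ln \<circ> Gamma) 1 + (1/2) * (ln \<circ> Gamma) (3/2::real)"
      by (rule convex_onD[OF log_convex_Gamma_real]) auto
    moreover have "Gamma (5/4::real) = G / 4"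
      using Gamma_plus1[of "1/4::real"] nonpos_Ints_nonpos[of "1/4::real"] by (auto simp: G_def)
    moreover have "Gamma (3/2::real) = sqrt pi / 2"
      using Gamma_plus1[of "1/2::real"] nonpos_Ints_nonpos[of "1/2::real"]
      by (auto simp: Gamma_one_half_real)
    ultimately have "2 * ln (G / 4) \<le> ln (sqrt pi / 2)" by simp
    then have "ln ((G/4)\<^sup>2) \<le> ln (sqrt pi / 2)" using G by (simp add: ln_realpow)
    then show ?thesis using G by (simp add: power2_eq_square)
  qed
  have "G / (sqrt pi * Gamma (3/4)) = G\<^sup>2 / (sqrt pi * (sqrt 2 * pi))"
    using G unfolding refl[symmetric] by (simp add: power2_eq_square)
  also have "\<dots> \<le> (8 * sqrt pi) / (sqrt pi * (sqrt 2 * pi))"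
    using \<open>G\<^sup>2 \<le> _\<close> by (intro divide_right_mono) auto
  also have "\<dots> = 4 * sqrt 2 / pi" using real_div_sqrt[of 2] by (simp add: field_simps)
  also have "\<dots> < 2"
  proof -
    have "(2 * sqrt 2)\<^sup>2 < pi\<^sup>2" using pi_gt3 power_strict_mono[of 3 pi 2] by simp
    then have "2 * sqrt 2 < pi" by (rule power2_less_imp_less) simp
    then show ?thesis by (simp add: field_simps)
  qed
  finally show ?thesis by (simp add: r_star_def G_def)
qed

section \<open>Positive operators and the resolvent series\<close>

text \<open>The quadratic polynomial \<open>t \<mapsto> \<langle>f + t g, T (f + t g)\<rangle>\<close> is nonnegative.  The form may be degenerate, so
  \<open>\<langle>g, T g\<rangle> = 0\<close> is a separate case.\<close>

lemma positive_operator_Cauchy_Schwarz: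
  fixes T :: "'a::real_inner \<Rightarrow>\<^sub>L 'a"
  assumes sa: "\<And>f g. inner (T f) g = inner f (T g)" and pos: "\<And>f. 0 \<le> inner f (T f)"
  shows "(inner f (T g))\<^sup>2 \<le> inner f (T f) * inner g (T g)"
proof -
  have quad: "0 \<le> inner f (T f) + 2 * t * inner f (T g) + t\<^sup>2 * inner g (T g)" for t
  proof -
    have "inner g (T f) = inner f (T g)" by (metis sa inner_commute)
    then show ?thesis
      using pos[of "f + t *\<^sub>R g"]
      by (simp add: blinfun.add_right blinfun.scaleR_right inner_add_left inner_add_right
          power2_eq_square algebra_simps)
  qed
  define x y z where "x = inner f (T f)" and "y = inner f (T g)" and "z = inner g (T g)"
  have q: "0 \<le> x + 2 * t * y + t\<^sup>2 * z" for t using quad by (simp add: x_def y_def z_def)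
  have z0: "0 \<le> z" using pos by (simp add: z_def)
  have "y\<^sup>2 \<le> x * z"
  proof (cases "z = 0")
    case True
    have "y = 0"
    proof (rule ccontr)
      assume "y \<noteq> 0"
      then show False using q[of "- (x + 1) / (2 * y)"] True by (simp add: field_simps)
    qed
    then show ?thesis using True by simp
  next
    case False
    then have "0 < z" using z0 by simp
    have "0 \<le> z * (x + 2 * (- y / z) * y + (- y / z)\<^sup>2 * z)"
      by (rule mult_nonneg_nonneg[OF z0 q])
    also have "\<dots> = x * z - y\<^sup>2"
      using \<open>0 < z\<close> by (simp add: field_simps power2_eq_square)
    finally show ?thesis by simp
  qed
  then show ?thesis by (simp add: x_def y_def z_def)
qed

text \<open>The norm of a positive operator is the supremum of its quadratic form: apply the Cauchy--Schwarz
  inequality of the form to \<open>T f\<close> and \<open>f\<close>.\<close>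

lemma positive_operator_norm_le:
  fixes T :: "'a::real_inner \<Rightarrow>\<^sub>L 'a"
  assumes sa: "\<And>f g. inner (T f) g = inner f (T g)" and pos: "\<And>f. 0 \<le> inner f (T f)"
    and k: "0 \<le> k" "\<And>f. inner f (T f) \<le> k * (norm f)\<^sup>2"
  shows "norm T \<le> k"
proof (rule norm_blinfun_bound[OF k(1)])
  fix f
  show "norm (T f) \<le> k * norm f"
  proof (cases "T f = 0")
    case False
    have "((norm (T f))\<^sup>2)\<^sup>2 = (inner (T f) (T f))\<^sup>2"
      by (simp add: power2_norm_eq_inner)
    also have "\<dots> \<le> inner (T f) (T (T f)) * inner f (T f)"
      by (rule positive_operator_Cauchy_Schwarz[OF sa pos])
    also have "\<dots> \<le> (k * (norm (T f))\<^sup>2) * (k * (norm f)\<^sup>2)"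
      using pos k by (intro mult_mono) auto
    finally have "(norm (T f))\<^sup>2 \<le> (k * norm f)\<^sup>2"
      using False by (simp add: power2_eq_square mult_ac)
    then show ?thesis by (rule power2_le_imp_le) (use k in simp)
  qed (use k in simp)
qed

text \<open>Jensen's inequality for the cube and the spectral measure of \<open>T\<close> at \<open>f\<close>, obtained from two
  Cauchy--Schwarz inequalities: with \<open>m\<^sub>k = \<langle>f, T\<^sup>k f\<rangle>\<close> they read \<open>m\<^sub>1\<^sup>2 \<le> m\<^sub>2\<close> and \<open>m\<^sub>2\<^sup>2 \<le> m\<^sub>1 m\<^sub>3\<close>.\<close>

lemma positive_operator_cube_le:
  fixes T :: "'a::real_inner \<Rightarrow>\<^sub>L 'a"
  assumes sa: "\<And>f g. inner (T f) g = inner f (T g)" and pos: "\<And>f. 0 \<le> inner f (T f)"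
    and f: "norm f = 1"
  shows "(inner f (T f)) ^ 3 \<le> inner (T f) (T (T f))"
proof -
  define m n q where "m = inner f (T f)" and "n = (norm (T f))\<^sup>2" and "q = inner (T f) (T (T f))"
  have "\<bar>m\<bar> \<le> norm (T f)" using Cauchy_Schwarz_ineq2[of f "T f"] f by (simp add: m_def)
  then have 1: "m\<^sup>2 \<le> n" unfolding n_def by (metis abs_ge_zero power2_abs power_mono)
  have "n\<^sup>2 \<le> m * q"
    using positive_operator_Cauchy_Schwarz[OF sa pos, of "T f" f]
    by (simp add: m_def n_def q_def power2_norm_eq_inner mult.commute)
  moreover have "(m\<^sup>2)\<^sup>2 \<le> n\<^sup>2" using 1 by (intro power_mono) auto
  ultimately have "m * m ^ 3 \<le> m * q" by (simp add: power2_eq_square power3_eq_cube mult_ac)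
  moreover have "0 \<le> m" "0 \<le> q" using pos by (auto simp: m_def q_def)
  ultimately show ?thesis by (cases "m = 0") (auto simp flip: m_def q_def)
qed

lemma selfadjoint_funpow:
  fixes T :: "'a::real_inner \<Rightarrow>\<^sub>L 'a"
  assumes sa: "\<And>f g. inner (T f) g = inner f (T g)"
  shows "inner (((blinfun_apply T) ^^ j) f) g = inner f (((blinfun_apply T) ^^ j) g)"
proof (induction j arbitrary: g)
  case (Suc j)
  have "inner (((blinfun_apply T) ^^ Suc j) f) g = inner (((blinfun_apply T) ^^ j) f) (T g)"
    by (simp add: sa)
  also have "\<dots> = inner f (((blinfun_apply T) ^^ Suc j) g)"
    by (simp only: Suc funpow_Suc_right o_apply)
  finally show ?case .
qed simp

text \<open>Half of the powers can be moved to the other side of the inner product, which leaves the square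
  of a norm or, for odd \<open>j\<close>, a value of the quadratic form.\<close>

lemma positive_operator_funpow_nonneg:
  fixes T :: "'a::real_inner \<Rightarrow>\<^sub>L 'a"
  assumes sa: "\<And>f g. inner (T f) g = inner f (T g)" and pos: "\<And>f. 0 \<le> inner f (T f)"
  shows "0 \<le> inner f (((blinfun_apply T) ^^ j) f)"
proof -
  obtain k where "j = k + k \<or> j = k + (1 + k)"
    by (metis evenE oddE mult_2 add.assoc add.commute)
  then consider "j = k + k" | "j = k + (1 + k)" by blast
  then show ?thesis
  proof cases
    case 1
    then have "inner f (((blinfun_apply T) ^^ j) f) = inner (((blinfun_apply T) ^^ k) f) (((blinfun_apply T) ^^ k) f)"
      by (simp only: funpow_add o_apply selfadjoint_funpow[OF sa])
    then show ?thesis by simp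
  next
    case 2
    then have "inner f (((blinfun_apply T) ^^ j) f) = inner (((blinfun_apply T) ^^ k) f) (T (((blinfun_apply T) ^^ k) f))"
      by (simp only: funpow_add o_apply selfadjoint_funpow[OF sa] id_apply One_nat_def funpow.simps)
    then show ?thesis using pos by simp
  qed
qed

lemma norm_funpow_blinfun_le:
  fixes T :: "'a::real_normed_vector \<Rightarrow>\<^sub>L 'a"
  shows "norm (((blinfun_apply T) ^^ j) f) \<le> norm T ^ j * norm f"
proof (induction j)
  case (Suc j)
  have "norm (T (((blinfun_apply T) ^^ j) f)) \<le> norm T * norm (((blinfun_apply T) ^^ j) f)"
    by (rule norm_blinfun)
  also have "\<dots> \<le> norm T * (norm T ^ j * norm f)" using Suc by (intro mult_left_mono) auto
  finally show ?case by (simp add: mult_ac)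
qed simp

text \<open>The map \<open>g \<mapsto> (b + T g) / x\<close> is a contraction.\<close>

lemma resolvent_exists:
  fixes T :: "'a::{real_normed_vector,complete_space} \<Rightarrow>\<^sub>L 'a"
  assumes "norm T < x"
  obtains g where "x *\<^sub>R g = b + T g"
proof -
  have x: "0 < x" using assms norm_ge_zero[of T] by linarith
  have "\<exists>!g. (1 / x) *\<^sub>R (b + T g) = g"
  proof (rule banach_fix_type)
    show "norm T / x < 1" "0 \<le> norm T / x" using assms x by auto
    show "\<forall>g h. dist ((1 / x) *\<^sub>R (b + T g)) ((1 / x) *\<^sub>R (b + T h)) \<le> norm T / x * dist g h"
    proof (intro allI)
      fix g h
      have "dist ((1 / x) *\<^sub>R (b + T g)) ((1 / x) *\<^sub>R (b + T h)) = (1 / x) * norm (T (g - h))"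
        using x by (simp add: dist_norm blinfun.diff_right flip: scaleR_diff_right)
      also have "\<dots> \<le> (1 / x) * (norm T * norm (g - h))"
        using x by (intro mult_left_mono norm_blinfun) auto
      finally show "dist ((1 / x) *\<^sub>R (b + T g)) ((1 / x) *\<^sub>R (b + T h)) \<le> norm T / x * dist g h"
        by (simp add: dist_norm)
    qed
  qed
  then obtain g where "g = (1 / x) *\<^sub>R (b + T g)" by metis
  then have "x *\<^sub>R g = x *\<^sub>R ((1 / x) *\<^sub>R (b + T g))" by simp
  then show ?thesis using x by (intro that[of g]) simp
qed

text \<open>Iterating \<open>g = (c b + T g) / x\<close> produces the partial sums with remainder \<open>\<langle>b, T\<^sup>n g\<rangle> / x\<^sup>n\<close>.  The factor
  \<open>c\<close> is kept, so that the statement also covers eigenvectors whose component along the constants is not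
  normalised.\<close>

lemma resolvent_moments_sums:
  fixes T :: "'a::real_inner \<Rightarrow>\<^sub>L 'a"
  assumes x: "norm T < x" and g: "x *\<^sub>R g = c *\<^sub>R b + T g"
  shows "(\<lambda>j. c * (inner b (((blinfun_apply T) ^^ j) b) / x ^ (j + 1))) sums inner b g"
proof -
  have x0: "0 < x" using assms norm_ge_zero[of T] by linarith
  have part: "inner b g - (\<Sum>j<n. c * (inner b (((blinfun_apply T) ^^ j) b) / x ^ (j + 1)))
     = inner b (((blinfun_apply T) ^^ n) g) / x ^ n" for n
  proof (induction n)
    case (Suc n)
    have lin: "((blinfun_apply T) ^^ n) (c *\<^sub>R u + v) = c *\<^sub>R ((blinfun_apply T) ^^ n) u + ((blinfun_apply T) ^^ n) v"
      for u v c
      by (induction n) (simp_all add: blinfun.add_right blinfun.scaleR_right)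
    have "x *\<^sub>R ((blinfun_apply T) ^^ n) g = ((blinfun_apply T) ^^ n) (x *\<^sub>R g + 0)"
      using lin[of x g 0] lin[of "-1" 0 0] by simp
    also have "\<dots> = c *\<^sub>R ((blinfun_apply T) ^^ n) b + ((blinfun_apply T) ^^ Suc n) g"
      by (simp add: g lin funpow_swap1)
    finally have "x * inner b (((blinfun_apply T) ^^ n) g) =
      c * inner b (((blinfun_apply T) ^^ n) b) + inner b (((blinfun_apply T) ^^ Suc n) g)"
      by (metis inner_add_right inner_scaleR_right)
    then have "inner b (((blinfun_apply T) ^^ n) g) / x ^ n =
      c * (inner b (((blinfun_apply T) ^^ n) b) / x ^ (n + 1)) + inner b (((blinfun_apply T) ^^ Suc n) g) / x ^ Suc n"
      using x0 by (simp add: field_simps)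
    then show ?case using Suc by simp
  qed simp
  have "(\<lambda>n. inner b (((blinfun_apply T) ^^ n) g) / x ^ n) \<longlonglongrightarrow> 0"
  proof (rule tendsto_0_le[where K = 1])
    show "(\<lambda>n. norm b * norm g * (norm T / x) ^ n) \<longlonglongrightarrow> 0"
      using x x0 by (intro tendsto_mult_right_zero LIMSEQ_power_zero) auto
    show "\<forall>\<^sub>F n in sequentially. norm (inner b (((blinfun_apply T) ^^ n) g) / x ^ n)
      \<le> norm (norm b * norm g * (norm T / x) ^ n) * 1"
    proof (intro always_eventually allI)
      fix n
      have "\<bar>inner b (((blinfun_apply T) ^^ n) g)\<bar> \<le> norm b * (norm T ^ n * norm g)"
        using Cauchy_Schwarz_ineq2 norm_funpow_blinfun_le by (meson mult_left_mono norm_ge_zero order_trans)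
      then show "norm (inner b (((blinfun_apply T) ^^ n) g) / x ^ n) \<le> norm (norm b * norm g * (norm T / x) ^ n) * 1"
        using x0 by (simp add: abs_mult power_divide divide_right_mono mult_ac)
    qed
  qed
  from tendsto_diff[OF tendsto_const[of "inner b g"] this]
  show ?thesis unfolding sums_def by (simp flip: part)
qed

section \<open>The scalar secular equation\<close>

text \<open>The moments enter only through their signs and geometric bounds.  In the application \<open>a = a\<^sub>0\<close>, \<open>a r\<close> bounds the
  norm of \<open>C\<close>, and \<open>M = \<parallel>b\<parallel>\<^sup>2\<close>.\<close>

locale secular_equation =
  fixes mu :: "nat \<Rightarrow> real" and a r M :: real
  assumes a_pos: "0 < a" and r_nonneg: "0 \<le> r" and r_less_1: "r < 1"
    and mu_nonneg: "0 \<le> mu j" and mu_le: "mu j \<le> M * (a * r) ^ j" and mu_0_pos: "0 < mu 0"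
begin

definition resolvent_sum :: "real \<Rightarrow> real" where
  "resolvent_sum x = (\<Sum>j. mu j / x ^ (j + 1))"

lemma term_le:
  assumes "a \<le> x"
  shows "mu j / x ^ (j + 1) \<le> M / a * r ^ j"
proof -
  have "mu j / x ^ (j + 1) \<le> mu j / a ^ (j + 1)"
    using assms a_pos mu_nonneg by (intro divide_left_mono power_mono) auto
  also have "\<dots> \<le> M * (a * r) ^ j / a ^ (j + 1)"
    using a_pos mu_le by (intro divide_right_mono) auto
  also have "\<dots> = M / a * r ^ j"
    using a_pos by (simp add: power_mult_distrib)
  finally show ?thesis .
qed

lemma term_nonneg: "a \<le> x \<Longrightarrow> 0 \<le> mu j / x ^ (j + 1)"
  using a_pos mu_nonneg by (intro divide_nonneg_nonneg) auto

lemma norm_term_le: "a \<le> x \<Longrightarrow> norm (mu j / x ^ (j + 1)) \<le> M / a * r ^ j"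
  using term_le[of x j] term_nonneg[of x j] by (simp only: real_norm_def abs_of_nonneg)

lemma majorant_summable: "summable (\<lambda>j. M / a * r ^ j)"
  using r_nonneg r_less_1 by (intro summable_mult summable_geometric) auto

lemma summable_resolvent:
  assumes "a \<le> x"
  shows "summable (\<lambda>j. mu j / x ^ (j + 1))"
  by (rule summable_comparison_test'[OF majorant_summable, of 0]) (rule norm_term_le[OF assms])

lemma partial_sum_le:
  assumes "a \<le> x"
  shows "(\<Sum>j\<le>N. mu j / x ^ (j + 1)) \<le> resolvent_sum x"
  unfolding resolvent_sum_def
  using summable_resolvent[OF assms] term_nonneg[OF assms] by (intro sum_le_suminf) auto

lemma partial_sum_antimono:
  assumes "a \<le> x" "x \<le> y"
  shows "(\<Sum>j\<le>N. mu j / y ^ (j + 1)) \<le> (\<Sum>j\<le>N. mu j / x ^ (j + 1))"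
  using assms a_pos mu_nonneg by (intro sum_mono divide_left_mono power_mono) auto

lemma resolvent_sum_antimono:
  assumes "a \<le> x" "x \<le> y"
  shows "resolvent_sum y \<le> resolvent_sum x"
  unfolding resolvent_sum_def
  using assms a_pos mu_nonneg
  by (intro suminf_le summable_resolvent divide_left_mono power_mono) auto

lemma tail_le:
  assumes "a \<le> x"
  shows "resolvent_sum x - (\<Sum>j\<le>N. mu j / x ^ (j + 1)) \<le> M / a * r ^ (N + 1) / (1 - r)"
proof -
  have "resolvent_sum x - (\<Sum>j\<le>N. mu j / x ^ (j + 1)) = (\<Sum>j. mu (j + (N + 1)) / x ^ ((j + (N + 1)) + 1))"
    unfolding resolvent_sum_def
    by (subst suminf_minus_initial_segment[OF summable_resolvent[OF assms]])
       (simp add: lessThan_Suc_atMost)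
  also have "\<dots> \<le> (\<Sum>j. M / a * r ^ (j + (N + 1)))"
    by (intro suminf_le term_le assms
        summable_ignore_initial_segment[OF summable_resolvent[OF assms], of "N + 1"]
        summable_ignore_initial_segment[OF majorant_summable, of "N + 1"])
  also have "\<dots> = (\<Sum>j. M / a * r ^ (N + 1) * r ^ j)"
    by (simp add: power_add mult_ac)
  also have "\<dots> = M / a * r ^ (N + 1) / (1 - r)"
    using r_nonneg r_less_1 by (subst suminf_mult) (auto simp: suminf_geometric summable_geometric)
  finally show ?thesis .
qed

lemma continuous_on_resolvent_sum: "continuous_on {a..} resolvent_sum"
proof (rule uniform_limit_theorem)
  show "uniform_limit {a..} (\<lambda>n x. \<Sum>j<n. mu j / x ^ (j + 1)) resolvent_sum sequentially"
    unfolding resolvent_sum_def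
    by (intro Weierstrass_m_test[OF _ majorant_summable] norm_term_le) simp
  show "\<forall>\<^sub>F n in sequentially. continuous_on {a..} (\<lambda>x. \<Sum>j<n. mu j / x ^ (j + 1))"
    using a_pos by (intro always_eventually allI continuous_intros) auto
qed simp

text \<open>The right-hand side is continuous and decreasing on \<open>[a, \<infinity>)\<close>, and at \<open>a\<close> it is larger than \<open>a\<close>; the
  intermediate value theorem is applied between \<open>a\<close> and the value at \<open>a\<close>.\<close>

lemma ex1_root: "\<exists>!x. a < x \<and> x = a + resolvent_sum x"
proof (rule ex_ex1I)
  define c where "c = a + resolvent_sum a"
  have "0 < resolvent_sum a"
    using partial_sum_le[of a 0] divide_pos_pos[OF mu_0_pos a_pos] by simp
  then have "a < c" by (simp add: c_def)
  have "\<exists>x\<ge>a. x \<le> c \<and> x - (a + resolvent_sum x) = 0"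
  proof (rule IVT')
    show "a - (a + resolvent_sum a) \<le> 0" using \<open>0 < resolvent_sum a\<close> by simp
    show "0 \<le> c - (a + resolvent_sum c)"
      using resolvent_sum_antimono[of a c] \<open>a < c\<close> by (simp add: c_def)
    show "continuous_on {a..c} (\<lambda>x. x - (a + resolvent_sum x))"
      by (intro continuous_intros continuous_on_subset[OF continuous_on_resolvent_sum]) auto
  qed (use \<open>a < c\<close> in simp)
  then obtain x where x: "a \<le> x" "x = a + resolvent_sum x" by auto
  then have "x \<noteq> a" using \<open>0 < resolvent_sum a\<close> by auto
  with x(1) have "a < x" by simp
  with x(2) show "\<exists>x. a < x \<and> x = a + resolvent_sum x" by blast
next
  fix x y assume "a < x \<and> x = a + resolvent_sum x" "a < y \<and> y = a + resolvent_sum y"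
  then show "x = y"
    using resolvent_sum_antimono[of x y] resolvent_sum_antimono[of y x] by linarith
qed

context
  fixes lam :: real and lamN :: "nat \<Rightarrow> real"
  assumes lam: "a < lam" "lam = a + resolvent_sum lam"
    and lamN: "\<And>N. a < lamN N" "\<And>N. lamN N = a + (\<Sum>j\<le>N. mu j / lamN N ^ (j + 1))"
begin

lemma truncated_root_le: "lamN N \<le> lam"
proof (rule ccontr)
  assume "\<not> lamN N \<le> lam"
  then have "(\<Sum>j\<le>N. mu j / lamN N ^ (j + 1)) \<le> (\<Sum>j\<le>N. mu j / lam ^ (j + 1))"
    using lam by (intro partial_sum_antimono) auto
  also have "\<dots> \<le> resolvent_sum lam" using lam by (intro partial_sum_le) auto
  finally show False using \<open>\<not> _\<close> lam(2) lamN(2)[of N] by linarith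
qed

lemma incseq_truncated_root: "incseq lamN"
proof (rule incseq_SucI, rule ccontr)
  fix N assume *: "\<not> lamN N \<le> lamN (Suc N)"
  have "(\<Sum>j\<le>N. mu j / lamN N ^ (j + 1)) \<le> (\<Sum>j\<le>N. mu j / lamN (Suc N) ^ (j + 1))"
    using * lamN(1) by (intro partial_sum_antimono) (auto intro: less_imp_le)
  also have "\<dots> \<le> (\<Sum>j\<le>Suc N. mu j / lamN (Suc N) ^ (j + 1))"
    using term_nonneg[of "lamN (Suc N)" "Suc N"] lamN(1)[of "Suc N"] by simp
  finally show False using * lamN(2)[of N] lamN(2)[of "Suc N"] by linarith
qed

text \<open>At \<open>lamN N \<le> lam\<close> the truncated sum is at least as large as at \<open>lam\<close>, so the error of the root is
  at most the tail of the series at \<open>lam\<close>.\<close>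

lemma truncation_error: "lam - lamN N \<le> M / a * r ^ (N + 1) / (1 - r)"
proof -
  have "(\<Sum>j\<le>N. mu j / lam ^ (j + 1)) \<le> (\<Sum>j\<le>N. mu j / lamN N ^ (j + 1))"
    using lamN(1)[of N] truncated_root_le by (intro partial_sum_antimono) auto
  then have "lam - lamN N \<le> resolvent_sum lam - (\<Sum>j\<le>N. mu j / lam ^ (j + 1))"
    using lam(2) lamN(2)[of N] by linarith
  also have "\<dots> \<le> M / a * r ^ (N + 1) / (1 - r)"
    using lam(1) by (intro tail_le) simp
  finally show ?thesis .
qed

lemma truncated_root_tendsto: "lamN \<longlonglongrightarrow> lam"
proof -
  have "(\<lambda>N. r ^ (N + 1)) \<longlonglongrightarrow> 0"
    using LIMSEQ_Suc[OF LIMSEQ_power_zero[of r]] r_nonneg r_less_1 by simp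
  from tendsto_mult_left[OF this, of "M / a / (1 - r)"]
  have lim: "(\<lambda>N. M / a * r ^ (N + 1) / (1 - r)) \<longlonglongrightarrow> 0"
    by simp
  have "(\<lambda>N. lam - lamN N) \<longlonglongrightarrow> 0"
  proof (rule tendsto_sandwich[OF _ _ tendsto_const lim])
    show "\<forall>\<^sub>F N in sequentially. 0 \<le> lam - lamN N"
      using truncated_root_le by simp
    show "\<forall>\<^sub>F N in sequentially. lam - lamN N \<le> M / a * r ^ (N + 1) / (1 - r)"
      by (intro always_eventually allI truncation_error)
  qed
  from tendsto_diff[OF tendsto_const[of lam] this] show ?thesis by simp
qed

end

end

section \<open>The trace inequality\<close>

lift_definition interval_vec :: "real \<Rightarrow> real \<times> real \<Rightarrow> L2nu" is interval_fun
  by (simp add: sq_integrable_interval_fun)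

context
  fixes \<alpha> :: real
  assumes \<alpha>: "0 < \<alpha>" "\<alpha> < 1"
begin

lemma riesz_op_quadratic_form:
  shows "integrable plane (\<lambda>\<omega>. (inner (interval_vec \<alpha> \<omega>) f)\<^sup>2)"
    and "inner f (riesz_op \<alpha> f) = (\<integral>\<omega>. (inner (interval_vec \<alpha> \<omega>) f)\<^sup>2 \<partial>plane)"
proof -
  show "integrable plane (\<lambda>\<omega>. (inner (interval_vec \<alpha> \<omega>) f)\<^sup>2)"
    by (transfer fixing: \<alpha>) (simp add: riesz_quadratic_form(1)[OF \<alpha>])
  show "inner f (riesz_op \<alpha> f) = (\<integral>\<omega>. (inner (interval_vec \<alpha> \<omega>) f)\<^sup>2 \<partial>plane)"
    unfolding riesz_op.rep_eq
    by (transfer fixing: \<alpha>) (simp add: \<alpha> riesz_quadratic_form(2)[OF \<alpha>, unfolded riesz_kernel_def])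
qed

lemma riesz_op_selfadjoint: "inner (riesz_op \<alpha> f) g = inner f (riesz_op \<alpha> g)"
  using \<alpha> unfolding riesz_op.rep_eq
  by (transfer fixing: \<alpha>) (simp add: riesz_form_symmetric flip: riesz_kernel_def)

lemma riesz_op_nonneg: "0 \<le> inner f (riesz_op \<alpha> f)"
  unfolding riesz_op_quadratic_form(2) by (rule Bochner_Integration.integral_nonneg) simp

lemma norm_riesz_op_interval_vec:
  "(norm (riesz_op \<alpha> (interval_vec \<alpha> \<omega>)))\<^sup>2 = (\<integral>v. (\<integral>u. riesz_kernel \<alpha> v u * interval_fun \<alpha> \<omega> u \<partial>nu)\<^sup>2 \<partial>nu)"
  using \<alpha> unfolding riesz_op.rep_eq power2_norm_eq_inner
  by (transfer fixing: \<alpha> \<omega>) (simp add: power2_eq_square flip: riesz_kernel_def)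

text \<open>Two diagonal entries of \<open>S\<^sup>3\<close> sum to at most its trace: the trace is the integral of \<open>\<parallel>S \<phi>\<^sub>\<omega>\<parallel>\<^sup>2\<close>,
  and for each \<open>\<omega>\<close> Bessel's inequality bounds the contribution of \<open>e\<^sub>1\<close> and \<open>e\<^sub>2\<close> by that integrand.\<close>

lemma trace_cube_ineq:
  assumes "\<alpha> < 2/3"
    and e: "inner e1 e1 = 1" "inner e2 e2 = 1" "inner e1 e2 = 0"
  shows "inner (riesz_op \<alpha> e1) (riesz_op \<alpha> (riesz_op \<alpha> e1)) + inner (riesz_op \<alpha> e2) (riesz_op \<alpha> (riesz_op \<alpha> e2)) \<le> Q3 \<alpha>"
proof -
  let ?S = "riesz_op \<alpha>" and ?\<phi> = "interval_vec \<alpha>"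
  have Bessel: "(inner x e1)\<^sup>2 + (inner x e2)\<^sup>2 \<le> (norm x)\<^sup>2" for x
  proof -
    have "0 \<le> inner (x - inner x e1 *\<^sub>R e1 - inner x e2 *\<^sub>R e2) (x - inner x e1 *\<^sub>R e1 - inner x e2 *\<^sub>R e2)"
      by (rule inner_ge_zero)
    also have "\<dots> = inner x x - (inner x e1)\<^sup>2 - (inner x e2)\<^sup>2"
      using e by (simp add: inner_diff_left inner_diff_right inner_commute[of e1 x]
          inner_commute[of e2 x] inner_commute[of e2 e1] power2_eq_square)
    finally show ?thesis by (simp add: power2_norm_eq_inner)
  qed
  have int: "integrable plane (\<lambda>\<omega>. (inner (?\<phi> \<omega>) (?S e1))\<^sup>2 + (inner (?\<phi> \<omega>) (?S e2))\<^sup>2)"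
    by (intro Bochner_Integration.integrable_add riesz_op_quadratic_form(1))
  have eq: "inner (?S e1) (?S (?S e1)) + inner (?S e2) (?S (?S e2)) = (\<integral>\<omega>. (inner (?\<phi> \<omega>) (?S e1))\<^sup>2 + (inner (?\<phi> \<omega>) (?S e2))\<^sup>2 \<partial>plane)"
    by (simp add: riesz_op_quadratic_form)
  have "ennreal (inner (?S e1) (?S (?S e1)) + inner (?S e2) (?S (?S e2))) = (\<integral>\<^sup>+\<omega>. ennreal ((inner (?\<phi> \<omega>) (?S e1))\<^sup>2 + (inner (?\<phi> \<omega>) (?S e2))\<^sup>2) \<partial>plane)"
    unfolding eq by (rule nn_integral_eq_integral[OF int, symmetric]) simp
  also have "\<dots> \<le> (\<integral>\<^sup>+\<omega>. ennreal ((norm (?S (?\<phi> \<omega>)))\<^sup>2) \<partial>plane)"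
    by (intro nn_integral_mono ennreal_leI) (simp add: Bessel flip: riesz_op_selfadjoint)
  also have "\<dots> = ennreal (Q3 \<alpha>)"
    unfolding norm_riesz_op_interval_vec nn_integral_riesz_interval_fun[OF \<alpha>]
    using \<alpha> assms by (intro riesz_triple_integral)
  finally show ?thesis
    using \<alpha> assms by (subst (asm) ennreal_le_iff) (auto simp: Q3_def intro!: mult_nonneg_nonneg divide_nonneg_nonneg less_imp_le)
qed

end

section \<open>Block form with respect to the constants\<close>

lemma AE_nu_nonneg: "AE u in nu. 0 \<le> u"
  unfolding nu_def by (subst AE_density) (auto simp: indicator_def)

lemma sq_integrable_exp:
  assumes "0 \<le> s"
  shows "sq_integrable (\<lambda>u. exp (- (s * u)))"
  unfolding sq_integrable_def
proof
  show "integrable nu (\<lambda>u. (exp (- (s * u)))\<^sup>2)"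
  proof (rule nu.integrable_const_bound[where B = 1])
    show "AE u in nu. norm ((exp (- (s * u)))\<^sup>2) \<le> 1"
      using AE_nu_nonneg by eventually_elim (use assms in \<open>simp add: power_le_one\<close>)
  qed measurable
qed measurable

lift_definition exp_vec :: "L2nu" is "\<lambda>u. exp (- u)"
  using sq_integrable_exp[of 1] by simp

lemma integral_exp_riesz:
  assumes \<alpha>: "0 < \<alpha>" "\<alpha> < 1" and s: "0 \<le> s"
  shows "(\<integral>u. exp (- (s * u)) * (\<integral>v. riesz_kernel \<alpha> u v \<partial>nu) \<partial>nu) = Gamma (1 - \<alpha>) * (1 + (1 + s) powr (\<alpha> - 1)) / (2 + s)"
proof -
  have int: "integrable nu (\<lambda>v. riesz_kernel \<alpha> u v)" for u
  proof (rule integrableI_bounded)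
    show "(\<integral>\<^sup>+v. ennreal (norm (riesz_kernel \<alpha> u v)) \<partial>nu) < \<infinity>"
      using nn_integral_riesz_kernel_le[OF \<alpha>, of u] by (simp add: le_less_trans)
  qed measurable
  have nn: "0 \<le> (\<integral>v. riesz_kernel \<alpha> u v \<partial>nu)" for u by (rule Bochner_Integration.integral_nonneg) simp
  have "(\<integral>\<^sup>+u. ennreal (exp (- (s * u)) * (\<integral>v. riesz_kernel \<alpha> u v \<partial>nu)) \<partial>nu) =
    ennreal (Gamma (1 - \<alpha>) * (1 + (1 + s) powr (\<alpha> - 1)) / (2 + s))"
    using riesz_form_exp[OF \<alpha>(2) s] int by (simp add: ennreal_mult nn nn_integral_eq_integral)
  then have "has_bochner_integral nu (\<lambda>u. exp (- (s * u)) * (\<integral>v. riesz_kernel \<alpha> u v \<partial>nu)) (Gamma (1 - \<alpha>) * (1 + (1 + s) powr (\<alpha> - 1)) / (2 + s))"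
    using \<alpha> s nn by (intro has_bochner_integral_nn_integral) (auto intro!: divide_nonneg_nonneg mult_nonneg_nonneg less_imp_le)
  then show ?thesis by (rule has_bochner_integral_integral_eq)
qed

lemma inner_one_riesz_one:
  assumes \<alpha>: "0 < \<alpha>" "\<alpha> < 1"
  shows "inner const_one (riesz_op \<alpha> const_one) = a0 \<alpha>"
proof -
  have "inner const_one (riesz_op \<alpha> const_one) = (\<integral>u. exp (- (0 * u)) * (\<integral>v. riesz_kernel \<alpha> u v \<partial>nu) \<partial>nu)"
    using \<alpha> unfolding riesz_op.rep_eq by (transfer fixing: \<alpha>) (simp flip: riesz_kernel_def)
  then show ?thesis using integral_exp_riesz[OF \<alpha>, of 0] by (simp add: a0_def)
qed

lemma inner_exp_riesz_one:
  assumes \<alpha>: "0 < \<alpha>" "\<alpha> < 1"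
  shows "inner exp_vec (riesz_op \<alpha> const_one) = a0 \<alpha> * (1 + 2 powr (\<alpha> - 1)) / 3"
proof -
  have "inner exp_vec (riesz_op \<alpha> const_one) = (\<integral>u. exp (- (1 * u)) * (\<integral>v. riesz_kernel \<alpha> u v \<partial>nu) \<partial>nu)"
    using \<alpha> unfolding riesz_op.rep_eq by (transfer fixing: \<alpha>) (simp flip: riesz_kernel_def)
  then show ?thesis using integral_exp_riesz[OF \<alpha>, of 1] by (simp add: a0_def)
qed

lemma inner_exp_one: "inner exp_vec const_one = 1/2"
proof -
  have "(\<integral>\<^sup>+u. ennreal (exp (- u)) \<partial>nu) = (\<integral>\<^sup>+u. ennreal (if 0 < u then exp (- (2 * u)) else 0) \<partial>lborel)"
    by (subst nn_integral_nu) (auto intro!: nn_integral_cong simp flip: ennreal_mult' exp_add)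
  then have "(\<integral>\<^sup>+u. ennreal (exp (- u)) \<partial>nu) = ennreal (1/2)"
    using nn_integral_exp[of 2] by simp
  then have "has_bochner_integral nu (\<lambda>u. exp (- u)) (1/2)"
    by (intro has_bochner_integral_nn_integral) auto
  then have "(\<integral>u. exp (- u) \<partial>nu) = 1/2" by (rule has_bochner_integral_integral_eq)
  then show ?thesis by transfer simp
qed

context
  fixes \<alpha> :: real
  assumes \<alpha>: "0 < \<alpha>" "\<alpha> < 1"
begin

lemma riesz_op_one: "riesz_op \<alpha> const_one = a0 \<alpha> *\<^sub>R const_one + b_vec \<alpha>"
  using inner_one_riesz_one[OF \<alpha>]
  by (simp add: b_vec_def blinfun.diff_left proj_const.rep_eq inner_commute)

lemma b_vec_orthogonal: "inner (b_vec \<alpha>) const_one = 0"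
  by (simp add: b_vec_def blinfun.diff_left proj_const.rep_eq inner_diff_left inner_const_one)

text \<open>If \<open>S 1\<close> were the constant \<open>a\<^sub>0\<close>, its inner product with \<open>u \<mapsto> e\<^sup>-\<^sup>u\<close> would be \<open>a\<^sub>0 / 2\<close>.  The exact value
  \<open>a\<^sub>0 (1 + 2\<^sup>\<alpha>\<^sup>-\<^sup>1) / 3\<close> would then force \<open>2\<^sup>\<alpha> = 1\<close>.\<close>

lemma b_vec_nonzero: "b_vec \<alpha> \<noteq> 0"
proof
  assume "b_vec \<alpha> = 0"
  then have "inner exp_vec (riesz_op \<alpha> const_one) = a0 \<alpha> * inner exp_vec const_one"
    by (simp add: riesz_op_one)
  then have "a0 \<alpha> * (1 + 2 powr (\<alpha> - 1)) / 3 = a0 \<alpha> * (1 / 2)"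
    unfolding inner_exp_riesz_one[OF \<alpha>] inner_exp_one .
  moreover have "0 < a0 \<alpha>" using \<alpha> by (simp add: a0_def)
  ultimately have "2 powr (\<alpha> - 1) * 2 = (1::real)" by (simp add: field_simps)
  then have "2 powr \<alpha> = (1::real)" by (simp add: powr_diff)
  moreover have "1 < (2::real) powr \<alpha>" using \<alpha> by (intro gr_one_powr) auto
  ultimately show False by simp
qed

lemma C_op_eq: "C_op \<alpha> f = riesz_op \<alpha> (f - proj_const f) - proj_const (riesz_op \<alpha> (f - proj_const f))"
  by (simp add: C_op_def blinfun.diff_left)

lemma inner_C_op: "inner f (C_op \<alpha> g) = inner (f - proj_const f) (riesz_op \<alpha> (g - proj_const g))"
  unfolding C_op_eq
  by (simp add: proj_const.rep_eq inner_diff_left inner_diff_right) (simp add: inner_commute)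

lemma C_op_selfadjoint: "inner (C_op \<alpha> f) g = inner f (C_op \<alpha> g)"
  by (metis inner_C_op inner_commute riesz_op_selfadjoint[OF \<alpha>])

lemma C_op_nonneg: "0 \<le> inner f (C_op \<alpha> f)"
  unfolding inner_C_op by (rule riesz_op_nonneg[OF \<alpha>])

lemma C_op_orthogonal: "inner (C_op \<alpha> f) const_one = 0"
  by (simp add: C_op_eq proj_const.rep_eq inner_diff_left inner_const_one)

lemma riesz_op_block:
  assumes "inner g const_one = 0"
  shows "riesz_op \<alpha> (c *\<^sub>R const_one + g) = (c * a0 \<alpha> + inner (b_vec \<alpha>) g) *\<^sub>R const_one + (c *\<^sub>R b_vec \<alpha> + C_op \<alpha> g)"
proof -
  have "inner (riesz_op \<alpha> g) const_one = inner g (riesz_op \<alpha> const_one)"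
    by (rule riesz_op_selfadjoint[OF \<alpha>])
  also have "\<dots> = inner (b_vec \<alpha>) g"
    using assms by (simp add: riesz_op_one inner_add_right inner_commute)
  finally have "C_op \<alpha> g = riesz_op \<alpha> g - inner (b_vec \<alpha>) g *\<^sub>R const_one"
    using assms by (simp add: C_op_eq proj_const.rep_eq)
  then show ?thesis
    by (simp add: blinfun.add_right blinfun.scaleR_right riesz_op_one algebra_simps)
qed

context
  assumes \<alpha>3: "\<alpha> < 2/3"
begin

lemma Q3_eq: "Q3 \<alpha> = a0 \<alpha> ^ 3 * (1 + r_alpha \<alpha> ^ 3)"
proof -
  have "r_alpha \<alpha> ^ 3 = Q3 \<alpha> / a0 \<alpha> ^ 3 - 1"
    unfolding r_alpha_def by (rule odd_real_root_pow) simp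
  moreover have "0 < a0 \<alpha>" using \<alpha> by (simp add: a0_def)
  ultimately show ?thesis by (simp add: field_simps)
qed

text \<open>The trace inequality for \<open>1\<close> and \<open>f\<close>, with each diagonal entry of \<open>S\<^sup>3\<close> bounded below by the cube
  of the corresponding entry of \<open>S\<close>: \<open>a\<^sub>0\<^sup>3 + \<langle>f, S f\<rangle>\<^sup>3 \<le> Q\<^sub>3\<close>.\<close>

lemma riesz_form_le_unit:
  assumes "inner f const_one = 0" "norm f = 1"
  shows "inner f (riesz_op \<alpha> f) \<le> a0 \<alpha> * r_alpha \<alpha>"
proof -
  have a0: "0 < a0 \<alpha>" using \<alpha> by (simp add: a0_def)
  have "a0 \<alpha> ^ 3 \<le> inner (riesz_op \<alpha> const_one) (riesz_op \<alpha> (riesz_op \<alpha> const_one))"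
    using positive_operator_cube_le[of "riesz_op \<alpha>" const_one] riesz_op_selfadjoint[OF \<alpha>] riesz_op_nonneg[OF \<alpha>]
      inner_one_riesz_one[OF \<alpha>] inner_const_one by (simp add: norm_eq_sqrt_inner)
  moreover have "inner f (riesz_op \<alpha> f) ^ 3 \<le> inner (riesz_op \<alpha> f) (riesz_op \<alpha> (riesz_op \<alpha> f))"
    using assms by (intro positive_operator_cube_le riesz_op_selfadjoint riesz_op_nonneg \<alpha>)
  moreover have "inner (riesz_op \<alpha> const_one) (riesz_op \<alpha> (riesz_op \<alpha> const_one)) + inner (riesz_op \<alpha> f) (riesz_op \<alpha> (riesz_op \<alpha> f)) \<le> Q3 \<alpha>"
    using assms \<alpha>3 inner_const_one
    by (intro trace_cube_ineq \<alpha>) (auto simp: norm_eq_1 inner_commute)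
  ultimately have "inner f (riesz_op \<alpha> f) ^ 3 \<le> (a0 \<alpha> * r_alpha \<alpha>) ^ 3"
    unfolding Q3_eq by (simp add: power_mult_distrib distrib_left)
  then show ?thesis
    using a0 r_alpha_pos[OF \<alpha>(1) \<alpha>3] by (simp add: power_mono_iff riesz_op_nonneg[OF \<alpha>])
qed

lemma norm_C_op_le: "norm (C_op \<alpha>) \<le> a0 \<alpha> * r_alpha \<alpha>"
proof (rule positive_operator_norm_le[OF C_op_selfadjoint C_op_nonneg])
  have a0: "0 < a0 \<alpha>" using \<alpha> by (simp add: a0_def)
  then show k: "0 \<le> a0 \<alpha> * r_alpha \<alpha>" using r_alpha_pos[OF \<alpha>(1) \<alpha>3] by simp
  fix f
  define g where "g = f - proj_const f"
  have g: "inner g const_one = 0"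
    by (simp add: g_def proj_const.rep_eq inner_diff_left inner_const_one)
  have "inner f (C_op \<alpha> f) = inner g (riesz_op \<alpha> g)" by (simp add: inner_C_op g_def)
  also have "\<dots> \<le> a0 \<alpha> * r_alpha \<alpha> * (norm g)\<^sup>2"
  proof (cases "g = 0")
    case False
    define h where "h = (1 / norm g) *\<^sub>R g"
    have h: "g = norm g *\<^sub>R h" "norm h = 1" "inner h const_one = 0"
      using False g by (simp_all add: h_def)
    have "inner g (riesz_op \<alpha> g) = (norm g)\<^sup>2 * inner h (riesz_op \<alpha> h)"
      by (subst (1 2) h(1)) (simp add: blinfun.scaleR_right power2_eq_square)
    also have "\<dots> \<le> (norm g)\<^sup>2 * (a0 \<alpha> * r_alpha \<alpha>)"
      using h by (intro mult_left_mono riesz_form_le_unit) auto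
    finally show ?thesis by (simp add: mult.commute)
  qed simp
  also have "\<dots> \<le> a0 \<alpha> * r_alpha \<alpha> * (norm f)\<^sup>2"
  proof (intro mult_left_mono k)
    have "(norm f)\<^sup>2 = (norm g)\<^sup>2 + (inner f const_one)\<^sup>2"
      unfolding power2_norm_eq_inner g_def
      by (simp add: proj_const.rep_eq inner_diff_left inner_diff_right inner_const_one power2_eq_square inner_commute)
    then show "(norm g)\<^sup>2 \<le> (norm f)\<^sup>2" by simp
  qed
  finally show "inner f (C_op \<alpha> f) \<le> a0 \<alpha> * r_alpha \<alpha> * (norm f)\<^sup>2" .
qed

text \<open>The trace inequality for \<open>1\<close> and \<open>f = b / \<parallel>b\<parallel>\<close>.  Here the diagonal entries of \<open>S\<^sup>3\<close> are expanded
  by the block form: the entry at \<open>1\<close> contains \<open>a\<^sub>0\<^sup>3 + 2 a\<^sub>0 \<parallel>b\<parallel>\<^sup>2\<close>, the entry at \<open>f\<close> contains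
  \<open>a\<^sub>0 \<parallel>b\<parallel>\<^sup>2\<close>, and all other terms are nonnegative.\<close>

lemma norm_b_vec_le: "(norm (b_vec \<alpha>))\<^sup>2 \<le> (a0 \<alpha>)\<^sup>2 * r_alpha \<alpha> ^ 3 / 3"
proof -
  let ?S = "riesz_op \<alpha>" and ?e = const_one and ?b = "b_vec \<alpha>" and ?C = "C_op \<alpha>" and ?a = "a0 \<alpha>"
  define n where "n = norm ?b"
  have n: "0 < n" using b_vec_nonzero by (simp add: n_def)
  have bb: "inner ?b ?b = n\<^sup>2" by (simp add: n_def power2_norm_eq_inner)
  define f where "f = (1 / n) *\<^sub>R ?b"
  have b: "?b = n *\<^sub>R f" using n by (simp add: f_def)
  have f: "inner f ?e = 0" "inner f f = 1"
    using n by (simp_all add: f_def b_vec_orthogonal bb power2_eq_square)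
  have Se: "?S ?e = ?a *\<^sub>R ?e + n *\<^sub>R f" using riesz_op_one b by simp
  have Sf: "?S f = n *\<^sub>R ?e + ?C f"
    using riesz_op_block[OF f(1), of 0] f by (simp add: b)
  have Cf: "inner (?C f) ?e = 0" by (rule C_op_orthogonal)
  \<comment> \<open>the entries of \<open>S\<^sup>3\<close> at \<open>e\<close> and \<open>f\<close> are values of the form of \<open>S\<close> at \<open>S e\<close> and \<open>S f\<close>\<close>
  have quad: "inner (c *\<^sub>R ?e + g) (?S (c *\<^sub>R ?e + g)) = c\<^sup>2 * ?a + 2 * c * inner ?b g + inner g (?C g)"
    if g: "inner g ?e = 0" for c g
    unfolding riesz_op_block[OF g]
    using g b_vec_orthogonal C_op_orthogonal[of g] inner_const_one
    by (simp add: inner_add_left inner_add_right inner_commute[of ?e g] inner_commute[of ?e ?b]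
        inner_commute[of ?e "?C g"] inner_commute[of g ?b] power2_eq_square algebra_simps)
  have 1: "inner (?S ?e) (?S (?S ?e)) = ?a\<^sup>2 * ?a + 2 * ?a * n\<^sup>2 + n\<^sup>2 * inner f (?C f)"
    unfolding Se using f by (subst quad) (simp_all add: b blinfun.scaleR_right power2_eq_square)
  have 2: "inner (?S f) (?S (?S f)) = n\<^sup>2 * ?a + 2 * n * (n * inner f (?C f)) + inner (?C f) (?C (?C f))"
    unfolding Sf using Cf by (subst quad) (simp_all add: b)
  have "inner (?S ?e) (?S (?S ?e)) + inner (?S f) (?S (?S f)) \<le> Q3 \<alpha>"
    using f \<alpha>3 inner_const_one by (intro trace_cube_ineq \<alpha>) (auto simp: inner_commute)
  moreover have "0 \<le> n\<^sup>2 * inner f (?C f)" "0 \<le> 2 * n * (n * inner f (?C f))" "0 \<le> inner (?C f) (?C (?C f))"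
    using n C_op_nonneg by auto
  ultimately have "?a * (3 * n\<^sup>2) \<le> ?a * (?a\<^sup>2 * r_alpha \<alpha> ^ 3)"
    unfolding 1 2 Q3_eq by (simp add: power2_eq_square power3_eq_cube algebra_simps)
  moreover have "0 < ?a" using \<alpha> by (simp add: a0_def)
  ultimately show ?thesis by (simp add: n_def)
qed

end

end

text \<open>Write \<open>f = c 1 + g\<close> with \<open>g\<close> orthogonal to \<open>1\<close>.  By the block form, \<open>S f = x f\<close> means
  \<open>c a\<^sub>0 + \<langle>b, g\<rangle> = x c\<close> and \<open>x g = c b + C g\<close>, and the second equation turns \<open>\<langle>b, g\<rangle>\<close> into \<open>c\<close> times the
  series.  Moreover \<open>c \<noteq> 0\<close>, since otherwise \<open>g\<close> would be an eigenvector of \<open>C\<close> for \<open>x > \<parallel>C\<parallel>\<close>.\<close>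

lemma eigenvalue_iff_secular:
  assumes \<alpha>: "0 < \<alpha>" "\<alpha> < 1" and x: "norm (C_op \<alpha>) < x"
  shows "eigenvalue (riesz_op \<alpha>) x \<longleftrightarrow> x = a0 \<alpha> + (\<Sum>j. moment \<alpha> j / x ^ (j + 1))"
proof
  let ?S = "riesz_op \<alpha>" and ?e = const_one and ?b = "b_vec \<alpha>" and ?C = "C_op \<alpha>" and ?a = "a0 \<alpha>"
  have x0: "0 < x" using x norm_ge_zero[of ?C] by linarith
  {
    assume "eigenvalue ?S x"
    then obtain f where f: "f \<noteq> 0" "?S f = x *\<^sub>R f" by (auto simp: eigenvalue_def)
    define c where "c = inner f ?e"
    define g where "g = f - c *\<^sub>R ?e"
    have g: "inner g ?e = 0" by (simp add: g_def c_def inner_diff_left inner_const_one)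
    have feq: "f = c *\<^sub>R ?e + g" by (simp add: g_def)
    have "(c * ?a + inner ?b g) *\<^sub>R ?e + (c *\<^sub>R ?b + ?C g) = (x * c) *\<^sub>R ?e + x *\<^sub>R g"
      using f(2) unfolding feq riesz_op_block[OF \<alpha> g] by (simp add: scaleR_add_right)
    note eq = this
    from arg_cong[OF eq, of "\<lambda>v. inner v ?e"]
    have c: "c * ?a + inner ?b g = x * c"
      using g b_vec_orthogonal[OF \<alpha>] C_op_orthogonal[OF \<alpha>, of g] inner_const_one
      by (simp add: inner_add_left)
    with eq have g': "x *\<^sub>R g = c *\<^sub>R ?b + ?C g" by simp
    have "c \<noteq> 0"
    proof
      assume "c = 0"
      with g' have "norm (x *\<^sub>R g) = norm (?C g)" by simp
      then have "x * norm g = norm (?C g)" using x0 by simp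
      also have "\<dots> \<le> norm ?C * norm g" by (rule norm_blinfun)
      finally have "norm g \<le> 0" using x by (simp add: mult_le_cancel_right)
      with \<open>c = 0\<close> feq f(1) show False by simp
    qed
    have "(\<lambda>j. c * (moment \<alpha> j / x ^ (j + 1))) sums inner ?b g"
      unfolding moment_def by (rule resolvent_moments_sums[OF x g'])
    from sums_mult[OF this, of "1 / c"] have "(\<lambda>j. moment \<alpha> j / x ^ (j + 1)) sums (1 / c * inner ?b g)"
      using \<open>c \<noteq> 0\<close> by (simp only: mult.assoc[symmetric]) simp
    then have "(\<Sum>j. moment \<alpha> j / x ^ (j + 1)) = 1 / c * inner ?b g" by (rule sums_unique[symmetric])
    then have "c * (?a + (\<Sum>j. moment \<alpha> j / x ^ (j + 1))) = c * x"
      using c \<open>c \<noteq> 0\<close> by (simp only: distrib_left) (simp add: mult.commute)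
    with \<open>c \<noteq> 0\<close> show "x = ?a + (\<Sum>j. moment \<alpha> j / x ^ (j + 1))"
      by (simp only: mult_cancel_left) simp
  }
  {
    assume sec: "x = ?a + (\<Sum>j. moment \<alpha> j / x ^ (j + 1))"
    obtain g where g: "x *\<^sub>R g = ?b + ?C g" using resolvent_exists[OF x] .
    from arg_cong[OF g, of "\<lambda>v. inner v ?e"] have ge: "inner g ?e = 0"
      using x0 b_vec_orthogonal[OF \<alpha>] C_op_orthogonal[OF \<alpha>, of g] by (simp add: inner_add_left)
    have "(\<lambda>j. 1 * (moment \<alpha> j / x ^ (j + 1))) sums inner ?b g"
      unfolding moment_def by (rule resolvent_moments_sums[OF x]) (simp add: g)
    then have "x = ?a + inner ?b g" using sec by (simp add: sums_iff)
    then have xs: "1 * ?a + inner ?b g = x" by simp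
    have "?S (1 *\<^sub>R ?e + g) = x *\<^sub>R (1 *\<^sub>R ?e + g)"
      unfolding riesz_op_block[OF \<alpha> ge] xs by (simp add: scaleR_add_right g)
    moreover have "1 *\<^sub>R ?e + g \<noteq> 0"
    proof
      assume "1 *\<^sub>R ?e + g = 0"
      then have "inner (1 *\<^sub>R ?e + g) ?e = 0" by simp
      then show False using ge inner_const_one by (simp add: inner_add_left)
    qed
    ultimately show "eigenvalue ?S x" unfolding eigenvalue_def by blast
  }
qed

section \<open>Leading eigenvalue and truncation error\<close>

theorem proposition6p4:
  fixes \<alpha> :: real
  assumes "0 < \<alpha>" and "\<alpha> \<le> 1/2"
  shows "norm (C_op \<alpha>) \<le> a0 \<alpha> * r_alpha \<alpha> \<and> 0 < r_alpha \<alpha> \<and> r_alpha \<alpha> \<le> r_star \<and> r_star < 1 \<and>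
    (\<forall>j. 0 \<le> moment \<alpha> j) \<and>
    (\<exists>lam. leading_eigenvalue (riesz_op \<alpha>) lam \<and>
      (\<forall>x. x > a0 \<alpha> \<and> summable (\<lambda>j. moment \<alpha> j / x ^ (j + 1)) \<and>
            x = a0 \<alpha> + (\<Sum>j. moment \<alpha> j / x ^ (j + 1)) \<longleftrightarrow> x = lam) \<and>
      (\<forall>lamN :: nat \<Rightarrow> real.
        (\<forall>N. lamN N > a0 \<alpha> \<and> lamN N = a0 \<alpha> + (\<Sum>j\<le>N. moment \<alpha> j / lamN N ^ (j + 1))) \<longrightarrow>
        incseq lamN \<and> lamN \<longlonglongrightarrow> lam \<and>
        (\<forall>N. 0 \<le> (lam - lamN N) / a0 \<alpha> \<and>
             (lam - lamN N) / a0 \<alpha> \<le> r_star ^ (N + 4) / (3 * (1 - r_star)))))"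
proof -
  define a r where "a = a0 \<alpha>" and "r = r_alpha \<alpha>"
  have \<alpha>: "0 < \<alpha>" "\<alpha> < 1" and \<alpha>3: "\<alpha> < 2/3" using assms by auto
  have a: "0 < a" using \<alpha> by (simp add: a_def a0_def)
  have r: "0 < r" "r \<le> r_star"
    using r_alpha_pos[of \<alpha>] r_alpha_mono[of \<alpha> "1/2"] r_alpha_half assms by (auto simp: r_def)
  then have r1: "r < 1" using r_star_less_1 by simp
  have C: "norm (C_op \<alpha>) \<le> a * r" unfolding a_def r_def by (rule norm_C_op_le[OF \<alpha> \<alpha>3])
  have Ca: "norm (C_op \<alpha>) < a"
  proof -
    have "a * r < a * 1" using a r1 by (intro mult_strict_left_mono)
    then show ?thesis using C by linarith
  qed
  have mom0: "0 \<le> moment \<alpha> j" for j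
    unfolding moment_def by (rule positive_operator_funpow_nonneg[OF C_op_selfadjoint[OF \<alpha>] C_op_nonneg[OF \<alpha>]])
  have mom_le: "moment \<alpha> j \<le> (norm (b_vec \<alpha>))\<^sup>2 * (a * r) ^ j" for j
  proof -
    have "moment \<alpha> j \<le> norm (b_vec \<alpha>) * norm ((blinfun_apply (C_op \<alpha>) ^^ j) (b_vec \<alpha>))"
      unfolding moment_def by (rule norm_cauchy_schwarz)
    also have "\<dots> \<le> norm (b_vec \<alpha>) * (norm (C_op \<alpha>) ^ j * norm (b_vec \<alpha>))"
      by (intro mult_left_mono norm_funpow_blinfun_le) auto
    also have "\<dots> \<le> norm (b_vec \<alpha>) * ((a * r) ^ j * norm (b_vec \<alpha>))"
      using C by (intro mult_left_mono mult_right_mono power_mono) auto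
    finally show ?thesis by (simp add: power2_eq_square mult_ac)
  qed
  interpret secular_equation "moment \<alpha>" a r "(norm (b_vec \<alpha>))\<^sup>2"
  proof
    show "0 < moment \<alpha> 0" using b_vec_nonzero[OF \<alpha>] by (simp add: moment_def)
  qed (use a r r1 mom0 mom_le in auto)
  obtain lam where lam: "a < lam" "lam = a + resolvent_sum lam"
    and uniq: "\<And>x. a < x \<Longrightarrow> x = a + resolvent_sum x \<Longrightarrow> x = lam"
    using ex1_root by metis
  have eig: "eigenvalue (riesz_op \<alpha>) x \<longleftrightarrow> x = a + resolvent_sum x" if "a < x" for x
    unfolding resolvent_sum_def a_def
    using that Ca by (intro eigenvalue_iff_secular \<alpha>) (auto simp: a_def)
  have leading: "leading_eigenvalue (riesz_op \<alpha>) lam"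
    unfolding leading_eigenvalue_def
  proof (intro conjI allI impI)
    show "eigenvalue (riesz_op \<alpha>) lam" using eig[OF lam(1)] lam(2) by blast
    fix \<kappa> assume "eigenvalue (riesz_op \<alpha>) \<kappa>"
    then show "\<kappa> \<le> lam" using eig[of \<kappa>] uniq[of \<kappa>] lam(1) by (cases "a < \<kappa>") auto
  qed
  have root: "x > a \<and> summable (\<lambda>j. moment \<alpha> j / x ^ (j + 1)) \<and> x = a + (\<Sum>j. moment \<alpha> j / x ^ (j + 1)) \<longleftrightarrow> x = lam" for x
    unfolding resolvent_sum_def[symmetric]
    using lam uniq[of x] summable_resolvent[of x] by (metis less_imp_le)
  have trunc: "incseq lamN \<and> lamN \<longlonglongrightarrow> lam \<and>
        (\<forall>N. 0 \<le> (lam - lamN N) / a \<and> (lam - lamN N) / a \<le> r_star ^ (N + 4) / (3 * (1 - r_star)))"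
    if lamN: "\<forall>N. lamN N > a \<and> lamN N = a + (\<Sum>j\<le>N. moment \<alpha> j / lamN N ^ (j + 1))" for lamN
  proof (intro conjI allI)
    have N1: "\<And>N. a < lamN N" and N2: "\<And>N. lamN N = a + (\<Sum>j\<le>N. moment \<alpha> j / lamN N ^ (j + 1))"
      using lamN by blast+
    show "incseq lamN" by (rule incseq_truncated_root[OF lam N1 N2])
    show "lamN \<longlonglongrightarrow> lam" by (rule truncated_root_tendsto[OF lam N1 N2])
    fix N
    show "0 \<le> (lam - lamN N) / a"
      using truncated_root_le[OF lam N1 N2, of N] a by simp
    have "lam - lamN N \<le> (norm (b_vec \<alpha>))\<^sup>2 / a * r ^ (N + 1) / (1 - r)"
      by (rule truncation_error[OF lam N1 N2])
    also have "\<dots> \<le> (a\<^sup>2 * r ^ 3 / 3) / a * r ^ (N + 1) / (1 - r)"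
      using norm_b_vec_le[OF \<alpha> \<alpha>3] a r r1
      by (intro divide_right_mono mult_right_mono) (auto simp: a_def r_def)
    \<comment> \<open>three powers of \<open>r\<close> from \<open>b\<close> and \<open>N + 1\<close> from the tail\<close>
    also have "\<dots> = a * (r ^ (N + 4) / (3 * (1 - r)))"
      using a r1 by (simp add: power2_eq_square power3_eq_cube power_add field_simps eval_nat_numeral)
    finally have "(lam - lamN N) / a \<le> r ^ (N + 4) / (3 * (1 - r))"
      using a by (simp add: divide_le_eq mult.commute)
    also have "\<dots> \<le> r_star ^ (N + 4) / (3 * (1 - r_star))"
      using r r_star_less_1 by (intro frac_le power_mono) auto
    finally show "(lam - lamN N) / a \<le> r_star ^ (N + 4) / (3 * (1 - r_star))" .
  qed
  show ?thesis
    using C r r_star_less_1 mom0 leading root trunc unfolding a_def r_def by blast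
qed

end
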